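(* Let $(\Omega,\Sigma,\mu)$ be a $\sigma$-finite measure space, let $\rho\colon L^+(\mu)\to[0,\infty]$ be a modular function norm, and let $\mathbb{X}$ be a quasi-Banach space endowed with a continuous quasi-norm $\|\cdot\|$. Let $$L_\rho(\mathbb{X})=\{f\in L(\mu,\mathbb{X})\colon\rho(u\|f\|)<\infty\text{ for some }u>0\},\qquad B_{\rho,\mathbb{X}}(\varepsilon)=\{f\in L(\mu,\mathbb{X})\colon\rho(\|f\|)<\varepsilon\},\ \varepsilon>0.$$ Then the following hold. (i) $\{uB_{\rho,\mathbb{X}}(\varepsilon)\colon u,\varepsilon\in(0,\infty)\}$ is a neighbourhood basis at the origin for a complete vector topology on $L_\rho(\mathbb{X})$. (ii) $L_\rho(\mathbb{X})=L_{\overline{\rho}}(\mathbb{X})$ with the same topology. (iii) If $\rho$ is pseudo-homogeneous at infinity, then $L_\rho(\mathbb{X})=\{f\in L(\mu,\mathbb{X})\colon\rho(\|f\|)<\infty\}$ and $\{B_{\rho,\mathbb{X}}(\varepsilon)\colon\varepsilon\in(0,\infty)\}$ is a neighbourhood basis at the origin for the topology on $L_\rho(\mathbb{X})$. (iv) If $\rho$ is pseudo-homogeneous at the origin, then $L_\rho(\mathbb{X})=L_{\tilde{\rho}}(\mathbb{X})$ with the same topology, and $L_{\tilde{\rho}}(\mathbb{X})$ endowed with the quasi-norm $\|f\|_0=\tilde{\rho}(\|f\|)$ is a quasi-Banach space. (v) Let $p\in(0,1]$. If $\rho$ is lattice $p$-convex and $\mathbb{X}$ is locally $p$-convex, then $L_\rho(\mathbb{X})$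 is locally $p$-convex.
   Context: Scalars $\mathbb{F}$ are real or complex, and vector topologies are assumed to be Hausdorff. A topological vector space is complete if every Cauchy net converges. A quasi-norm on a vector space is a map $\|\cdot\|$ into $[0,\infty)$ with $\|x\|>0$ for $x\neq0$, $\|\lambda x\|=|\lambda|\|x\|$, and $\|x+y\|\le\kappa(\|x\|+\|y\|)$ for some constant $\kappa$; a quasi-Banach space is a complete quasi-normed space. $\mathbb{X}$ carries its Borel $\sigma$-algebra, and the quasi-norm is assumed continuous for the topology it induces. $L(\mu,\mathbb{X})$ is the vector space of strongly measurable functions $f\colon\Omega\to\mathbb{X}$ (measurable, with values $\mu$-a.e. in a separable subspace of $\mathbb{X}$), modulo equality $\mu$-a.e. $\|f\|$ denotes the function $\omega\mapsto\|f(\omega)\|$. $L^+(\mu)$ is the cone of measurable functions on $\Omega$ with values in $[0,\infty]$ (modulo equality a.e.), and $\Sigma(\mu)$ is the set of $E\in\Sigma$ with $\mu(E)<\infty$. A gauge is a map $\rho\colon L^+(\mu)\to[0,\infty]$ such that $f\le g$ $\mu$-a.e. implies $\rho(f)\le\rho(g)$. A modular function norm is a gauge $\rho$ such that: (a) there are constants $k,r\in(0,\infty)$ with $\rho(f+g)\le k(\rho(rf)+\rho(rg))$ for all $f,g\in L^+(\mu)$; (b) for every $E\in\Sigma(\mu)$ there is $u_E\in(0,\infty)$ such that $\rho(u_E\chi_E)<\infty$ and for every $\varepsilon>0$ there is $\delta>0$ such that $\mu(A)\le\varepsilon$ whenever $A\in\Sigma$, $A\subseteq E$ and $\rho(u_E\chi_A)\le\delta$;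 (c) $\lim_{t\to0^+}\rho(tf)=0$ for all $f\in L^+(\mu)$ with $\rho(f)<\infty$; (d) there is a constant $F\in[1,\infty)$ with $\rho(\lim_nf_n)\le F\lim_n\rho(f_n)$ for all non-decreasing sequences $(f_n)_{n=1}^\infty$ in $L^+(\mu)$. Let $J$ be the set of $t\in(0,\infty)$ for which there is $C\in(0,\infty)$ with $\rho(tf)\le C\rho(f)$ for all $f\in L^+(\mu)$, and for $t\in J$ let $\Delta(t)$ be the infimum of such $C$; always $(0,1]\subseteq J$. The gauge $\rho$ is pseudo-homogeneous at infinity if $J=(0,\infty)$, and pseudo-homogeneous at the origin if $\lim_{t\to0^+}\Delta(t)=0$. For a modular function norm $\rho$ and $f\in L^+(\mu)$ put (with $\inf\emptyset=\infty$) $$\tilde{\rho}(f)=\inf\{t\in(0,\infty)\colon\rho(f/t)<1\},\qquad\overline{\rho}(f)=\inf\{t\in(0,\infty)\colon\rho(f/t)<t\}.$$ $L_{\overline{\rho}}(\mathbb{X})$ and $L_{\tilde{\rho}}(\mathbb{X})$, with their topologies, are defined from $\overline{\rho}$ and $\tilde\rho$ by the same recipe as $L_\rho(\mathbb{X})$ from $\rho$. For $0<p<\infty$, $\rho$ is lattice $p$-convex if there is $C\in[1,\infty)$ with $\rho\big((\sum_{j=1}^ns_j^pf_j^p)^{1/p}\big)\le C\max_{1\le j\le n}\rho(f_j)$ for all $n\in\mathbb{N}$, all $s_1,\dots,s_n\in[0,\infty)$ with $\sum_js_j^p\le1$, and all $f_1,\dots,f_n\in L^+(\mu)$. For $p\in(0,1]$,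 a subset $V$ of a vector space is $p$-convex if $su+tv\in V$ for all $u,v\in V$ and all $s,t\in\mathbb{F}$ with $|s|^p+|t|^p\le1$; a topological vector space is locally $p$-convex if it has a neighbourhood basis at the origin consisting of $p$-convex sets. *)

theory Defs
  imports "HOL-Analysis.Analysis" "HOL-Algebra.Module" "HOL-Algebra.Algebraic_Closure_Type"
begin

section \<open>Topological vector spaces on a carrier\<close>

text \<open>
  Vector spaces are module records over the ring \<open>ring_of_type_algebra\<close> of a scalar type \<open>'k\<close>,
  so that spaces of classes of functions (a carrier, not a type) and the target space are handled
  by the same notions; the multiplicative components of the record are irrelevant.
  The scalar field is a type of class \<open>real_normed_field\<close>. Its instances include \<open>real\<close> and
  \<open>complex\<close>, and by the Gelfand-Mazur theorem there are no others up to isometric isomorphism.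
\<close>

abbreviation vspace :: "('k::real_normed_field, 'v) module \<Rightarrow> bool" where
  "vspace V \<equiv> Module.module (ring_of_type_algebra :: 'k ring) V"

definition typ_vspace :: "('k::real_normed_field \<Rightarrow> 'b::ab_group_add \<Rightarrow> 'b) \<Rightarrow> ('k, 'b) module" where
  "typ_vspace smul = \<lparr>carrier = UNIV, monoid.mult = undefined, one = undefined,
     zero = 0, add = (+), smult = smul\<rparr>"

definition vector_topology :: "('k::real_normed_field, 'v) module \<Rightarrow> 'v topology \<Rightarrow> bool" where
  "vector_topology V T \<longleftrightarrow> vspace V \<and> topspace T = carrier V \<and> Hausdorff_space T \<and>
     continuous_map (prod_topology T T) T (\<lambda>(x, y). x \<oplus>\<^bsub>V\<^esub> y) \<and>
     continuous_map (prod_topology euclidean T) T (\<lambda>(c, x). c \<odot>\<^bsub>V\<^esub> x)"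

definition nbhd_basis_at :: "'v topology \<Rightarrow> 'v \<Rightarrow> 'v set set \<Rightarrow> bool" where
  "nbhd_basis_at T x \<B> \<longleftrightarrow>
     (\<forall>N\<in>\<B>. N \<subseteq> topspace T \<and> (\<exists>U. openin T U \<and> x \<in> U \<and> U \<subseteq> N)) \<and>
     (\<forall>U. openin T U \<and> x \<in> U \<longrightarrow> (\<exists>N\<in>\<B>. N \<subseteq> U))"

subsection \<open>Completeness\<close>

definition directed_by :: "'i set \<Rightarrow> ('i \<Rightarrow> 'i \<Rightarrow> bool) \<Rightarrow> bool" where
  "directed_by I pre \<longleftrightarrow> I \<noteq> {} \<and> (\<forall>i\<in>I. pre i i) \<and>
     (\<forall>i\<in>I. \<forall>j\<in>I. \<forall>k\<in>I. pre i j \<longrightarrow> pre j k \<longrightarrow> pre i k) \<and>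
     (\<forall>i\<in>I. \<forall>j\<in>I. \<exists>k\<in>I. pre i k \<and> pre j k)"

definition Cauchy_net ::
  "('k, 'v) module \<Rightarrow> 'v topology \<Rightarrow> 'i set \<Rightarrow> ('i \<Rightarrow> 'i \<Rightarrow> bool) \<Rightarrow> ('i \<Rightarrow> 'v) \<Rightarrow> bool" where
  "Cauchy_net V T I pre x \<longleftrightarrow> directed_by I pre \<and> x ` I \<subseteq> carrier V \<and>
     (\<forall>U. openin T U \<and> \<zero>\<^bsub>V\<^esub> \<in> U \<longrightarrow>
        (\<exists>i\<^sub>0\<in>I. \<forall>i\<in>I. \<forall>j\<in>I. pre i\<^sub>0 i \<and> pre i\<^sub>0 j \<longrightarrow> x i \<ominus>\<^bsub>V\<^esub> x j \<in> U))"

definition net_converges_to ::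
  "'v topology \<Rightarrow> 'i set \<Rightarrow> ('i \<Rightarrow> 'i \<Rightarrow> bool) \<Rightarrow> ('i \<Rightarrow> 'v) \<Rightarrow> 'v \<Rightarrow> bool" where
  "net_converges_to T I pre x l \<longleftrightarrow> l \<in> topspace T \<and>
     (\<forall>U. openin T U \<and> l \<in> U \<longrightarrow> (\<exists>i\<^sub>0\<in>I. \<forall>i\<in>I. pre i\<^sub>0 i \<longrightarrow> x i \<in> U))"

text \<open>
  A definition cannot quantify over all index types. The index sets are taken inside
  \<open>'v \<times> 'v set\<close>; by lemma \<open>complete_tvs_Cauchy_net\<close> below this is no restriction.
\<close>

definition complete_tvs :: "('k, 'v) module \<Rightarrow> 'v topology \<Rightarrow> bool" where
  "complete_tvs V T \<longleftrightarrow>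
     (\<forall>(I :: ('v \<times> 'v set) set) pre x. Cauchy_net V T I pre x \<longrightarrow> (\<exists>l. net_converges_to T I pre x l))"

lemma complete_tvs_Cauchy_net:
  fixes V :: "('k, 'v) module" and I :: "'i set"
  assumes "complete_tvs V T" and C: "Cauchy_net V T I pre x"
  shows "\<exists>l. net_converges_to T I pre x l"
proof -
  define S where "S i = x ` {j \<in> I. pre i j}" for i
  define K where "K = {(v, S i) | v i. i \<in> I \<and> v \<in> S i}"
  define pre' :: "('v \<times> 'v set) \<Rightarrow> ('v \<times> 'v set) \<Rightarrow> bool" where "pre' a b \<longleftrightarrow> snd b \<subseteq> snd a" for a b
  have dir: "directed_by I pre" and xI: "x ` I \<subseteq> carrier V"
    and cau: "\<And>U. openin T U \<and> \<zero>\<^bsub>V\<^esub> \<in> U \<Longrightarrow>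
      \<exists>i\<in>I. \<forall>j\<in>I. \<forall>k\<in>I. pre i j \<and> pre i k \<longrightarrow> x j \<ominus>\<^bsub>V\<^esub> x k \<in> U"
    using C unfolding Cauchy_net_def by simp_all
  note D = dir[unfolded directed_by_def]
  have ne: "I \<noteq> {}" by (rule D[THEN conjunct1])
  have rf: "pre i i" if "i \<in> I" for i
    by (rule D[THEN conjunct2, THEN conjunct1, rule_format, OF that])
  have tr: "pre i k" if "i \<in> I" "j \<in> I" "k \<in> I" "pre i j" "pre j k" for i j k
    by (rule D[THEN conjunct2, THEN conjunct2, THEN conjunct1, rule_format, OF that])
  have ub: "\<exists>k\<in>I. pre i k \<and> pre j k" if "i \<in> I" "j \<in> I" for i j
    by (rule D[THEN conjunct2, THEN conjunct2, THEN conjunct2, rule_format, OF that])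
  have xS: "x i \<in> S i" if "i \<in> I" for i using rf that by (simp add: S_def)
  have S_mono: "S j \<subseteq> S i" if "i \<in> I" "j \<in> I" "pre i j" for i j
    unfolding S_def using tr[OF that(1,2) _ that(3)] by blast
  have inK: "(x i, S i) \<in> K" if "i \<in> I" for i using xS[OF that] that by (auto simp: K_def)
  have fst_snd: "fst a \<in> snd a" if "a \<in> K" for a using that by (auto simp: K_def)
  have "directed_by K pre'"
    unfolding directed_by_def
  proof (intro conjI ballI impI)
    obtain i where "i \<in> I" using ne by blast
    then show "K \<noteq> {}" using inK by blast
  next
    fix a b assume "a \<in> K" "b \<in> K"
    then obtain i j where ij: "i \<in> I" "snd a = S i" "j \<in> I" "snd b = S j" by (auto simp: K_def)
    obtain k where k: "k \<in> I" "pre i k" "pre j k" using ub ij by blast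
    have "pre' a (x k, S k)" "pre' b (x k, S k)" using ij k S_mono by (auto simp: pre'_def)
    then show "\<exists>c\<in>K. pre' a c \<and> pre' b c" using inK k by blast
  qed (auto simp: pre'_def)
  moreover have "fst ` K \<subseteq> carrier V" using xI by (auto simp: K_def S_def)
  moreover have "\<exists>a\<in>K. \<forall>b\<in>K. \<forall>c\<in>K. pre' a b \<and> pre' a c \<longrightarrow> fst b \<ominus>\<^bsub>V\<^esub> fst c \<in> U"
    if "openin T U \<and> \<zero>\<^bsub>V\<^esub> \<in> U" for U
  proof -
    obtain i where i: "i \<in> I"
      and U: "\<And>j k. j \<in> I \<Longrightarrow> k \<in> I \<Longrightarrow> pre i j \<Longrightarrow> pre i k \<Longrightarrow> x j \<ominus>\<^bsub>V\<^esub> x k \<in> U"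
      using cau[OF \<open>openin T U \<and> \<zero>\<^bsub>V\<^esub> \<in> U\<close>] by blast
    have "fst b \<ominus>\<^bsub>V\<^esub> fst c \<in> U" if "b \<in> K" "c \<in> K" "snd b \<subseteq> S i" "snd c \<subseteq> S i" for b c
    proof -
      have "fst b \<in> S i" "fst c \<in> S i" using fst_snd that by blast+
      then show ?thesis using U by (auto simp: S_def)
    qed
    then show ?thesis using inK[OF i] unfolding pre'_def by (intro bexI[of _ "(x i, S i)"]) simp_all
  qed
  ultimately have "Cauchy_net V T K pre' fst" unfolding Cauchy_net_def by blast
  then obtain l where l: "net_converges_to T K pre' fst l"
    using assms(1) unfolding complete_tvs_def by blast
  have "\<exists>i\<in>I. \<forall>j\<in>I. pre i j \<longrightarrow> x j \<in> U" if "openin T U \<and> l \<in> U" for U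
  proof -
    obtain a where a: "a \<in> K" "\<And>b. b \<in> K \<Longrightarrow> pre' a b \<Longrightarrow> fst b \<in> U"
      using l \<open>openin T U \<and> l \<in> U\<close> unfolding net_converges_to_def by blast
    then obtain i where i: "i \<in> I" "snd a = S i" by (auto simp: K_def)
    have "x j \<in> U" if "j \<in> I" "pre i j" for j
    proof -
      have "(x j, S i) \<in> K" using i that by (auto simp: K_def S_def)
      then show ?thesis using a(2)[of "(x j, S i)"] i by (auto simp: pre'_def)
    qed
    then show ?thesis using i by blast
  qed
  then have "net_converges_to T I pre x l" using l unfolding net_converges_to_def by blast
  then show ?thesis ..
qed

subsection \<open>Quasi-norms and local convexity\<close>

definition quasi_norm :: "('k::real_normed_field, 'v) module \<Rightarrow> ('v \<Rightarrow> real) \<Rightarrow> bool" where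
  "quasi_norm V q \<longleftrightarrow>
     (\<forall>x\<in>carrier V. 0 \<le> q x) \<and>
     (\<forall>x\<in>carrier V. x \<noteq> \<zero>\<^bsub>V\<^esub> \<longrightarrow> 0 < q x) \<and>
     (\<forall>c. \<forall>x\<in>carrier V. q (c \<odot>\<^bsub>V\<^esub> x) = norm c * q x) \<and>
     (\<exists>\<kappa>. \<forall>x\<in>carrier V. \<forall>y\<in>carrier V. q (x \<oplus>\<^bsub>V\<^esub> y) \<le> \<kappa> * (q x + q y))"

definition qn_topology :: "('k, 'v) module \<Rightarrow> ('v \<Rightarrow> real) \<Rightarrow> 'v topology" where
  "qn_topology V q = topology (\<lambda>U. U \<subseteq> carrier V \<and>
     (\<forall>x\<in>U. \<exists>e>0. \<forall>y\<in>carrier V. q (y \<ominus>\<^bsub>V\<^esub> x) < e \<longrightarrow> y \<in> U))"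

lemma openin_qn_topology:
  "openin (qn_topology V q) U \<longleftrightarrow> U \<subseteq> carrier V \<and>
     (\<forall>x\<in>U. \<exists>e>0. \<forall>y\<in>carrier V. q (y \<ominus>\<^bsub>V\<^esub> x) < e \<longrightarrow> y \<in> U)"
proof -
  have "istopology (\<lambda>U. U \<subseteq> carrier V \<and>
     (\<forall>x\<in>U. \<exists>e>0. \<forall>y\<in>carrier V. q (y \<ominus>\<^bsub>V\<^esub> x) < e \<longrightarrow> y \<in> U))" (is "istopology ?P")
    unfolding istopology_def
  proof (intro conjI allI impI)
    fix A B assume A: "?P A" and B: "?P B"
    show "A \<inter> B \<subseteq> carrier V" using A by blast
    show "\<forall>x\<in>A \<inter> B. \<exists>e>0. \<forall>y\<in>carrier V. q (y \<ominus>\<^bsub>V\<^esub> x) < e \<longrightarrow> y \<in> A \<inter> B"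
    proof
      fix x assume "x \<in> A \<inter> B"
      then obtain e e' where "e > 0" "e' > 0"
        "\<forall>y\<in>carrier V. q (y \<ominus>\<^bsub>V\<^esub> x) < e \<longrightarrow> y \<in> A" "\<forall>y\<in>carrier V. q (y \<ominus>\<^bsub>V\<^esub> x) < e' \<longrightarrow> y \<in> B"
        using A B by blast
      then show "\<exists>e>0. \<forall>y\<in>carrier V. q (y \<ominus>\<^bsub>V\<^esub> x) < e \<longrightarrow> y \<in> A \<inter> B"
        by (intro exI[of _ "min e e'"]) auto
    qed
  next
    fix \<K> assume K: "\<forall>U\<in>\<K>. ?P U"
    then show "\<Union>\<K> \<subseteq> carrier V" by blast
    show "\<forall>x\<in>\<Union>\<K>. \<exists>e>0. \<forall>y\<in>carrier V. q (y \<ominus>\<^bsub>V\<^esub> x) < e \<longrightarrow> y \<in> \<Union>\<K>"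
      using K by (meson UnionE UnionI)
  qed
  then show ?thesis unfolding qn_topology_def by (simp add: topology_inverse')
qed

definition quasi_banach :: "('k::real_normed_field, 'v) module \<Rightarrow> ('v \<Rightarrow> real) \<Rightarrow> bool" where
  "quasi_banach V q \<longleftrightarrow> vspace V \<and> quasi_norm V q \<and> complete_tvs V (qn_topology V q)"

definition p_convex :: "('k::real_normed_field, 'v) module \<Rightarrow> real \<Rightarrow> 'v set \<Rightarrow> bool" where
  "p_convex V p A \<longleftrightarrow> A \<subseteq> carrier V \<and> (\<forall>u\<in>A. \<forall>v\<in>A. \<forall>s t :: 'k.
     norm s powr p + norm t powr p \<le> 1 \<longrightarrow> s \<odot>\<^bsub>V\<^esub> u \<oplus>\<^bsub>V\<^esub> t \<odot>\<^bsub>V\<^esub> v \<in> A)"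

definition locally_p_convex :: "('k::real_normed_field, 'v) module \<Rightarrow> 'v topology \<Rightarrow> real \<Rightarrow> bool" where
  "locally_p_convex V T p \<longleftrightarrow> (\<exists>\<B>. nbhd_basis_at T \<zero>\<^bsub>V\<^esub> \<B> \<and> (\<forall>A\<in>\<B>. p_convex V p A))"

section \<open>Gauges\<close>

text \<open>
  A gauge is given on functions instead of on classes modulo equality a.e.; only its values on
  \<open>borel_measurable M\<close> matter, and monotonicity a.e. makes it depend on the class only.
\<close>

definition gauge_on :: "'a measure \<Rightarrow> (('a \<Rightarrow> ennreal) \<Rightarrow> ennreal) \<Rightarrow> bool" where
  "gauge_on M \<rho> \<longleftrightarrow> (\<forall>f\<in>borel_measurable M. \<forall>g\<in>borel_measurable M.
     (AE x in M. f x \<le> g x) \<longrightarrow> \<rho> f \<le> \<rho> g)"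

definition modular_function_norm :: "'a measure \<Rightarrow> (('a \<Rightarrow> ennreal) \<Rightarrow> ennreal) \<Rightarrow> bool" where
  "modular_function_norm M \<rho> \<longleftrightarrow> gauge_on M \<rho> \<and>
     (\<exists>k r :: real. 0 < k \<and> 0 < r \<and> (\<forall>f\<in>borel_measurable M. \<forall>g\<in>borel_measurable M.
        \<rho> (\<lambda>x. f x + g x) \<le>
          ennreal k * (\<rho> (\<lambda>x. ennreal r * f x) + \<rho> (\<lambda>x. ennreal r * g x)))) \<and>
     (\<forall>E\<in>sets M. emeasure M E < \<infinity> \<longrightarrow> (\<exists>u::real. 0 < u \<and>
        \<rho> (\<lambda>x. ennreal u * indicator E x) < \<infinity> \<and>
        (\<forall>\<epsilon>::real. 0 < \<epsilon> \<longrightarrow> (\<exists>\<delta>::real. 0 < \<delta> \<and> (\<forall>A\<in>sets M. A \<subseteq> E \<longrightarrow>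
           \<rho> (\<lambda>x. ennreal u * indicator A x) \<le> ennreal \<delta> \<longrightarrow> emeasure M A \<le> ennreal \<epsilon>))))) \<and>
     (\<forall>f\<in>borel_measurable M. \<rho> f < \<infinity> \<longrightarrow>
        ((\<lambda>t::real. \<rho> (\<lambda>x. ennreal t * f x)) \<longlongrightarrow> 0) (at_right 0)) \<and>
     (\<exists>F::real. 1 \<le> F \<and> (\<forall>f g. (\<forall>n. f n \<in> borel_measurable M) \<longrightarrow> g \<in> borel_measurable M \<longrightarrow>
        (\<forall>n. AE x in M. f n x \<le> f (Suc n) x) \<longrightarrow>
        (AE x in M. (\<lambda>n::nat. f n x) \<longlonglongrightarrow> g x) \<longrightarrow>
        \<rho> g \<le> ennreal F * lim (\<lambda>n. \<rho> (f n))))"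

definition dilation_bounds :: "'a measure \<Rightarrow> (('a \<Rightarrow> ennreal) \<Rightarrow> ennreal) \<Rightarrow> real \<Rightarrow> real set" where
  "dilation_bounds M \<rho> t =
     {C. 0 < C \<and> (\<forall>f\<in>borel_measurable M. \<rho> (\<lambda>x. ennreal t * f x) \<le> ennreal C * \<rho> f)}"

definition dilation_domain :: "'a measure \<Rightarrow> (('a \<Rightarrow> ennreal) \<Rightarrow> ennreal) \<Rightarrow> real set" where
  "dilation_domain M \<rho> = {t. 0 < t \<and> dilation_bounds M \<rho> t \<noteq> {}}"

text \<open>Only meaningful on \<open>dilation_domain M \<rho>\<close>, which for a gauge contains \<open>(0,1]\<close>.\<close>

definition dilation_const :: "'a measure \<Rightarrow> (('a \<Rightarrow> ennreal) \<Rightarrow> ennreal) \<Rightarrow> real \<Rightarrow> real" where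
  "dilation_const M \<rho> t = Inf (dilation_bounds M \<rho> t)"

definition pseudo_homogeneous_infinity :: "'a measure \<Rightarrow> (('a \<Rightarrow> ennreal) \<Rightarrow> ennreal) \<Rightarrow> bool" where
  "pseudo_homogeneous_infinity M \<rho> \<longleftrightarrow> dilation_domain M \<rho> = {0<..}"

definition pseudo_homogeneous_origin :: "'a measure \<Rightarrow> (('a \<Rightarrow> ennreal) \<Rightarrow> ennreal) \<Rightarrow> bool" where
  "pseudo_homogeneous_origin M \<rho> \<longleftrightarrow> (dilation_const M \<rho> \<longlongrightarrow> 0) (at_right 0)"

definition gauge_tilde :: "(('a \<Rightarrow> ennreal) \<Rightarrow> ennreal) \<Rightarrow> ('a \<Rightarrow> ennreal) \<Rightarrow> ennreal" where
  "gauge_tilde \<rho> f = Inf {ennreal t | t::real. 0 < t \<and> \<rho> (\<lambda>x. f x / ennreal t) < 1}"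

definition gauge_bar :: "(('a \<Rightarrow> ennreal) \<Rightarrow> ennreal) \<Rightarrow> ('a \<Rightarrow> ennreal) \<Rightarrow> ennreal" where
  "gauge_bar \<rho> f = Inf {ennreal t | t::real. 0 < t \<and> \<rho> (\<lambda>x. f x / ennreal t) < ennreal t}"

definition ennreal_rpow :: "ennreal \<Rightarrow> real \<Rightarrow> ennreal" where
  "ennreal_rpow a p = (if a = \<infinity> then \<infinity> else ennreal (enn2real a powr p))"

text \<open>\<open>ennreal_rpow\<close> is only used with positive exponents.\<close>

definition lattice_p_convex :: "'a measure \<Rightarrow> (('a \<Rightarrow> ennreal) \<Rightarrow> ennreal) \<Rightarrow> real \<Rightarrow> bool" where
  "lattice_p_convex M \<rho> p \<longleftrightarrow> (\<exists>C::real. 1 \<le> C \<and>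
     (\<forall>(n::nat) (s :: nat \<Rightarrow> real) f. 1 \<le> n \<longrightarrow>
        (\<forall>j\<in>{1..n}. 0 \<le> s j \<and> f j \<in> borel_measurable M) \<longrightarrow> (\<Sum>j=1..n. s j powr p) \<le> 1 \<longrightarrow>
        \<rho> (\<lambda>x. ennreal_rpow (\<Sum>j=1..n. ennreal (s j powr p) * ennreal_rpow (f j x) p) (1 / p))
          \<le> ennreal C * (MAX j\<in>{1..n}. \<rho> (f j))))"

section \<open>The spaces of vector-valued functions\<close>

text \<open>
  The target space is the type \<open>'b\<close> with the scalar multiplication \<open>smul\<close>, quasi-normed by \<open>q\<close>.
\<close>

abbreviation target_topology :: "('k::real_normed_field \<Rightarrow> 'b::ab_group_add \<Rightarrow> 'b) \<Rightarrow> ('b \<Rightarrow> real) \<Rightarrow> 'b topology" where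
  "target_topology smul q \<equiv> qn_topology (typ_vspace smul) q"

definition strongly_measurable ::
  "'a measure \<Rightarrow> ('k::real_normed_field \<Rightarrow> 'b::ab_group_add \<Rightarrow> 'b) \<Rightarrow> ('b \<Rightarrow> real) \<Rightarrow> ('a \<Rightarrow> 'b) \<Rightarrow> bool" where
  "strongly_measurable M smul q f \<longleftrightarrow>
     f \<in> measurable M (sigma UNIV {U. openin (target_topology smul q) U}) \<and>
     (\<exists>S. submodule S (ring_of_type_algebra :: 'k ring) (typ_vspace smul) \<and>
          separable_space (subtopology (target_topology smul q) S) \<and> (AE x in M. f x \<in> S))"

definition ae_rel ::
  "'a measure \<Rightarrow> ('k::real_normed_field \<Rightarrow> 'b::ab_group_add \<Rightarrow> 'b) \<Rightarrow> ('b \<Rightarrow> real) \<Rightarrow> (('a \<Rightarrow> 'b) \<times> ('a \<Rightarrow> 'b)) set" where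
  "ae_rel M smul q = {(f, g). strongly_measurable M smul q f \<and> strongly_measurable M smul q g \<and>
     (AE x in M. f x = g x)}"

text \<open>
  If \<open>'b\<close> is not separable, a pointwise sum of two strongly measurable functions may fail to be
  measurable on a null set. Then \<open>ae_rel\<close> relates it to nothing, and it contributes \<open>{}\<close> to the
  union defining the sum of classes; representatives with values in a separable subspace everywhere
  contribute the intended class.
\<close>

definition L_all ::
  "'a measure \<Rightarrow> ('k::real_normed_field \<Rightarrow> 'b::ab_group_add \<Rightarrow> 'b) \<Rightarrow> ('b \<Rightarrow> real) \<Rightarrow> ('k, ('a \<Rightarrow> 'b) set) module" where
  "L_all M smul q = \<lparr>
     carrier = {f. strongly_measurable M smul q f} // ae_rel M smul q,
     monoid.mult = undefined, one = undefined,
     zero = ae_rel M smul q `` {\<lambda>_. 0},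
     add = (\<lambda>A B. \<Union>f\<in>A. \<Union>g\<in>B. ae_rel M smul q `` {\<lambda>x. f x + g x}),
     smult = (\<lambda>c A. \<Union>f\<in>A. ae_rel M smul q `` {\<lambda>x. smul c (f x)})\<rparr>"

text \<open>The function \<open>\<parallel>f\<parallel>\<close> for some representative \<open>f\<close> of a class, well-defined up to equality a.e.\<close>

definition pt_norm :: "('b \<Rightarrow> real) \<Rightarrow> ('a \<Rightarrow> 'b) set \<Rightarrow> 'a \<Rightarrow> ennreal" where
  "pt_norm q A = (\<lambda>x. ennreal (q ((SOME f. f \<in> A) x)))"

definition L_space ::
  "'a measure \<Rightarrow> ('k::real_normed_field \<Rightarrow> 'b::ab_group_add \<Rightarrow> 'b) \<Rightarrow> ('b \<Rightarrow> real) \<Rightarrow>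
   (('a \<Rightarrow> ennreal) \<Rightarrow> ennreal) \<Rightarrow> ('k, ('a \<Rightarrow> 'b) set) module" where
  "L_space M smul q \<rho> = L_all M smul q
     \<lparr>carrier := {A \<in> carrier (L_all M smul q).
        \<exists>u::real. 0 < u \<and> \<rho> (\<lambda>x. ennreal u * pt_norm q A x) < \<infinity>}\<rparr>"

definition L_ball ::
  "'a measure \<Rightarrow> ('k::real_normed_field \<Rightarrow> 'b::ab_group_add \<Rightarrow> 'b) \<Rightarrow> ('b \<Rightarrow> real) \<Rightarrow>
   (('a \<Rightarrow> ennreal) \<Rightarrow> ennreal) \<Rightarrow> real \<Rightarrow> ('a \<Rightarrow> 'b) set set" where
  "L_ball M smul q \<rho> \<epsilon> = {A \<in> carrier (L_all M smul q). \<rho> (pt_norm q A) < ennreal \<epsilon>}"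

definition L_basis ::
  "'a measure \<Rightarrow> ('k::real_normed_field \<Rightarrow> 'b::ab_group_add \<Rightarrow> 'b) \<Rightarrow> ('b \<Rightarrow> real) \<Rightarrow>
   (('a \<Rightarrow> ennreal) \<Rightarrow> ennreal) \<Rightarrow> ('a \<Rightarrow> 'b) set set set" where
  "L_basis M smul q \<rho> =
     {(\<lambda>A. (of_real u :: 'k) \<odot>\<^bsub>L_all M smul q\<^esub> A) ` L_ball M smul q \<rho> \<epsilon> | u \<epsilon>. 0 < u \<and> 0 < \<epsilon>}"

text \<open>
  The translation-invariant topology generated by \<open>L_basis\<close>. That the members of \<open>L_basis\<close> are
  neighbourhoods of the origin for it is not built in. When they are, and this is a vector
  topology, it is the only vector topology with \<open>L_basis\<close> as neighbourhood basis at the origin.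
\<close>

definition L_topology ::
  "'a measure \<Rightarrow> ('k::real_normed_field \<Rightarrow> 'b::ab_group_add \<Rightarrow> 'b) \<Rightarrow> ('b \<Rightarrow> real) \<Rightarrow>
   (('a \<Rightarrow> ennreal) \<Rightarrow> ennreal) \<Rightarrow> ('a \<Rightarrow> 'b) set topology" where
  "L_topology M smul q \<rho> = topology (\<lambda>U. U \<subseteq> carrier (L_space M smul q \<rho>) \<and>
     (\<forall>A\<in>U. \<exists>N\<in>L_basis M smul q \<rho>. (\<lambda>B. A \<oplus>\<^bsub>L_all M smul q\<^esub> B) ` N \<subseteq> U))"

end

theory Submission
  imports Defs
begin

text \<open>
  The topology of \<open>L\<^sub>\<rho>(X)\<close> is generated by the balls of the single functional
  \<open>A \<mapsto> inf {t > 0. \<rho>(\<parallel>A\<parallel> / t) < t}\<close>, which behaves like an F-norm except that subadditivity is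
  replaced by uniform continuity of addition at the origin; the other neighbourhood bases are
  compared with these balls. The nondegeneracy condition (b) makes
  this topology finer than local convergence in measure, which gives the Hausdorff property and,
  by the Borel-Cantelli lemma, an almost everywhere convergent subsequence of every Cauchy sequence;
  the Fatou-type condition (d) then turns pointwise convergence into convergence in \<open>L\<^sub>\<rho>(X)\<close>.
  For (v), a \<open>p\<close>-convex neighbourhood in \<open>X\<close> has a Minkowski functional \<open>Q\<close> whose \<open>p\<close>-th power is
  subadditive, and lattice \<open>p\<close>-convexity bounds \<open>\<rho>\<close> of any function dominated by a \<open>p\<close>-combination of
  functions with small \<open>\<rho>\<close>.
\<close>

section \<open>Vector topologies given by a functional\<close>

text \<open>A neighbourhood \<open>u B(\<epsilon>)\<close> has two parameters, a dilation and a
  bound. Giving both the value \<open>t\<close> loses nothing: \<open>\<rho>(h / t) < t\<close>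
  persists when \<open>t\<close> grows, so the infimum of such \<open>t\<close> is one number that
  decides all membership questions up to a change of radius. Every constant of the problem
  (\<open>k\<close> and \<open>r\<close> of (a), \<open>kappa\<close> of the target,
  \<open>F\<close> of (d)) acts on the dilation or on the bound and is absorbed by shrinking the
  radius. The price is that balls need not be open, so the topology is built from uniform smallness
  at the origin alone. The target with its quasi-norm is a second instance of the same locale. The
  other obstacle is a target that is not separable: sums of Borel measurable functions may then fail
  to be measurable, so calculations use representatives all of whose values lie in one separable
  subspace. Continuity of \<open>q\<close> has two uses: it makes the balls of the target open,
  hence norms and limits measurable, and it lets \<open>q (f n - f m)\<close> converge to
  \<open>q (f n - g)\<close> itself, not merely up to a factor, before (d) is applied.\<close>

locale vs_gauge =
  fixes V :: "('k::real_normed_field, 'v) module" and G :: "'v \<Rightarrow> real"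
  assumes vspace: "vspace V"
    and G_add: "0 < e \<Longrightarrow> \<exists>d>0. \<forall>x\<in>carrier V. \<forall>y\<in>carrier V. G x < d \<longrightarrow> G y < d \<longrightarrow> G (x \<oplus>\<^bsub>V\<^esub> y) < e"
    and G_bal: "x \<in> carrier V \<Longrightarrow> norm c \<le> 1 \<Longrightarrow> G (c \<odot>\<^bsub>V\<^esub> x) \<le> G x"
    and G_abs: "x \<in> carrier V \<Longrightarrow> 0 < e \<Longrightarrow> \<exists>d>0. \<forall>c. norm c < d \<longrightarrow> G (c \<odot>\<^bsub>V\<^esub> x) < e"
    and G_sep: "x \<in> carrier V \<Longrightarrow> (\<And>e. 0 < e \<Longrightarrow> G x < e) \<Longrightarrow> x = \<zero>\<^bsub>V\<^esub>"
begin

section \<open>Vector space algebra in a module record\<close>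

sublocale module "ring_of_type_algebra :: 'k ring" V by (rule vspace)

lemma scalars [simp]: "carrier (ring_of_type_algebra :: 'k ring) = UNIV"
  "\<one>\<^bsub>ring_of_type_algebra :: 'k ring\<^esub> = 1" "\<zero>\<^bsub>ring_of_type_algebra :: 'k ring\<^esub> = 0"
  "(a::'k) \<oplus>\<^bsub>ring_of_type_algebra\<^esub> b = a + b" "(a::'k) \<otimes>\<^bsub>ring_of_type_algebra\<^esub> b = a * b"
  by (simp_all add: ring_of_type_algebra_def)

lemma smul_closed [simp]: "x \<in> carrier V \<Longrightarrow> (c::'k) \<odot>\<^bsub>V\<^esub> x \<in> carrier V"
  using smult_closed[of c x] by simp

lemma smul_assoc: "x \<in> carrier V \<Longrightarrow> (a::'k) \<odot>\<^bsub>V\<^esub> (b \<odot>\<^bsub>V\<^esub> x) = (a * b) \<odot>\<^bsub>V\<^esub> x"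
  using smult_assoc1[of a b x] by simp

lemma smul_add_left: "x \<in> carrier V \<Longrightarrow> ((a::'k) + b) \<odot>\<^bsub>V\<^esub> x = a \<odot>\<^bsub>V\<^esub> x \<oplus>\<^bsub>V\<^esub> b \<odot>\<^bsub>V\<^esub> x"
  using smult_l_distr[of a b x] by simp

lemma smul_add_right: "x \<in> carrier V \<Longrightarrow> y \<in> carrier V \<Longrightarrow>
    (a::'k) \<odot>\<^bsub>V\<^esub> (x \<oplus>\<^bsub>V\<^esub> y) = a \<odot>\<^bsub>V\<^esub> x \<oplus>\<^bsub>V\<^esub> a \<odot>\<^bsub>V\<^esub> y"
  using smult_r_distr[of a x y] by simp

lemma smul_1 [simp]: "x \<in> carrier V \<Longrightarrow> (1::'k) \<odot>\<^bsub>V\<^esub> x = x"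
  using smult_one[of x] by simp

lemma smul_0 [simp]: "x \<in> carrier V \<Longrightarrow> (0::'k) \<odot>\<^bsub>V\<^esub> x = \<zero>\<^bsub>V\<^esub>"
  using smult_l_null[of x] by simp

lemma uminus_smul: assumes "x \<in> carrier V" shows "\<ominus>\<^bsub>V\<^esub> x = (-1::'k) \<odot>\<^bsub>V\<^esub> x"
proof -
  have "(-1::'k) \<odot>\<^bsub>V\<^esub> x \<oplus>\<^bsub>V\<^esub> x = ((-1) + 1 :: 'k) \<odot>\<^bsub>V\<^esub> x"
    using assms by (simp only: smul_add_left smul_1)
  then show ?thesis using assms M.minus_equality by simp
qed

lemma minus_closed' [simp]: "x \<in> carrier V \<Longrightarrow> y \<in> carrier V \<Longrightarrow> x \<ominus>\<^bsub>V\<^esub> y \<in> carrier V"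
  by (rule M.minus_closed)

lemma diff_add_diff:
  assumes "x \<in> carrier V" "y \<in> carrier V" "z \<in> carrier V"
  shows "(x \<ominus>\<^bsub>V\<^esub> z) \<oplus>\<^bsub>V\<^esub> (z \<ominus>\<^bsub>V\<^esub> y) = x \<ominus>\<^bsub>V\<^esub> y"
  using assms by (simp add: M.minus_eq M.a_assoc M.r_neg2 M.r_neg1)

lemma diff_self [simp]: "x \<in> carrier V \<Longrightarrow> x \<ominus>\<^bsub>V\<^esub> x = \<zero>\<^bsub>V\<^esub>"
  by (simp add: M.minus_eq M.r_neg)

lemma diff_zero [simp]: "x \<in> carrier V \<Longrightarrow> x \<ominus>\<^bsub>V\<^esub> \<zero>\<^bsub>V\<^esub> = x"
proof -
  have "\<ominus>\<^bsub>V\<^esub> \<zero>\<^bsub>V\<^esub> = \<zero>\<^bsub>V\<^esub>" by (rule M.minus_equality) simp_all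
  then show "x \<in> carrier V \<Longrightarrow> x \<ominus>\<^bsub>V\<^esub> \<zero>\<^bsub>V\<^esub> = x" by (simp add: M.minus_eq)
qed

lemma diff_eq_zero: "x \<in> carrier V \<Longrightarrow> y \<in> carrier V \<Longrightarrow> x \<ominus>\<^bsub>V\<^esub> y = \<zero>\<^bsub>V\<^esub> \<Longrightarrow> x = y"
  using diff_add_diff[of x "\<zero>\<^bsub>V\<^esub>" y] by simp

lemma uminus_diff:
  assumes "x \<in> carrier V" "y \<in> carrier V"
  shows "\<ominus>\<^bsub>V\<^esub> (x \<ominus>\<^bsub>V\<^esub> y) = y \<ominus>\<^bsub>V\<^esub> x"
  using assms by (simp add: M.minus_eq M.minus_add M.a_comm)

lemma diff_add:
  assumes "a \<in> carrier V" "b \<in> carrier V" "x \<in> carrier V" "y \<in> carrier V"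
  shows "(a \<oplus>\<^bsub>V\<^esub> b) \<ominus>\<^bsub>V\<^esub> (x \<oplus>\<^bsub>V\<^esub> y) = (a \<ominus>\<^bsub>V\<^esub> x) \<oplus>\<^bsub>V\<^esub> (b \<ominus>\<^bsub>V\<^esub> y)"
  using assms by (simp add: M.minus_eq M.minus_add M.a_ac)

lemma diff_smul:
  assumes "x \<in> carrier V" "y \<in> carrier V"
  shows "a \<odot>\<^bsub>V\<^esub> y \<ominus>\<^bsub>V\<^esub> b \<odot>\<^bsub>V\<^esub> x = (a::'k) \<odot>\<^bsub>V\<^esub> (y \<ominus>\<^bsub>V\<^esub> x) \<oplus>\<^bsub>V\<^esub> (a - b) \<odot>\<^bsub>V\<^esub> x"
proof -
  have "(a - b) \<odot>\<^bsub>V\<^esub> x = a \<odot>\<^bsub>V\<^esub> x \<ominus>\<^bsub>V\<^esub> b \<odot>\<^bsub>V\<^esub> x"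
    using assms smul_add_left[of x a "-b"] by (simp add: M.minus_eq uminus_smul smul_assoc)
  moreover have "a \<odot>\<^bsub>V\<^esub> (y \<ominus>\<^bsub>V\<^esub> x) = a \<odot>\<^bsub>V\<^esub> y \<ominus>\<^bsub>V\<^esub> a \<odot>\<^bsub>V\<^esub> x"
    using assms by (simp add: M.minus_eq uminus_smul smul_assoc smul_add_right)
  ultimately show ?thesis using assms by (simp add: diff_add_diff)
qed

lemma G_zero: "0 < e \<Longrightarrow> G \<zero>\<^bsub>V\<^esub> < e"
  using G_abs[of "\<zero>\<^bsub>V\<^esub>" e] by (metis M.zero_closed norm_zero smul_0)

lemma G_uminus: "x \<in> carrier V \<Longrightarrow> G (\<ominus>\<^bsub>V\<^esub> x) \<le> G x"
  by (simp add: uminus_smul G_bal)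

lemma G_diff_commute: "x \<in> carrier V \<Longrightarrow> y \<in> carrier V \<Longrightarrow> G (x \<ominus>\<^bsub>V\<^esub> y) = G (y \<ominus>\<^bsub>V\<^esub> x)"
  by (metis G_uminus minus_closed' uminus_diff antisym)

text \<open>\<open>G\<close> is not homogeneous, so \<open>n x\<close> is controlled as a repeated
  sum, with one application of \<open>G_add\<close> per summand.\<close>

lemma G_scale_nat:
  "0 < e \<Longrightarrow> \<exists>d>0. \<forall>x\<in>carrier V. G x < d \<longrightarrow> G ((of_nat n :: 'k) \<odot>\<^bsub>V\<^esub> x) < e"
proof (induction n arbitrary: e)
  case 0
  then show ?case by (auto intro!: exI[of _ 1] simp: G_zero)
next
  case (Suc n)
  obtain d where d: "d > 0" "\<And>x y. x \<in> carrier V \<Longrightarrow> y \<in> carrier V \<Longrightarrow> G x < d \<Longrightarrow> G y < d \<Longrightarrow> G (x \<oplus>\<^bsub>V\<^esub> y) < e"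
    using G_add[OF Suc.prems] by blast
  obtain d' where d': "d' > 0" "\<And>x. x \<in> carrier V \<Longrightarrow> G x < d' \<Longrightarrow> G ((of_nat n :: 'k) \<odot>\<^bsub>V\<^esub> x) < d"
    using Suc.IH[OF d(1)] by blast
  show ?case
    by (rule exI[of _ "min d d'"]) (use d d' in \<open>auto simp: smul_add_left\<close>)
qed

text \<open>For \<open>n > norm c\<close> the vector \<open>c x\<close> is \<open>n\<close> times
  \<open>(c / n) x\<close>, and the inner factor is harmless by \<open>G_bal\<close>.\<close>

lemma G_scale:
  assumes "0 < e"
  shows "\<exists>d>0. \<forall>x\<in>carrier V. G x < d \<longrightarrow> G ((c::'k) \<odot>\<^bsub>V\<^esub> x) < e"
proof -
  obtain n :: nat where n: "norm c < n" using reals_Archimedean2 by blast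
  then have n0: "(of_nat n :: 'k) \<noteq> 0" using norm_ge_zero[of c] by (metis norm_of_nat norm_zero not_le)
  obtain d where d: "d > 0" "\<And>x. x \<in> carrier V \<Longrightarrow> G x < d \<Longrightarrow> G ((of_nat n :: 'k) \<odot>\<^bsub>V\<^esub> x) < e"
    using G_scale_nat[OF assms] by blast
  have "G (c \<odot>\<^bsub>V\<^esub> x) < e" if x: "x \<in> carrier V" "G x < d" for x
  proof -
    have "norm (c / of_nat n) \<le> 1" using n n0 by (auto simp: norm_divide divide_le_eq_1)
    then have "G ((c / of_nat n) \<odot>\<^bsub>V\<^esub> x) < d" using G_bal[OF x(1)] x(2) by (meson le_less_trans)
    from d(2)[OF _ this] show ?thesis using x n0 by (simp add: smul_assoc)
  qed
  with d show ?thesis by blast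
qed

section \<open>The topology generated by the balls of \<open>G\<close>\<close>

abbreviation "T \<equiv> qn_topology V G"

lemma topspace_T [simp]: "topspace T = carrier V"
proof -
  have "openin T (carrier V)" by (auto simp: openin_qn_topology intro: exI[of _ 1])
  then show ?thesis by (metis openin_qn_topology openin_subset openin_topspace subset_antisym)
qed

text \<open>A ball of \<open>G\<close> need not be open, as there is no triangle inequality; this
  lemma supplies an open set inside it that still contains the centre.\<close>

lemma open_nbhd:
  assumes x: "x \<in> carrier V" and e: "0 < e"
  obtains U where "openin T U" "x \<in> U" "\<And>y. y \<in> U \<Longrightarrow> y \<in> carrier V \<and> G (y \<ominus>\<^bsub>V\<^esub> x) < e"
proof
  \<comment> \<open>The points around which some whole ball stays in the \<open>e\<close>-ball of
    \<open>x\<close>. By \<open>G_add\<close>, a good radius \<open>d\<close> at \<open>y\<close>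
    yields a common good radius \<open>d'\<close> at all points of the \<open>d'\<close>-ball of
    \<open>y\<close>, so \<open>?U\<close> is open.\<close>
  let ?U = "{y\<in>carrier V. \<exists>d>0. \<forall>z\<in>carrier V. G (z \<ominus>\<^bsub>V\<^esub> y) < d \<longrightarrow> G (z \<ominus>\<^bsub>V\<^esub> x) < e}"
  show "openin T ?U"
    unfolding openin_qn_topology
  proof (intro conjI ballI)
    fix y assume "y \<in> ?U"
    then obtain d where y: "y \<in> carrier V" and d: "d > 0" "\<And>z. z\<in>carrier V \<Longrightarrow> G (z \<ominus>\<^bsub>V\<^esub> y) < d \<Longrightarrow> G (z \<ominus>\<^bsub>V\<^esub> x) < e"
      by blast
    obtain d' where d': "d' > 0" "\<And>x y. x \<in> carrier V \<Longrightarrow> y \<in> carrier V \<Longrightarrow> G x < d' \<Longrightarrow> G y < d' \<Longrightarrow> G (x \<oplus>\<^bsub>V\<^esub> y) < d"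
      using G_add[OF d(1)] by blast
    have "G (z \<ominus>\<^bsub>V\<^esub> x) < e" if "w \<in> carrier V" "G (w \<ominus>\<^bsub>V\<^esub> y) < d'" "z \<in> carrier V" "G (z \<ominus>\<^bsub>V\<^esub> w) < d'" for w z
      using d'(2)[of "z \<ominus>\<^bsub>V\<^esub> w" "w \<ominus>\<^bsub>V\<^esub> y"] that y d(2) by (simp add: diff_add_diff)
    then show "\<exists>e>0. \<forall>w\<in>carrier V. G (w \<ominus>\<^bsub>V\<^esub> y) < e \<longrightarrow> w \<in> ?U" using d'(1) by blast
  qed auto
  show "x \<in> ?U" using x e by auto
  \<comment> \<open>Take \<open>z = y\<close> in the definition of \<open>?U\<close>; the difference
    is zero and \<open>G_zero\<close> puts it below every \<open>d\<close>.\<close>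
  show "y \<in> carrier V \<and> G (y \<ominus>\<^bsub>V\<^esub> x) < e" if "y \<in> ?U" for y
    using that G_zero by fastforce
qed

lemma nbhd_basis_balls: "nbhd_basis_at T \<zero>\<^bsub>V\<^esub> {{x \<in> carrier V. G x < e} | e. 0 < e}"
  unfolding nbhd_basis_at_def
proof (intro conjI ballI allI impI)
  fix N assume "N \<in> {{x \<in> carrier V. G x < e} | e. 0 < e}"
  then obtain e where e: "0 < e" "N = {x \<in> carrier V. G x < e}" by blast
  then show "N \<subseteq> topspace T" by auto
  show "\<exists>U. openin T U \<and> \<zero>\<^bsub>V\<^esub> \<in> U \<and> U \<subseteq> N"
    by (rule open_nbhd[OF M.zero_closed e(1)]) (use e in \<open>fastforce\<close>)
next
  fix U assume "openin T U \<and> \<zero>\<^bsub>V\<^esub> \<in> U"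
  then obtain e where "e > 0" "\<And>y. y \<in> carrier V \<Longrightarrow> G (y \<ominus>\<^bsub>V\<^esub> \<zero>\<^bsub>V\<^esub>) < e \<Longrightarrow> y \<in> U"
    unfolding openin_qn_topology by blast
  then show "\<exists>N\<in>{{x \<in> carrier V. G x < e} | e. 0 < e}. N \<subseteq> U"
    by (intro bexI[of _ "{x \<in> carrier V. G x < e}"]) auto
qed

text \<open>Reduces every later claim about a neighbourhood basis to a comparison with balls, with
  no open set in sight.\<close>

lemma nbhd_basis_refine:
  assumes "\<And>N. N \<in> \<B> \<Longrightarrow> N \<subseteq> carrier V \<and> (\<exists>e>0. {x \<in> carrier V. G x < e} \<subseteq> N)"
    and "\<And>e. 0 < e \<Longrightarrow> \<exists>N\<in>\<B>. N \<subseteq> {x \<in> carrier V. G x < e}"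
  shows "nbhd_basis_at T \<zero>\<^bsub>V\<^esub> \<B>"
  using nbhd_basis_balls assms unfolding nbhd_basis_at_def
  by (smt (verit) mem_Collect_eq subset_trans topspace_T)

lemma Hausdorff_T: "Hausdorff_space T"
  unfolding Hausdorff_space_def
proof (intro allI impI)
  fix x y assume "x \<in> topspace T \<and> y \<in> topspace T \<and> x \<noteq> y"
  then have xy: "x \<in> carrier V" "y \<in> carrier V" "x \<noteq> y" by auto
  then have "x \<ominus>\<^bsub>V\<^esub> y \<noteq> \<zero>\<^bsub>V\<^esub>" using diff_eq_zero by blast
  then obtain e where e: "0 < e" "\<not> G (x \<ominus>\<^bsub>V\<^esub> y) < e" using G_sep xy by (meson minus_closed')
  obtain d where d: "d > 0" "\<And>x y. x \<in> carrier V \<Longrightarrow> y \<in> carrier V \<Longrightarrow> G x < d \<Longrightarrow> G y < d \<Longrightarrow> G (x \<oplus>\<^bsub>V\<^esub> y) < e"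
    using G_add[OF e(1)] by blast
  obtain U where U: "openin T U" "x \<in> U" "\<And>z. z \<in> U \<Longrightarrow> z \<in> carrier V \<and> G (z \<ominus>\<^bsub>V\<^esub> x) < d"
    using open_nbhd[OF xy(1) d(1)] by blast
  obtain W where W: "openin T W" "y \<in> W" "\<And>z. z \<in> W \<Longrightarrow> z \<in> carrier V \<and> G (z \<ominus>\<^bsub>V\<^esub> y) < d"
    using open_nbhd[OF xy(2) d(1)] by blast
  have "False" if z: "z \<in> U" "z \<in> W" for z
    using d(2)[of "x \<ominus>\<^bsub>V\<^esub> z" "z \<ominus>\<^bsub>V\<^esub> y"] U(3)[OF z(1)] W(3)[OF z(2)] xy e
    by (simp add: diff_add_diff G_diff_commute[of x z])
  then have "disjnt U W" by (auto simp: disjnt_def)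
  with U W show "\<exists>U W. openin T U \<and> openin T W \<and> x \<in> U \<and> y \<in> W \<and> disjnt U W" by blast
qed

lemma vector_topology_T: "vector_topology V T"
  unfolding vector_topology_def
proof (intro conjI)
  show "continuous_map (prod_topology T T) T (\<lambda>(x, y). x \<oplus>\<^bsub>V\<^esub> y)"
    unfolding continuous_map_def
  proof (intro conjI allI impI)
    fix U assume U: "openin T U"
    show "openin (prod_topology T T) {z \<in> topspace (prod_topology T T). (\<lambda>(x, y). x \<oplus>\<^bsub>V\<^esub> y) z \<in> U}"
      unfolding openin_prod_topology_alt
    proof (intro allI impI)
      fix x y assume "(x, y) \<in> {z \<in> topspace (prod_topology T T). (\<lambda>(x, y). x \<oplus>\<^bsub>V\<^esub> y) z \<in> U}"
      then have xy: "x \<in> carrier V" "y \<in> carrier V" "x \<oplus>\<^bsub>V\<^esub> y \<in> U" by auto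
      obtain e where e: "0 < e" "\<And>z. z \<in> carrier V \<Longrightarrow> G (z \<ominus>\<^bsub>V\<^esub> (x \<oplus>\<^bsub>V\<^esub> y)) < e \<Longrightarrow> z \<in> U"
        using U xy unfolding openin_qn_topology by blast
      obtain d where d: "d > 0" "\<And>x y. x \<in> carrier V \<Longrightarrow> y \<in> carrier V \<Longrightarrow> G x < d \<Longrightarrow> G y < d \<Longrightarrow> G (x \<oplus>\<^bsub>V\<^esub> y) < e"
        using G_add[OF e(1)] by blast
      obtain A where A: "openin T A" "x \<in> A" "\<And>z. z \<in> A \<Longrightarrow> z \<in> carrier V \<and> G (z \<ominus>\<^bsub>V\<^esub> x) < d"
        using open_nbhd[OF xy(1) d(1)] by blast
      obtain B where B: "openin T B" "y \<in> B" "\<And>z. z \<in> B \<Longrightarrow> z \<in> carrier V \<and> G (z \<ominus>\<^bsub>V\<^esub> y) < d"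
        using open_nbhd[OF xy(2) d(1)] by blast
      have "a \<oplus>\<^bsub>V\<^esub> b \<in> U" if "a \<in> A" "b \<in> B" for a b
        using A(3)[OF that(1)] B(3)[OF that(2)] xy by (intro e(2)) (auto simp: diff_add intro!: d(2))
      then show "\<exists>A B. openin T A \<and> openin T B \<and> x \<in> A \<and> y \<in> B \<and>
          A \<times> B \<subseteq> {z \<in> topspace (prod_topology T T). (\<lambda>(x, y). x \<oplus>\<^bsub>V\<^esub> y) z \<in> U}"
        using A B by (intro exI[of _ A] exI[of _ B]) auto
    qed
  qed auto
  show "continuous_map (prod_topology euclidean T) T (\<lambda>(c, x). c \<odot>\<^bsub>V\<^esub> x)"
    unfolding continuous_map_def
  proof (intro conjI allI impI)
    fix U assume U: "openin T U"
    show "openin (prod_topology euclidean T) {z \<in> topspace (prod_topology euclidean T). (\<lambda>(c, x). c \<odot>\<^bsub>V\<^esub> x) z \<in> U}"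
      unfolding openin_prod_topology_alt
    proof (intro allI impI)
      fix c :: 'k and x assume "(c, x) \<in> {z \<in> topspace (prod_topology euclidean T). (\<lambda>(c, x). c \<odot>\<^bsub>V\<^esub> x) z \<in> U}"
      then have x: "x \<in> carrier V" "c \<odot>\<^bsub>V\<^esub> x \<in> U" by auto
      obtain e where e: "0 < e" "\<And>z. z \<in> carrier V \<Longrightarrow> G (z \<ominus>\<^bsub>V\<^esub> (c \<odot>\<^bsub>V\<^esub> x)) < e \<Longrightarrow> z \<in> U"
        using U x unfolding openin_qn_topology by blast
      obtain d where d: "d > 0" "\<And>x y. x \<in> carrier V \<Longrightarrow> y \<in> carrier V \<Longrightarrow> G x < d \<Longrightarrow> G y < d \<Longrightarrow> G (x \<oplus>\<^bsub>V\<^esub> y) < e"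
        using G_add[OF e(1)] by blast
      obtain d1 where d1: "d1 > 0" "\<And>b. norm b < d1 \<Longrightarrow> G (b \<odot>\<^bsub>V\<^esub> x) < d"
        using G_abs[OF x(1) d(1)] by blast
      \<comment> \<open>\<open>r\<close> bounds the norm of every scalar within \<open>d1\<close> of
        \<open>c\<close>. Smallness under the single scalar \<open>r\<close>, with balancedness,
        controls \<open>b (y - x)\<close> uniformly in \<open>b\<close>; the remainder
        \<open>(b - c) x\<close> of \<open>b y - c x\<close> is small by absorption.\<close>
      define r where "r = norm c + d1"
      have r: "r > 0" using d1(1) by (simp add: r_def add_nonneg_pos)
      obtain d2 where d2: "d2 > 0" "\<And>y. y \<in> carrier V \<Longrightarrow> G y < d2 \<Longrightarrow> G ((of_real r :: 'k) \<odot>\<^bsub>V\<^esub> y) < d"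
        using G_scale[OF d(1)] by blast
      have d2': "G (b \<odot>\<^bsub>V\<^esub> y) < d" if "y \<in> carrier V" "G y < d2" "norm b \<le> r" for b y
      proof -
        have "norm (b / of_real r) \<le> 1" using that r by (simp add: norm_divide)
        then have "G ((b / of_real r) \<odot>\<^bsub>V\<^esub> y) < d2" using G_bal[OF that(1)] that(2) by (meson le_less_trans)
        from d2(2)[OF _ this] show ?thesis using that r by (simp add: smul_assoc)
      qed
      obtain B where B: "openin T B" "x \<in> B" "\<And>z. z \<in> B \<Longrightarrow> z \<in> carrier V \<and> G (z \<ominus>\<^bsub>V\<^esub> x) < d2"
        using open_nbhd[OF x(1) d2(1)] by blast
      have "b \<odot>\<^bsub>V\<^esub> y \<in> U" if b: "b \<in> ball c d1" and y: "y \<in> B" for b y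
      proof (rule e(2))
        have b': "norm (b - c) < d1" using b by (simp add: dist_norm norm_minus_commute)
        have "norm b \<le> r" using norm_triangle_ineq[of "b - c" c] b' by (simp add: r_def)
        then show "G (b \<odot>\<^bsub>V\<^esub> y \<ominus>\<^bsub>V\<^esub> c \<odot>\<^bsub>V\<^esub> x) < e"
          using B(3)[OF y] x(1) b' by (simp add: diff_smul) (intro d(2) d2' d1(2), auto)
      qed (use B(3)[OF y] in simp)
      then show "\<exists>A B. openin euclidean A \<and> openin T B \<and> c \<in> A \<and> x \<in> B \<and>
          A \<times> B \<subseteq> {z \<in> topspace (prod_topology euclidean T). (\<lambda>(c, x). c \<odot>\<^bsub>V\<^esub> x) z \<in> U}"
        using B d1(1) by (intro exI[of _ "ball c d1"] exI[of _ B]) auto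
    qed
  qed auto
qed (use vspace Hausdorff_T in auto)

text \<open>The balls of radius \<open>1 / Suc n\<close> form a countable basis at the origin, so a
  Cauchy net is governed by countably many of its members, and a limit of these attracts the whole
  net.\<close>

lemma complete_tvs_T:
  assumes seq: "\<And>y :: nat \<Rightarrow> 'v. range y \<subseteq> carrier V \<Longrightarrow>
      (\<And>e. 0 < e \<Longrightarrow> \<exists>N. \<forall>m\<ge>N. \<forall>n\<ge>N. G (y m \<ominus>\<^bsub>V\<^esub> y n) < e) \<Longrightarrow>
      \<exists>l\<in>carrier V. \<forall>e>0. \<exists>N. \<forall>n\<ge>N. G (y n \<ominus>\<^bsub>V\<^esub> l) < e"
  shows "complete_tvs V T"
  unfolding complete_tvs_def
proof (intro allI impI)
  fix I :: "('v \<times> 'v set) set" and pre x assume "Cauchy_net V T I pre x"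
  then have dir: "directed_by I pre" and xI: "x ` I \<subseteq> carrier V"
    and C: "\<And>U. openin T U \<Longrightarrow> \<zero>\<^bsub>V\<^esub> \<in> U \<Longrightarrow>
      \<exists>i\<in>I. \<forall>j\<in>I. \<forall>k\<in>I. pre i j \<and> pre i k \<longrightarrow> x j \<ominus>\<^bsub>V\<^esub> x k \<in> U"
    unfolding Cauchy_net_def by auto
  have C': "\<exists>i. i \<in> I \<and> (\<forall>j\<in>I. \<forall>k\<in>I. pre i j \<longrightarrow> pre i k \<longrightarrow> G (x j \<ominus>\<^bsub>V\<^esub> x k) < 1 / Suc n)" for n
  proof -
    obtain U where U: "openin T U" "\<zero>\<^bsub>V\<^esub> \<in> U" "\<And>y. y \<in> U \<Longrightarrow> y \<in> carrier V \<and> G (y \<ominus>\<^bsub>V\<^esub> \<zero>\<^bsub>V\<^esub>) < 1 / Suc n"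
      using open_nbhd[of "\<zero>\<^bsub>V\<^esub>" "1 / Suc n"] by auto
    then have U3: "\<And>y. y \<in> U \<Longrightarrow> G y < 1 / Suc n" by fastforce
    show ?thesis using C[OF U(1,2)] U3 by meson
  qed
  define j where "j n = (SOME i. i \<in> I \<and> (\<forall>j\<in>I. \<forall>k\<in>I. pre i j \<longrightarrow> pre i k \<longrightarrow> G (x j \<ominus>\<^bsub>V\<^esub> x k) < 1 / Suc n))" for n
  have j: "j n \<in> I" "\<And>k l. k \<in> I \<Longrightarrow> l \<in> I \<Longrightarrow> pre (j n) k \<Longrightarrow> pre (j n) l \<Longrightarrow> G (x k \<ominus>\<^bsub>V\<^esub> x l) < 1 / Suc n" for n
    using someI_ex[OF C'[of n]] unfolding j_def by blast+
  have rf: "pre a a" if "a \<in> I" for a using dir that unfolding directed_by_def by blast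
  have tr: "pre a c" if "a \<in> I" "b \<in> I" "c \<in> I" "pre a b" "pre b c" for a b c
    using dir that unfolding directed_by_def by blast
  have ub: "\<exists>c. c \<in> I \<and> pre a c \<and> pre b c" if "a \<in> I" "b \<in> I" for a b
    using dir that unfolding directed_by_def by blast
  define up where "up a b = (SOME c. c \<in> I \<and> pre a c \<and> pre b c)" for a b
  have up: "up a b \<in> I" "pre a (up a b)" "pre b (up a b)" if "a \<in> I" "b \<in> I" for a b
    using someI_ex[OF ub[OF that]] unfolding up_def by blast+
  \<comment> \<open>The indices \<open>j n\<close> need not be comparable. \<open>i\<close> replaces
    them by an increasing sequence with \<open>i n\<close> beyond \<open>j n\<close>, so that the
    members at \<open>i n\<close> form a Cauchy sequence.\<close>
  define i where "i = rec_nat (j 0) (\<lambda>n a. up a (j (Suc n)))"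
  have i0: "i 0 = j 0" and iS: "i (Suc n) = up (i n) (j (Suc n))" for n by (simp_all add: i_def)
  have iI: "i n \<in> I" for n by (induction n) (auto simp: i0 iS j up)
  have ji: "pre (j n) (i n)" for n by (cases n) (auto simp: i0 iS j up iI rf)
  have ii: "pre (i m) (i n)" if "m \<le> n" for m n
    using that by (induction rule: dec_induct) (auto intro: rf iI tr[OF iI iI iI] simp: iS up j(1) iI, metis iI iS j(1) tr up(2))
  have small: "G (x k \<ominus>\<^bsub>V\<^esub> x l) < 1 / Suc n" if "k \<in> I" "l \<in> I" "pre (i n) k" "pre (i n) l" for k l n
    using j(2)[of k l n] that tr[OF j(1) iI _ ji] by blast
  define y where "y n = x (i n)" for n
  have yC: "y n \<in> carrier V" for n using xI iI by (auto simp: y_def)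
  have xC: "x k \<in> carrier V" if "k \<in> I" for k using xI that by auto
  have "\<exists>N. \<forall>m\<ge>N. \<forall>n\<ge>N. G (y m \<ominus>\<^bsub>V\<^esub> y n) < e" if e: "0 < e" for e
  proof -
    obtain N where "1 / real (Suc N) < e" using nat_approx_posE[OF e] by blast
    then show ?thesis using small ii iI unfolding y_def by (metis less_trans)
  qed
  then obtain l where l: "l \<in> carrier V" and yl: "\<And>e. 0 < e \<Longrightarrow> \<exists>N. \<forall>n\<ge>N. G (y n \<ominus>\<^bsub>V\<^esub> l) < e"
    using seq[of y] yC by blast
  have "\<exists>i\<^sub>0\<in>I. \<forall>k\<in>I. pre i\<^sub>0 k \<longrightarrow> x k \<in> U" if U: "openin T U" "l \<in> U" for U
  proof -
    obtain e where e: "0 < e" "\<And>z. z \<in> carrier V \<Longrightarrow> G (z \<ominus>\<^bsub>V\<^esub> l) < e \<Longrightarrow> z \<in> U"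
      using U unfolding openin_qn_topology by blast
    obtain d where d: "d > 0" "\<And>x y. x \<in> carrier V \<Longrightarrow> y \<in> carrier V \<Longrightarrow> G x < d \<Longrightarrow> G y < d \<Longrightarrow> G (x \<oplus>\<^bsub>V\<^esub> y) < e"
      using G_add[OF e(1)] by blast
    obtain N where N: "\<And>n. n \<ge> N \<Longrightarrow> G (y n \<ominus>\<^bsub>V\<^esub> l) < d" using yl[OF d(1)] by blast
    obtain N' where N': "1 / real (Suc N') < d" using nat_approx_posE[OF d(1)] by blast
    define n where "n = max N N'"
    have n: "1 / real (Suc n) < d"
      using N' by (rule le_less_trans[rotated]) (simp add: n_def frac_le)
    have "x k \<in> U" if k: "k \<in> I" "pre (i n) k" for k
    proof (rule e(2)[OF xC[OF k(1)]])
      have "G (x k \<ominus>\<^bsub>V\<^esub> y n) < d" using small[OF k(1) iI k(2) rf[OF iI]] n unfolding y_def by linarith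
      then show "G (x k \<ominus>\<^bsub>V\<^esub> l) < e"
        using d(2)[of "x k \<ominus>\<^bsub>V\<^esub> y n" "y n \<ominus>\<^bsub>V\<^esub> l"] N[of n] xC[OF k(1)] yC l by (simp add: diff_add_diff n_def)
    qed
    then show ?thesis using iI by blast
  qed
  then show "\<exists>l. net_converges_to T I pre x l" using l unfolding net_converges_to_def by auto
qed

end

text \<open>Functionals that are small together at the origin are small together on differences.
  This identifies the topology of \<open>tilde_norm\<close> with that of
  \<open>bar_norm\<close>.\<close>

lemma qn_topology_cong:
  assumes "\<And>e. 0 < e \<Longrightarrow> \<exists>d>0. \<forall>x\<in>carrier V. G x < d \<longrightarrow> H x < e"
    and "\<And>e. 0 < e \<Longrightarrow> \<exists>d>0. \<forall>x\<in>carrier V. H x < d \<longrightarrow> G x < e"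
    and "\<And>x y. x \<in> carrier V \<Longrightarrow> y \<in> carrier V \<Longrightarrow> x \<ominus>\<^bsub>V\<^esub> y \<in> carrier V"
  shows "qn_topology V G = qn_topology V H"
  unfolding topology_eq openin_qn_topology
proof (intro allI iffI conjI ballI; elim conjE)
  fix U x assume U: "U \<subseteq> carrier V" "\<forall>x\<in>U. \<exists>e>0. \<forall>y\<in>carrier V. G (y \<ominus>\<^bsub>V\<^esub> x) < e \<longrightarrow> y \<in> U" and x: "x \<in> U"
  then obtain e where "e > 0" "\<forall>y\<in>carrier V. G (y \<ominus>\<^bsub>V\<^esub> x) < e \<longrightarrow> y \<in> U" by blast
  with assms(2)[of e] show "\<exists>e>0. \<forall>y\<in>carrier V. H (y \<ominus>\<^bsub>V\<^esub> x) < e \<longrightarrow> y \<in> U"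
    using assms(3) U(1) x by (meson subsetD)
next
  fix U x assume U: "U \<subseteq> carrier V" "\<forall>x\<in>U. \<exists>e>0. \<forall>y\<in>carrier V. H (y \<ominus>\<^bsub>V\<^esub> x) < e \<longrightarrow> y \<in> U" and x: "x \<in> U"
  then obtain e where "e > 0" "\<forall>y\<in>carrier V. H (y \<ominus>\<^bsub>V\<^esub> x) < e \<longrightarrow> y \<in> U" by blast
  with assms(1)[of e] show "\<exists>e>0. \<forall>y\<in>carrier V. G (y \<ominus>\<^bsub>V\<^esub> x) < e \<longrightarrow> y \<in> U"
    using assms(3) U(1) x by (meson subsetD)
qed

section \<open>The quasi-Banach target space\<close>

lemma vs_gauge_quasi_norm:
  assumes "vspace V" "quasi_norm V q"
  shows "vs_gauge V q"
proof (intro vs_gauge.intro)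
  show "vspace V" by fact
  obtain \<kappa> where "\<forall>x\<in>carrier V. \<forall>y\<in>carrier V. q (x \<oplus>\<^bsub>V\<^esub> y) \<le> \<kappa> * (q x + q y)"
    and nn: "\<And>x. x \<in> carrier V \<Longrightarrow> 0 \<le> q x"
    and hom: "\<And>c x. x \<in> carrier V \<Longrightarrow> q (c \<odot>\<^bsub>V\<^esub> x) = norm c * q x"
    and pos: "\<And>x. x \<in> carrier V \<Longrightarrow> x \<noteq> \<zero>\<^bsub>V\<^esub> \<Longrightarrow> 0 < q x"
    using assms(2) unfolding quasi_norm_def by blast
  \<comment> \<open>The definition of \<open>quasi_norm\<close> does not say that its constant is
    positive; the maximum with 1 makes division by it legitimate.\<close>
  then have \<kappa>: "q (x \<oplus>\<^bsub>V\<^esub> y) \<le> max \<kappa> 1 * (q x + q y)" if "x \<in> carrier V" "y \<in> carrier V" for x y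
    using that by (smt (verit) mult_right_mono max.cobounded1)
  show "\<exists>d>0. \<forall>x\<in>carrier V. \<forall>y\<in>carrier V. q x < d \<longrightarrow> q y < d \<longrightarrow> q (x \<oplus>\<^bsub>V\<^esub> y) < e"
    if e: "0 < e" for e
  proof (intro exI conjI ballI impI)
    fix x y assume xy: "x \<in> carrier V" "y \<in> carrier V"
      "q x < e / (2 * max \<kappa> 1)" "q y < e / (2 * max \<kappa> 1)"
    then have "max \<kappa> 1 * (q x + q y) < max \<kappa> 1 * (e / (2 * max \<kappa> 1) + e / (2 * max \<kappa> 1))"
      by (intro mult_strict_left_mono add_strict_mono) auto
    also have "\<dots> = e" by (simp add: field_simps)
    finally show "q (x \<oplus>\<^bsub>V\<^esub> y) < e" using \<kappa>[OF xy(1,2)] by linarith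
  qed (use e in \<open>auto intro!: divide_pos_pos mult_pos_pos\<close>)
  show "q (c \<odot>\<^bsub>V\<^esub> x) \<le> q x" if "x \<in> carrier V" "norm c \<le> 1" for c x
    using that nn[of x] by (simp add: hom mult_left_le_one_le)
  show "\<exists>d>0. \<forall>c. norm c < d \<longrightarrow> q (c \<odot>\<^bsub>V\<^esub> x) < e" if "x \<in> carrier V" "0 < e" for x e
  proof (intro exI conjI allI impI)
    show "0 < e / (q x + 1)" using that nn[of x] by auto
    show "q (c \<odot>\<^bsub>V\<^esub> x) < e" if c: "norm c < e / (q x + 1)" for c
    proof -
      have "norm c * q x \<le> norm c * (q x + 1)" by (simp add: mult_left_mono)
      also have "\<dots> < e" using c nn[of x] that \<open>x \<in> carrier V\<close> by (simp add: pos_less_divide_eq)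
      finally show ?thesis using \<open>x \<in> carrier V\<close> by (simp add: hom)
    qed
  qed
  show "x = \<zero>\<^bsub>V\<^esub>" if "x \<in> carrier V" "\<And>e. 0 < e \<Longrightarrow> q x < e" for x
    using pos[OF that(1)] that(2)[of "q x"] by blast
qed

lemma typ_vspace_simps [simp]:
  "carrier (typ_vspace smul) = UNIV" "\<zero>\<^bsub>typ_vspace smul\<^esub> = 0"
  "x \<oplus>\<^bsub>typ_vspace smul\<^esub> y = x + y" "c \<odot>\<^bsub>typ_vspace smul\<^esub> x = smul c x"
  by (simp_all add: typ_vspace_def)

locale quasi_banach_target =
  fixes smul :: "'k::real_normed_field \<Rightarrow> 'b::ab_group_add \<Rightarrow> 'b" and q :: "'b \<Rightarrow> real"
  assumes qb: "quasi_banach (typ_vspace smul) q"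
    and q_cont: "continuous_map (target_topology smul q) euclideanreal q"
begin

sublocale tgt: vs_gauge "typ_vspace smul" q
  using qb by (auto simp: quasi_banach_def intro: vs_gauge_quasi_norm)

lemma uminus_eq [simp]: "\<ominus>\<^bsub>typ_vspace smul\<^esub> x = - x"
  by (rule tgt.M.minus_equality) simp_all

lemma minus_eq [simp]: "x \<ominus>\<^bsub>typ_vspace smul\<^esub> y = x - y"
  by (simp add: tgt.M.minus_eq)

lemma smul_simps [simp]: "smul 1 x = x" "smul 0 x = 0" "smul a (smul b x) = smul (a * b) x"
  "smul c 0 = 0"
  using tgt.smul_1[of x] tgt.smul_0[of x] tgt.smul_assoc[of x a b] tgt.smult_r_null[of c] by simp_all

lemma smul_distrib: "smul (a + b) x = smul a x + smul b x" "smul a (x + y) = smul a x + smul a y"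
  using tgt.smul_add_left[of x a b] tgt.smul_add_right[of x y a] by simp_all

lemma smul_minus_1: "smul (-1) x = - x"
  using tgt.uminus_smul[of x] by simp

lemma q_nonneg [simp]: "0 \<le> q x" and q_smul: "q (smul c x) = norm c * q x"
  using qb unfolding quasi_banach_def quasi_norm_def by auto

lemma q_0 [simp]: "q 0 = 0" using q_smul[of 0 0] by simp

lemma q_eq_0 [simp]: "q x = 0 \<longleftrightarrow> x = 0"
  using qb unfolding quasi_banach_def quasi_norm_def by fastforce

lemma q_uminus [simp]: "q (- x) = q x"
  using q_smul[of "-1" x] by (simp add: smul_minus_1)

lemma q_commute: "q (x - y) = q (y - x)"
  using q_uminus[of "x - y"] by simp

definition kappa :: real where
  "kappa = (SOME k. 1 \<le> k \<and> (\<forall>x y. q (x + y) \<le> k * (q x + q y)))"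

lemma kappa: "1 \<le> kappa" "q (x + y) \<le> kappa * (q x + q y)"
proof -
  obtain k where "\<And>x y. q (x + y) \<le> k * (q x + q y)"
    using qb unfolding quasi_banach_def quasi_norm_def by auto
  then have "q (x + y) \<le> max k 1 * (q x + q y)" for x y
    by (smt (verit) mult_right_mono max.cobounded1 q_nonneg)
  then have "\<exists>k. 1 \<le> k \<and> (\<forall>x y. q (x + y) \<le> k * (q x + q y))" by (intro exI[of _ "max k 1"]) auto
  from someI_ex[OF this] show "1 \<le> kappa" "q (x + y) \<le> kappa * (q x + q y)"
    unfolding kappa_def by blast+
qed

lemma q_triangle: "q (x - z) \<le> kappa * (q (x - y) + q (y - z))"
  using kappa(2)[of "x - y" "y - z"] by simp

lemma openin_target:
  "openin tgt.T U \<longleftrightarrow> (\<forall>x\<in>U. \<exists>e>0. \<forall>y. q (y - x) < e \<longrightarrow> y \<in> U)"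
  by (simp add: openin_qn_topology)

text \<open>Continuity of \<open>q\<close> enters here: a ball around the origin is the preimage of
  an open ray. Other centres follow by translation in the definition of open sets.\<close>

lemma open_ball: "openin tgt.T {y. q (y - a) < r}"
proof -
  have "openin tgt.T {y. q y < r}"
    using q_cont openin_continuous_map_preimage[of "target_topology smul q" euclideanreal q "{..<r}"] by simp
  then have "\<exists>e>0. \<forall>y. q (y - x) < e \<longrightarrow> q (y - a) < r" if x: "q (x - a) < r" for x
  proof -
    have "\<forall>x\<in>{y. q y < r}. \<exists>e>0. \<forall>y. q (y - x) < e \<longrightarrow> y \<in> {y. q y < r}"
      using \<open>openin tgt.T {y. q y < r}\<close> unfolding openin_target .
    from bspec[OF this, of "x - a"] obtain e where e: "e > 0" "\<And>z. q (z - (x - a)) < e \<Longrightarrow> q z < r"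
      using x by auto
    have "q (y - a) < r" if "q (y - x) < e" for y using that by (intro e(2)) simp
    then show ?thesis using e(1) by blast
  qed
  then show ?thesis unfolding openin_target by blast
qed

text \<open>Completeness is defined through nets with index sets in a fixed type;
  \<open>complete_tvs_Cauchy_net\<close> carries it over to nets indexed by
  \<open>nat\<close>.\<close>

lemma convergent_q:
  assumes "\<And>e. 0 < e \<Longrightarrow> \<exists>N. \<forall>m\<ge>N. \<forall>n\<ge>N. q (y m - y n) < e"
  shows "\<exists>l. (\<lambda>n. q (y n - l)) \<longlonglongrightarrow> 0"
proof -
  have "Cauchy_net (typ_vspace smul) tgt.T (UNIV :: nat set) (\<le>) y"
    unfolding Cauchy_net_def
  proof (intro conjI allI impI)
    show "directed_by (UNIV :: nat set) (\<le>)"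
      unfolding directed_by_def by (auto intro: max.cobounded1 max.cobounded2)
    fix U assume "openin tgt.T U \<and> \<zero>\<^bsub>typ_vspace smul\<^esub> \<in> U"
    then obtain e where "e > 0" "\<And>y. q y < e \<Longrightarrow> y \<in> U" by (auto simp: openin_target)
    with assms[of e] show "\<exists>i\<^sub>0\<in>UNIV. \<forall>i\<in>UNIV. \<forall>j\<in>UNIV. i\<^sub>0 \<le> i \<and> i\<^sub>0 \<le> j \<longrightarrow> y i \<ominus>\<^bsub>typ_vspace smul\<^esub> y j \<in> U"
      by (simp) blast
  qed auto
  then obtain l where l: "net_converges_to tgt.T (UNIV :: nat set) (\<le>) y l"
    using complete_tvs_Cauchy_net qb unfolding quasi_banach_def by blast
  have "(\<lambda>n. q (y n - l)) \<longlonglongrightarrow> 0"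
  proof (rule LIMSEQ_I)
    fix r :: real assume "0 < r"
    then have "l \<in> {z. q (z - l) < r}" by simp
    moreover have "\<exists>i\<^sub>0\<in>UNIV. \<forall>i\<in>UNIV. i\<^sub>0 \<le> i \<longrightarrow> y i \<in> U"
      if "openin tgt.T U" "l \<in> U" for U
      using l that unfolding net_converges_to_def by blast
    ultimately have "\<exists>N. \<forall>n\<ge>N. y n \<in> {z. q (z - l) < r}"
      using open_ball[of l r] by fast
    then show "\<exists>N. \<forall>n\<ge>N. norm (q (y n - l) - 0) < r" by simp
  qed
  then show ?thesis by blast
qed

text \<open>The quasi-triangle inequality alone bounds the limit only up to a factor
  \<open>kappa\<close>. Continuity of \<open>q\<close> gives genuine convergence, which the Fatou
  argument for completeness requires.\<close>

lemma q_continuous_seq: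
  assumes "(\<lambda>n. q (y n - l)) \<longlonglongrightarrow> 0"
  shows "(\<lambda>n. q (a - y n)) \<longlonglongrightarrow> q (a - l)"
proof (rule LIMSEQ_I)
  fix r :: real assume r: "0 < r"
  have "openin tgt.T {z. q z \<in> {q (a - l) - r<..<q (a - l) + r}}"
    using q_cont openin_continuous_map_preimage[of "target_topology smul q" euclideanreal q "{q (a - l) - r<..<q (a - l) + r}"]
    by simp
  then obtain e where e: "e > 0" "\<And>z. q (z - (a - l)) < e \<Longrightarrow> q z \<in> {q (a - l) - r<..<q (a - l) + r}"
    unfolding openin_target using r by fastforce
  obtain N where "\<And>n. n \<ge> N \<Longrightarrow> q (y n - l) < e"
    using LIMSEQ_D[OF assms e(1)] by auto
  then have "norm (q (a - y n) - q (a - l)) < r" if "n \<ge> N" for n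
    using e(2)[of "a - y n"] that q_commute[of "y n" l] by (simp add: abs_less_iff) fastforce
  then show "\<exists>N. \<forall>n\<ge>N. norm (q (a - y n) - q (a - l)) < r" by blast
qed

subsection \<open>Separable subspaces\<close>

text \<open>Separability in metric form, with \<open>D\<close> allowed to lie outside
  \<open>S\<close>: the same \<open>D\<close> then serves the closure of \<open>S\<close>.
  \<open>sep_subspace_iff\<close> links it to the topological notion.\<close>

definition sep_subspace :: "'b set \<Rightarrow> bool" where
  "sep_subspace S \<longleftrightarrow> 0 \<in> S \<and> (\<forall>x\<in>S. \<forall>y\<in>S. x + y \<in> S) \<and> (\<forall>c. \<forall>x\<in>S. smul c x \<in> S) \<and>
     (\<exists>D. countable D \<and> (\<forall>x\<in>S. \<forall>e>0. \<exists>d\<in>D. q (x - d) < e))"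

lemma sep_subspaceD:
  assumes "sep_subspace S"
  shows "0 \<in> S" "x \<in> S \<Longrightarrow> y \<in> S \<Longrightarrow> x + y \<in> S" "x \<in> S \<Longrightarrow> smul c x \<in> S"
  using assms by (auto simp: sep_subspace_def)

lemma sep_subspaceI:
  assumes "countable D" "\<And>x e. x \<in> S \<Longrightarrow> 0 < e \<Longrightarrow> \<exists>d\<in>D. q (x - d) < e"
    "0 \<in> S" "\<And>x y. x \<in> S \<Longrightarrow> y \<in> S \<Longrightarrow> x + y \<in> S" "\<And>c x. x \<in> S \<Longrightarrow> smul c x \<in> S"
  shows "sep_subspace S"
  unfolding sep_subspace_def using assms by (intro conjI ballI allI exI[of _ D]) auto

lemma sep_subspace_iff:
  "sep_subspace S \<longleftrightarrow> submodule S (ring_of_type_algebra :: 'k ring) (typ_vspace smul) \<and>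
     separable_space (subtopology tgt.T S)"
proof (intro iffI conjI; (elim conjE)?)
  assume S: "sep_subspace S"
  show "submodule S (ring_of_type_algebra :: 'k ring) (typ_vspace smul)"
  proof (rule tgt.submoduleI)
    show "\<ominus>\<^bsub>typ_vspace smul\<^esub> a \<in> S" if "a \<in> S" for a
      using sep_subspaceD(3)[OF S that, of "-1"] by (simp add: smul_minus_1)
  qed (use sep_subspaceD[OF S] in auto)
  obtain D where D: "countable D" "\<And>x e. x \<in> S \<Longrightarrow> 0 < e \<Longrightarrow> \<exists>d\<in>D. q (x - d) < e"
    using S unfolding sep_subspace_def by blast
  \<comment> \<open>For each \<open>d\<close> in \<open>D\<close> and each radius
    \<open>1 / Suc n\<close>, a point of \<open>S\<close> that near to \<open>d\<close> if there is
    one. The intersection with \<open>S\<close> in \<open>C\<close> discards arbitrary values of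
    \<open>SOME\<close> outside \<open>S\<close>.\<close>
  define ch where "ch d n = (SOME s. s \<in> S \<and> q (s - d) < 1 / Suc n)" for d n
  define C where "C = (\<lambda>(d, n). ch d n) ` (D \<times> UNIV) \<inter> S"
  show "separable_space (subtopology tgt.T S)"
    unfolding separable_space_def
  proof (intro exI conjI)
    show "countable C" unfolding C_def using D(1) by (intro countable_Int1 countable_image countable_SIGMA) auto
    show "C \<subseteq> topspace (subtopology tgt.T S)" by (auto simp: C_def)
    have "\<exists>c\<in>C. c \<in> U" if x: "x \<in> S" "x \<in> U" and U: "openin tgt.T U" for x U
    proof -
      obtain e where e: "e > 0" "\<And>y. q (y - x) < e \<Longrightarrow> y \<in> U" using U x unfolding openin_target by blast
      \<comment> \<open>Both legs of the path from \<open>ch d n\<close> through \<open>d\<close> to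
        \<open>x\<close> are shorter than \<open>e / (2 * kappa)\<close>, so the quasi-triangle
        inequality gives less than \<open>e\<close>. This splitting recurs below.\<close>
      have "e / (2 * kappa) > 0" using e kappa(1) by auto
      then obtain n where n: "1 / real (Suc n) < e / (2 * kappa)" using nat_approx_posE by blast
      obtain d where d: "d \<in> D" "q (x - d) < 1 / Suc n" using D(2)[OF x(1), of "1 / Suc n"] by auto
      have c: "ch d n \<in> S \<and> q (ch d n - d) < 1 / Suc n"
        unfolding ch_def by (rule someI[of _ x]) (use x d in auto)
      have "q (ch d n - x) \<le> kappa * (q (ch d n - d) + q (d - x))" by (rule q_triangle)
      also have "\<dots> < kappa * (e / (2 * kappa) + e / (2 * kappa))"
        using c d n kappa(1) by (intro mult_strict_left_mono add_strict_mono) (auto simp: q_commute[of d x])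
      also have "\<dots> = e" using kappa(1) by (simp add: field_simps)
      finally have "ch d n \<in> U" by (rule e(2))
      then show ?thesis using c d by (auto simp: C_def intro!: bexI[of _ "ch d n"])
    qed
    moreover have "C \<subseteq> S" by (auto simp: C_def)
    ultimately have "\<exists>y\<in>C. y \<in> U \<inter> S" if "x \<in> S" "x \<in> U" "openin tgt.T U" for x U
      using that by blast
    then show "subtopology tgt.T S closure_of C = topspace (subtopology tgt.T S)"
      unfolding closure_of_def openin_subtopology by auto
  qed
next
  assume sub: "submodule S (ring_of_type_algebra :: 'k ring) (typ_vspace smul)"
    and sep: "separable_space (subtopology tgt.T S)"
  obtain C where C: "countable C" "C \<subseteq> S" "subtopology tgt.T S closure_of C = S"
    using sep unfolding separable_space_def by auto
  have "\<exists>d\<in>C. q (x - d) < e" if x: "x \<in> S" "0 < e" for x e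
  proof -
    have "x \<in> subtopology tgt.T S closure_of C" using C x by simp
    then have cl: "\<And>U. x \<in> U \<Longrightarrow> openin (subtopology tgt.T S) U \<Longrightarrow> \<exists>y. y \<in> C \<and> y \<in> U"
      unfolding in_closure_of by simp
    have "openin (subtopology tgt.T S) (S \<inter> {y. q (y - x) < e})"
      using open_ball by (intro openin_subtopology_Int2)
    moreover have "x \<in> S \<inter> {y. q (y - x) < e}" using x by simp
    ultimately have "\<exists>y. y \<in> C \<and> y \<in> S \<inter> {y. q (y - x) < e}" by (intro cl)
    then obtain y where "y \<in> C" "q (y - x) < e" by blast
    then show ?thesis by (auto simp: q_commute[of x])
  qed
  moreover have "0 \<in> S" "\<forall>x\<in>S. \<forall>y\<in>S. x + y \<in> S" "\<forall>c. \<forall>x\<in>S. smul c x \<in> S"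
    using tgt.submoduleE(5,4)[OF sub] submodule.axioms(1)[OF sub, THEN subgroup.one_closed] by auto
  ultimately show "sep_subspace S" using C(1) by (intro sep_subspaceI[of C]) auto
qed

lemma sep_subspace_zero: "sep_subspace {0}"
  unfolding sep_subspace_def by (auto intro!: exI[of _ "{0}"])

lemma sep_subspace_sum:
  assumes "sep_subspace A" "sep_subspace B"
  shows "sep_subspace {a + b | a b. a \<in> A \<and> b \<in> B}"
proof -
  obtain D where D: "countable D" "\<And>x e. x \<in> A \<Longrightarrow> 0 < e \<Longrightarrow> \<exists>d\<in>D. q (x - d) < e"
    using assms(1) unfolding sep_subspace_def by blast
  obtain E where E: "countable E" "\<And>x e. x \<in> B \<Longrightarrow> 0 < e \<Longrightarrow> \<exists>d\<in>E. q (x - d) < e"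
    using assms(2) unfolding sep_subspace_def by blast
  have "\<exists>d\<in>(\<lambda>(x, y). x + y) ` (D \<times> E). q (a + b - d) < e" if ab: "a \<in> A" "b \<in> B" "0 < e" for a b e
  proof -
    have e: "0 < e / (2 * kappa)" using kappa(1) ab by auto
    obtain d d' where d: "d \<in> D" "d' \<in> E" "q (a - d) < e / (2 * kappa)" "q (b - d') < e / (2 * kappa)"
      using D(2)[OF ab(1) e] E(2)[OF ab(2) e] by blast
    have "q (a + b - (d + d')) \<le> kappa * (q (a - d) + q (b - d'))"
      using kappa(2)[of "a - d" "b - d'"] by (simp add: algebra_simps)
    also have "\<dots> < kappa * (e / (2 * kappa) + e / (2 * kappa))"
      using d kappa(1) by (intro mult_strict_left_mono add_strict_mono) auto
    also have "\<dots> = e" using kappa(1) by (simp add: field_simps)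
    finally show ?thesis using d by force
  qed
  moreover have "countable ((\<lambda>(x, y). x + y) ` (D \<times> E))" using D E by auto
  moreover have "\<exists>a b. 0 = a + b \<and> a \<in> A \<and> b \<in> B" 
    using sep_subspaceD(1) assms by (metis add_0)
  moreover have "\<exists>a'' b''. a + b + (a' + b') = a'' + b'' \<and> a'' \<in> A \<and> b'' \<in> B"
    if "a \<in> A" "a' \<in> A" "b \<in> B" "b' \<in> B" for a a' b b'
    using sep_subspaceD(2)[OF assms(1) that(1,2)] sep_subspaceD(2)[OF assms(2) that(3,4)]
    by (intro exI[of _ "a + a'"] exI[of _ "b + b'"]) (auto simp: ac_simps)
  moreover have "\<exists>a'' b''. smul c (a + b) = a'' + b'' \<and> a'' \<in> A \<and> b'' \<in> B"
    if "a \<in> A" "b \<in> B" for a b c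
    using sep_subspaceD(3)[OF assms(1) that(1)] sep_subspaceD(3)[OF assms(2) that(2)] smul_distrib(2) by blast
  ultimately show ?thesis unfolding sep_subspace_def by blast
qed

lemma sep_subspace_Union:
  assumes "\<And>n::nat. sep_subspace (S n)" "incseq S"
  shows "sep_subspace (\<Union>n. S n)"
proof -
  have "\<exists>D. countable D \<and> (\<forall>x\<in>S n. \<forall>e>0. \<exists>d\<in>D. q (x - d) < e)" for n
    using assms(1) unfolding sep_subspace_def by blast
  then obtain D where D: "\<And>n. countable (D n)" "\<And>n x e. x \<in> S n \<Longrightarrow> 0 < e \<Longrightarrow> \<exists>d\<in>D n. q (x - d) < e"
    by metis
  have "x + y \<in> (\<Union>n. S n)" if xy: "x \<in> (\<Union>n. S n)" "y \<in> (\<Union>n. S n)" for x y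
  proof -
    obtain m n where "x \<in> S m" "y \<in> S n" using xy by blast
    then 
    have "x \<in> S (max m n)" "y \<in> S (max m n)"
      using incseqD[OF assms(2), of m "max m n"] incseqD[OF assms(2), of n "max m n"] by auto
    then show ?thesis using sep_subspaceD(2)[OF assms(1)] by blast
  qed
  moreover have "\<exists>d\<in>\<Union>n. D n. q (x - d) < e" if "x \<in> (\<Union>n. S n)" "0 < e" for x e
    using D(2) that by blast
  moreover have "countable (\<Union>n. D n)" using D(1) by auto
  moreover have "0 \<in> (\<Union>n. S n)" using sep_subspaceD(1)[OF assms(1)] by blast
  moreover have "smul c x \<in> (\<Union>n. S n)" if "x \<in> (\<Union>n. S n)" for c x
    using that sep_subspaceD(3)[OF assms(1)] by blast
  ultimately show ?thesis by (intro sep_subspaceI[of "\<Union>n. D n"])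
qed

lemma sep_subspace_closure:
  assumes "sep_subspace S"
  shows "sep_subspace {x. \<forall>e>0. \<exists>s\<in>S. q (x - s) < e}" (is "sep_subspace ?C")
proof -
  have small: "\<exists>s\<in>S. q (x - s) < e / (2 * kappa)" if "x \<in> ?C" "0 < e" for x e
    using that kappa(1) by auto
  have half: "kappa * (u + v) < e" if "u < e / (2 * kappa)" "v < e / (2 * kappa)" for u v e
  proof -
    have "kappa * (u + v) < kappa * (e / (2 * kappa) + e / (2 * kappa))"
      using that kappa(1) by (intro mult_strict_left_mono add_strict_mono) auto
    also have "\<dots> = e" using kappa(1) by (simp add: field_simps)
    finally show ?thesis .
  qed
  obtain D where D: "countable D" "\<And>x e. x \<in> S \<Longrightarrow> 0 < e \<Longrightarrow> \<exists>d\<in>D. q (x - d) < e"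
    using assms unfolding sep_subspace_def by blast
  have "\<exists>d\<in>D. q (x - d) < e" if x: "x \<in> ?C" "0 < e" for x e
  proof -
    obtain s where s: "s \<in> S" "q (x - s) < e / (2 * kappa)" using small[OF x] by blast
    obtain d where d: "d \<in> D" "q (s - d) < e / (2 * kappa)"
      using D(2)[OF s(1)] x(2) kappa(1) by (metis divide_pos_pos less_le_trans mult_pos_pos zero_less_numeral zero_less_one)
    show ?thesis using half[OF s(2) d(2)] q_triangle[of x d s] d(1) by (intro bexI[of _ d]) auto
  qed
  moreover have "x + y \<in> ?C" if xy: "x \<in> ?C" "y \<in> ?C" for x y
  proof (intro CollectI allI impI)
    fix e :: real assume e: "0 < e"
    obtain s t where s: "s \<in> S" "q (x - s) < e / (2 * kappa)" "t \<in> S" "q (y - t) < e / (2 * kappa)"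
      using small[OF xy(1) e] small[OF xy(2) e] by blast
    have "q (x + y - (s + t)) < e"
      using half[OF s(2,4)] kappa(2)[of "x - s" "y - t"] by (simp add: algebra_simps)
    then show "\<exists>s\<in>S. q (x + y - s) < e" using sep_subspaceD(2)[OF assms s(1,3)] by blast
  qed
  moreover have "smul c x \<in> ?C" if "x \<in> ?C" for c x
  proof (intro CollectI allI impI)
    fix e :: real assume e: "0 < e"
    have "0 < e / (norm c + 1)" using e by (simp add: add_nonneg_pos)
    then obtain s where s: "s \<in> S" "q (x - s) < e / (norm c + 1)" using \<open>x \<in> ?C\<close> by blast
    have "smul c x - smul c s = smul c (x - s)"
      using smul_distrib(2)[of c "x - s" s] by (simp add: algebra_simps)
    then have "q (smul c x - smul c s) = norm c * q (x - s)" by (simp add: q_smul)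
    also have "\<dots> \<le> (norm c + 1) * q (x - s)" by (simp add: mult_right_mono)
    also have "\<dots> < e" using s(2) by (simp add: pos_less_divide_eq add_nonneg_pos mult.commute)
    finally show "\<exists>s\<in>S. q (smul c x - s) < e" using sep_subspaceD(3)[OF assms s(1)] by blast
  qed
  moreover have "0 \<in> ?C" using sep_subspaceD(1)[OF assms] by (auto intro!: bexI[of _ 0])
  ultimately show ?thesis using D(1) by (intro sep_subspaceI[of D])
qed

text \<open>A limit of functions with values in different \<open>S n\<close> needs one separable
  subspace for its own values. The finite sums of the \<open>S n\<close> increase to a separable
  subspace, and its closure is \<open>R\<close>.\<close>

lemma sep_subspace_seq:
  assumes S: "\<And>n::nat. sep_subspace (S n)"
  obtains R where "sep_subspace R" "\<And>n. S n \<subseteq> R" "\<And>x. (\<And>e. 0 < e \<Longrightarrow> \<exists>s\<in>R. q (x - s) < e) \<Longrightarrow> x \<in> R"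
proof -
  define T where "T = rec_nat {0} (\<lambda>n A. {a + b | a b. a \<in> A \<and> b \<in> S n})"
  have T0: "T 0 = {0}" and TS: "T (Suc n) = {a + b | a b. a \<in> T n \<and> b \<in> S n}" for n
    by (simp_all add: T_def)
  have T: "sep_subspace (T n)" for n
    by (induction n) (auto simp only: T0 TS intro!: sep_subspace_zero sep_subspace_sum S)
  have inc: "incseq T"
  proof (rule incseq_SucI)
    show "T n \<subseteq> T (Suc n)" for n
      unfolding TS using sep_subspaceD(1)[OF S[of n]] by force
  qed
  have ST: "S n \<subseteq> T (Suc n)" for n
    unfolding TS using sep_subspaceD(1)[OF T[of n]] by force
  let ?R = "{x. \<forall>e>0. \<exists>s\<in>\<Union>n. T n. q (x - s) < e}"
  show thesis
  proof
    show "sep_subspace ?R" by (rule sep_subspace_closure[OF sep_subspace_Union[OF T inc]])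
    show "S n \<subseteq> ?R" for n
    proof (intro subsetI CollectI allI impI)
      fix x e assume "x \<in> S n" "(0::real) < e"
      then show "\<exists>s\<in>\<Union>n. T n. q (x - s) < e" using ST by (intro bexI[of _ x]) auto
    qed
    fix x assume x: "\<And>e. 0 < e \<Longrightarrow> \<exists>s\<in>?R. q (x - s) < e"
    show "x \<in> ?R"
    proof (intro CollectI allI impI)
      fix e :: real assume "0 < e"
      then have e: "0 < e / (2 * kappa)" using kappa(1) by auto
      obtain s where s: "s \<in> ?R" "q (x - s) < e / (2 * kappa)" using x[OF e] by blast
      then obtain t where t: "t \<in> (\<Union>n. T n)" "q (s - t) < e / (2 * kappa)" using e by blast
      have "q (x - t) \<le> kappa * (q (x - s) + q (s - t))" by (rule q_triangle)
      also have "\<dots> < kappa * (e / (2 * kappa) + e / (2 * kappa))"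
        using s t kappa(1) by (intro mult_strict_left_mono add_strict_mono) auto
      also have "\<dots> = e" using kappa(1) by (simp add: field_simps)
      finally show "\<exists>s\<in>\<Union>n. T n. q (x - s) < e" using t by blast
    qed
  qed
qed

subsection \<open>Measurability\<close>

abbreviation borelT :: "'b measure" where
  "borelT \<equiv> sigma UNIV {U. openin tgt.T U}"

lemma measurable_borelT_I:
  assumes "\<And>U. openin tgt.T U \<Longrightarrow> {x \<in> space M. f x \<in> U} \<in> sets M"
  shows "f \<in> measurable M borelT"
  using assms by (intro measurable_measure_of) (auto simp: vimage_def Int_def conj_commute)

lemma measurable_borelT_D:
  "f \<in> measurable M borelT \<Longrightarrow> openin tgt.T U \<Longrightarrow> {x \<in> space M. f x \<in> U} \<in> sets M"
  using measurable_sets[of f M borelT U] by (auto simp: vimage_def Int_def conj_commute)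

lemma measurable_q [measurable (raw)]:
  assumes "f \<in> measurable M borelT"
  shows "(\<lambda>x. q (f x)) \<in> borel_measurable M"
proof (rule borel_measurableI_less)
  show "{x \<in> space M. q (f x) < y} \<in> sets M" for y
    using measurable_borelT_D[OF assms open_ball[of 0 y]] by simp
qed

lemma measurable_smul:
  assumes "f \<in> measurable M borelT"
  shows "(\<lambda>x. smul c (f x)) \<in> measurable M borelT"
proof (rule measurable_borelT_I)
  fix U assume U: "openin tgt.T U"
  have "openin tgt.T {x. smul c x \<in> U}"
    unfolding openin_target
  proof (intro ballI)
    fix x assume "x \<in> {x. smul c x \<in> U}"
    then obtain e where e: "e > 0" "\<And>y. q (y - smul c x) < e \<Longrightarrow> y \<in> U" using U unfolding openin_target by blast
    have "q (smul c y - smul c x) < e" if "q (y - x) < e / (norm c + 1)" for y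
    proof -
      have "smul c y - smul c x = smul c (y - x)"
        using smul_distrib(2)[of c "y - x" x] by (simp add: algebra_simps)
      then have "q (smul c y - smul c x) = norm c * q (y - x)" by (simp add: q_smul)
      also have "\<dots> \<le> (norm c + 1) * q (y - x)" by (simp add: mult_right_mono)
      also have "\<dots> < e" using that by (simp add: pos_less_divide_eq add_nonneg_pos mult.commute)
      finally show ?thesis .
    qed
    moreover have "0 < e / (norm c + 1)" using e by (simp add: add_nonneg_pos)
    ultimately show "\<exists>e>0. \<forall>y. q (y - x) < e \<longrightarrow> y \<in> {x. smul c x \<in> U}" using e(2) by blast
  qed
  from measurable_borelT_D[OF assms this] show "{x \<in> space M. smul c (f x) \<in> U} \<in> sets M" by simp
qed

text \<open>
  Unlike strong measurability, which constrains the values only almost everywhere, this property is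
  stable under addition; every class of strongly measurable functions has such a representative.
\<close>

definition sep_measurable :: "'a measure \<Rightarrow> ('a \<Rightarrow> 'b) \<Rightarrow> bool" where
  "sep_measurable M f \<longleftrightarrow> f \<in> measurable M borelT \<and> (\<exists>S. sep_subspace S \<and> (\<forall>x\<in>space M. f x \<in> S))"

lemma measurable_ball:
  assumes "f \<in> measurable M borelT"
  shows "{x \<in> space M. q (f x - a) < r} \<in> sets M"
  using measurable_borelT_D[OF assms open_ball[of a r]] by simp

text \<open>For a non-separable target, the Borel sets of the product can exceed the product
  sigma-algebra, so continuity of addition does not suffice. Separable values repair this: the
  preimage of an open set is a countable union of intersections of preimages of balls centred in
  \<open>D\<close> and \<open>E\<close>.\<close>

lemma sep_measurable_add:
  assumes "sep_measurable M f" "sep_measurable M g"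
  shows "sep_measurable M (\<lambda>x. f x + g x)"
proof -
  obtain A B where A: "sep_subspace A" "\<And>x. x \<in> space M \<Longrightarrow> f x \<in> A"
    and B: "sep_subspace B" "\<And>x. x \<in> space M \<Longrightarrow> g x \<in> B"
    and f: "f \<in> measurable M borelT" and g: "g \<in> measurable M borelT"
    using assms unfolding sep_measurable_def by blast
  obtain D where D: "countable D" "\<And>x e. x \<in> A \<Longrightarrow> 0 < e \<Longrightarrow> \<exists>d\<in>D. q (x - d) < e"
    using A(1) unfolding sep_subspace_def by blast
  obtain E where E: "countable E" "\<And>x e. x \<in> B \<Longrightarrow> 0 < e \<Longrightarrow> \<exists>d\<in>E. q (x - d) < e"
    using B(1) unfolding sep_subspace_def by blast
  have "(\<lambda>x. f x + g x) \<in> measurable M borelT"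
  proof (rule measurable_borelT_I)
    fix U assume U: "openin tgt.T U"
    \<comment> \<open>Pairs of balls whose sum lies in \<open>U\<close>, listed by centres and
      radius. The list is countable and does not depend on the point \<open>x\<close>.\<close>
    define I where "I = {(a, b, n::nat). a \<in> D \<and> b \<in> E \<and>
      (\<forall>y z. q (y - a) < 1 / Suc n \<longrightarrow> q (z - b) < 1 / Suc n \<longrightarrow> y + z \<in> U)}"
    have "countable I"
      by (rule countable_subset[of _ "D \<times> E \<times> UNIV"]) (use D E in \<open>auto simp: I_def\<close>)
    moreover have "\<exists>(a, b, n)\<in>I. q (f x - a) < 1 / Suc n \<and> q (g x - b) < 1 / Suc n"
      if x: "x \<in> space M" "f x + g x \<in> U" for x
    proof -
      obtain e where e: "e > 0" "\<And>y. q (y - (f x + g x)) < e \<Longrightarrow> y \<in> U"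
        using U x unfolding openin_target by blast
      \<comment> \<open>One factor \<open>2 * kappa\<close> is spent on going from \<open>y\<close>
        to \<open>f x\<close> through \<open>a\<close>, and likewise from \<open>z\<close> to
        \<open>g x\<close> through \<open>b\<close>; the other is spent on adding the two
        differences.\<close>
      have "e / (4 * kappa * kappa) > 0" using e kappa(1) by auto
      then obtain n where n: "1 / real (Suc n) < e / (4 * kappa * kappa)" using nat_approx_posE by blast
      obtain a where a: "a \<in> D" "q (f x - a) < 1 / Suc n" using D(2)[OF A(2)[OF x(1)], of "1 / Suc n"] by auto
      obtain b where b: "b \<in> E" "q (g x - b) < 1 / Suc n" using E(2)[OF B(2)[OF x(1)], of "1 / Suc n"] by auto
      have "y + z \<in> U" if yz: "q (y - a) < 1 / Suc n" "q (z - b) < 1 / Suc n" for y z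
      proof (rule e(2))
        have k': "kappa * (u + v) < e / (2 * kappa)" if "u < 1 / Suc n" "v < 1 / Suc n" for u v
        proof -
          have "kappa * (u + v) < kappa * (e / (4 * kappa * kappa) + e / (4 * kappa * kappa))"
            using that n kappa(1) by (intro mult_strict_left_mono add_strict_mono) auto
          also have "\<dots> = e / (2 * kappa)" using kappa(1) by (simp add: field_simps)
          finally show ?thesis .
        qed
        have 1: "q (y - f x) < e / (2 * kappa)"
          using q_triangle[of y "f x" a] k'[OF yz(1) a(2)] by (simp add: q_commute[of a])
        have 2: "q (z - g x) < e / (2 * kappa)"
          using q_triangle[of z "g x" b] k'[OF yz(2) b(2)] by (simp add: q_commute[of b])
        have "q (y + z - (f x + g x)) \<le> kappa * (q (y - f x) + q (z - g x))"
          using kappa(2)[of "y - f x" "z - g x"] by (simp add: algebra_simps)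
        also have "\<dots> < kappa * (e / (2 * kappa) + e / (2 * kappa))"
          using 1 2 kappa(1) by (intro mult_strict_left_mono add_strict_mono) auto
        also have "\<dots> = e" using kappa(1) by (simp add: field_simps)
        finally show "q (y + z - (f x + g x)) < e" .
      qed
      then have "(a, b, n) \<in> I" using a b by (auto simp: I_def)
      then show ?thesis using a b by blast
    qed
    then have "{x \<in> space M. f x + g x \<in> U} =
      (\<Union>(a, b, n)\<in>I. {x \<in> space M. q (f x - a) < 1 / Suc n} \<inter> {x \<in> space M. q (g x - b) < 1 / Suc n})"
      by (auto simp: I_def)
    moreover have "{x \<in> space M. q (f x - a) < r} \<inter> {x \<in> space M. q (g x - b) < r} \<in> sets M" for a b r
      using measurable_ball f g by blast
    ultimately show "{x \<in> space M. f x + g x \<in> U} \<in> sets M"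
      by (auto intro!: sets.countable_UN')
  qed
  moreover have "\<forall>x\<in>space M. f x + g x \<in> {a + b | a b. a \<in> A \<and> b \<in> B}" using A B by auto
  ultimately show ?thesis unfolding sep_measurable_def using sep_subspace_sum[OF A(1) B(1)] by blast
qed

lemma sep_measurable_smul: "sep_measurable M f \<Longrightarrow> sep_measurable M (\<lambda>x. smul c (f x))"
  unfolding sep_measurable_def using measurable_smul sep_subspaceD(3) by metis

lemma sep_measurable_zero: "sep_measurable M (\<lambda>x. 0)"
  unfolding sep_measurable_def using sep_subspace_zero by (auto intro!: measurable_borelT_I)

lemma sep_measurable_diff: "sep_measurable M f \<Longrightarrow> sep_measurable M g \<Longrightarrow> sep_measurable M (\<lambda>x. f x - g x)"
  using sep_measurable_add[OF _ sep_measurable_smul[of M g "-1"]] by (simp add: smul_minus_1)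

lemma sep_measurable_if:
  assumes "sep_measurable M f" "{x \<in> space M. P x} \<in> sets M"
  shows "sep_measurable M (\<lambda>x. if P x then f x else 0)"
proof -
  obtain S where "sep_subspace S" "\<And>x. x \<in> space M \<Longrightarrow> f x \<in> S" "f \<in> measurable M borelT"
    using assms(1) unfolding sep_measurable_def by blast
  moreover have "(\<lambda>x. 0) \<in> measurable M borelT" using sep_measurable_zero[of M] unfolding sep_measurable_def by blast
  ultimately show ?thesis
    unfolding sep_measurable_def using measurable_If[of f M borelT "\<lambda>x. 0" P] assms(2) sep_subspaceD(1)[of S]
    by (intro conjI exI[of _ S]) auto
qed

lemma sep_measurable_lim:
  assumes f: "\<And>n::nat. sep_measurable M (f n)" and lim: "\<And>x. x \<in> space M \<Longrightarrow> (\<lambda>n. q (f n x - g x)) \<longlonglongrightarrow> 0"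
  shows "sep_measurable M g"
proof -
  have fm: "f n \<in> measurable M borelT" for n using f unfolding sep_measurable_def by blast
  have "\<exists>S. sep_subspace S \<and> (\<forall>x\<in>space M. f n x \<in> S)" for n using f unfolding sep_measurable_def by blast
  then obtain S where S: "\<And>n. sep_subspace (S n)" "\<And>n x. x \<in> space M \<Longrightarrow> f n x \<in> S n" by metis
  obtain R where R: "sep_subspace R" "\<And>n. S n \<subseteq> R" "\<And>x. (\<And>e. 0 < e \<Longrightarrow> \<exists>s\<in>R. q (x - s) < e) \<Longrightarrow> x \<in> R"
    using sep_subspace_seq[of S] S(1) by metis
  have lim': "\<exists>N. \<forall>n\<ge>N. q (f n x - g x) < e" if "x \<in> space M" "0 < e" for x e
    using LIMSEQ_D[OF lim[OF that(1)] that(2)] by simp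
  have "g x \<in> R" if x: "x \<in> space M" for x
  proof (rule R(3))
    fix e :: real assume "0 < e"
    then obtain N where "q (f N x - g x) < e" using lim'[OF x] by blast
    then show "\<exists>s\<in>R. q (g x - s) < e" using R(2) S(2)[OF x] by (intro bexI[of _ "f N x"]) (auto simp: q_commute)
  qed
  moreover have "g \<in> measurable M borelT"
  proof (rule measurable_borelT_I)
    fix U assume U: "openin tgt.T U"
    \<comment> \<open>\<open>F k\<close> is the set of points at distance at least
      \<open>1 / Suc k\<close> from the complement of \<open>U\<close>. It is closed, and a limit
      lies in \<open>U\<close> exactly when the sequence is eventually in one fixed
      \<open>F k\<close>.\<close>
    define F where "F k = {y. \<forall>z. z \<notin> U \<longrightarrow> 1 / real (Suc k) \<le> q (y - z)}" for k
    have F: "{x \<in> space M. f n x \<in> F k} \<in> sets M" for n k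
    proof -
      have "openin tgt.T (- F k)"
      proof -
        have "- F k = (\<Union>z\<in>-U. {y. q (y - z) < 1 / real (Suc k)})" by (auto simp: F_def not_le)
        then show ?thesis using open_ball by auto
      qed
      from measurable_borelT_D[OF fm this, of n] 
      have "space M - {x \<in> space M. f n x \<in> - F k} \<in> sets M" by blast
      moreover have "space M - {x \<in> space M. f n x \<in> - F k} = {x \<in> space M. f n x \<in> F k}" by auto
      ultimately show ?thesis by simp
    qed
    have "g x \<in> U \<longleftrightarrow> (\<exists>k N. \<forall>n\<ge>N. f n x \<in> F k)" if x: "x \<in> space M" for x
    proof
      assume "g x \<in> U"
      then obtain e where e: "e > 0" "\<And>y. q (y - g x) < e \<Longrightarrow> y \<in> U" using U unfolding openin_target by blast
      then have p: "e / (2 * kappa) > 0" using kappa(1) by auto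
      then obtain k where k: "1 / real (Suc k) < e / (2 * kappa)" using nat_approx_posE by blast
      obtain N where N: "\<And>n. n \<ge> N \<Longrightarrow> q (f n x - g x) < e / (2 * kappa)" using lim'[OF x p] by blast
      have "f n x \<in> F k" if "n \<ge> N" for n
        unfolding F_def
      proof (intro CollectI allI impI)
        fix z assume "z \<notin> U"
        then have "e \<le> q (z - g x)" using e(2) by (meson not_le)
        also have "\<dots> \<le> kappa * (q (z - f n x) + q (f n x - g x))" by (rule q_triangle)
        also have "\<dots> \<le> kappa * (q (f n x - z) + e / (2 * kappa))"
          using N[OF that] kappa(1) by (intro mult_left_mono) (auto simp: q_commute[of z])
        also have "\<dots> = kappa * q (f n x - z) + e / 2" using kappa(1) by (simp add: field_simps)
        finally have "e / 2 \<le> kappa * q (f n x - z)" by simp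
        then have "e / (2 * kappa) \<le> q (f n x - z)" using kappa(1) by (simp add: field_simps)
        then show "1 / real (Suc k) \<le> q (f n x - z)" using k by linarith
      qed
      then show "\<exists>k N. \<forall>n\<ge>N. f n x \<in> F k" by blast
    next
      assume "\<exists>k N. \<forall>n\<ge>N. f n x \<in> F k"
      then obtain k N where kN: "\<And>n. n \<ge> N \<Longrightarrow> f n x \<in> F k" by blast
      obtain N' where N': "\<And>n. n \<ge> N' \<Longrightarrow> q (f n x - g x) < 1 / Suc k" using lim'[OF x, of "1 / Suc k"] by auto
      \<comment> \<open>Otherwise \<open>z = g x\<close> is admissible in the definition of
        \<open>F k\<close>, which contradicts the convergence to \<open>g x\<close>.\<close>
      show "g x \<in> U"
        using kN[of "max N N'"] N'[of "max N N'"] unfolding F_def by fastforce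
    qed
    then have "{x \<in> space M. g x \<in> U} = (\<Union>k. \<Union>N. \<Inter>n\<in>{N..}. {x \<in> space M. f n x \<in> F k})"
      by (auto simp: Bex_def Ball_def) blast
    moreover have "(\<Inter>n\<in>{N..}. {x \<in> space M. f n x \<in> F k}) \<in> sets M" for k N
      using F by (intro sets.countable_INT') auto
    ultimately show "{x \<in> space M. g x \<in> U} \<in> sets M" by auto
  qed
  ultimately show ?thesis unfolding sep_measurable_def using R(1) by blast
qed

abbreviation "SM M \<equiv> {f. strongly_measurable M smul q f}"

lemma strongly_measurable_alt:
  "strongly_measurable M smul q f \<longleftrightarrow>
     f \<in> measurable M borelT \<and> (\<exists>S. sep_subspace S \<and> (AE x in M. f x \<in> S))"
  unfolding strongly_measurable_def sep_subspace_iff by auto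

lemma sep_measurable_imp_strongly_measurable: "sep_measurable M f \<Longrightarrow> strongly_measurable M smul q f"
  unfolding sep_measurable_def strongly_measurable_alt by (auto intro!: AE_I2)

text \<open>The exceptional set is enlarged to a measurable null set \<open>N\<close>, on which the
  function is replaced by 0, a value in every subspace.\<close>

lemma strongly_measurable_sep_measurable:
  assumes "strongly_measurable M smul q f"
  obtains g where "sep_measurable M g" "AE x in M. f x = g x"
proof -
  obtain S where f: "f \<in> measurable M borelT" and S: "sep_subspace S" "AE x in M. f x \<in> S"
    using assms unfolding strongly_measurable_alt by blast
  obtain N where N: "N \<in> null_sets M" "{x \<in> space M. f x \<notin> S} \<subseteq> N"
    using S(2) unfolding eventually_ae_filter by blast
  show thesis
  proof
    have "N \<in> sets M" using N by auto
    then have "{x \<in> space M. x \<notin> N} \<in> sets M" by (metis Collect_mem_eq sets.sets_Collect_neg sets.sets_into_space sets.Int_space_eq2 Int_def inf_commute)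
    then have "(\<lambda>x. if x \<notin> N then f x else 0) \<in> measurable M borelT"
      using f sep_measurable_zero[of M] unfolding sep_measurable_def by (intro measurable_If) auto
    then show "sep_measurable M (\<lambda>x. if x \<notin> N then f x else 0)"
      unfolding sep_measurable_def using S(1) sep_subspaceD(1)[OF S(1)] N(2) by (intro conjI exI[of _ S]) auto
    show "AE x in M. f x = (if x \<notin> N then f x else 0)" using AE_not_in[OF N(1)] by eventually_elim auto
  qed
qed

end

section \<open>Classes of strongly measurable functions\<close>

context quasi_banach_target
begin

lemma sep_measurable_uminus: "sep_measurable M f \<Longrightarrow> sep_measurable M (\<lambda>x. - f x)"
  using sep_measurable_smul[of M f "-1"] by (simp add: smul_minus_1)

definition cls :: "'a measure \<Rightarrow> ('a \<Rightarrow> 'b) \<Rightarrow> ('a \<Rightarrow> 'b) set" where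
  "cls M f = ae_rel M smul q `` {f}"

lemma mem_cls: "g \<in> cls M f \<longleftrightarrow> strongly_measurable M smul q f \<and> strongly_measurable M smul q g \<and> (AE x in M. f x = g x)"
  by (auto simp: cls_def ae_rel_def)

lemma equiv_ae_rel: "equiv (SM M) (ae_rel M smul q)"
proof (rule equivI)
  show "ae_rel M smul q \<subseteq> SM M \<times> SM M" by (auto simp: ae_rel_def)
  show "refl_on (SM M) (ae_rel M smul q)" by (auto simp: refl_on_def ae_rel_def)
  show "sym (ae_rel M smul q)" by (rule symI) (auto simp: ae_rel_def elim: AE_mp)
  show "trans (ae_rel M smul q)" by (rule transI) (auto simp: ae_rel_def elim: AE_mp)
qed

lemma cls_eq_iff:
  "strongly_measurable M smul q f \<Longrightarrow> strongly_measurable M smul q g \<Longrightarrow>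
    cls M f = cls M g \<longleftrightarrow> (AE x in M. f x = g x)"
  unfolding cls_def using eq_equiv_class_iff2[OF equiv_ae_rel, of f M g]
  by (subst eq_equiv_class_iff[OF equiv_ae_rel]) (auto simp: ae_rel_def)

lemma cls_eqI: "sep_measurable M f \<Longrightarrow> sep_measurable M g \<Longrightarrow> AE x in M. f x = g x \<Longrightarrow> cls M f = cls M g"
  by (simp add: cls_eq_iff sep_measurable_imp_strongly_measurable)

abbreviation "L M \<equiv> L_all M smul q"

lemma cls_carrier [intro, simp]: "sep_measurable M f \<Longrightarrow> cls M f \<in> carrier (L M)"
  using sep_measurable_imp_strongly_measurable by (auto simp: L_all_def cls_def quotient_def)

text \<open>Pointwise operations are safe on these representatives, so all calculations with classes
  start here.\<close>

lemma carrier_cls: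
  assumes "A \<in> carrier (L M)"
  obtains f where "sep_measurable M f" "A = cls M f"
proof -
  obtain f where f: "strongly_measurable M smul q f" "A = cls M f"
    using assms by (auto simp: L_all_def cls_def quotient_def)
  obtain g where g: "sep_measurable M g" "AE x in M. f x = g x" using strongly_measurable_sep_measurable[OF f(1)] by blast
  then have "cls M f = cls M g" using f(1) by (simp add: cls_eq_iff sep_measurable_imp_strongly_measurable)
  then show thesis using that g(1) f(2) by blast
qed

lemma add_cls:
  assumes "sep_measurable M f" "sep_measurable M g"
  shows "cls M f \<oplus>\<^bsub>L M\<^esub> cls M g = cls M (\<lambda>x. f x + g x)"
proof (intro equalityI subsetI)
  fix h assume "h \<in> cls M f \<oplus>\<^bsub>L M\<^esub> cls M g"
  then obtain f' g' where *: "f' \<in> cls M f" "g' \<in> cls M g" "h \<in> cls M (\<lambda>x. f' x + g' x)"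
    by (auto simp: L_all_def cls_def)
  then have "AE x in M. f x + g x = h x" unfolding mem_cls by (auto elim: AE_mp)
  then show "h \<in> cls M (\<lambda>x. f x + g x)"
    using * sep_measurable_add[OF assms] unfolding mem_cls by (auto intro: sep_measurable_imp_strongly_measurable)
next
  fix h assume "h \<in> cls M (\<lambda>x. f x + g x)"
  moreover have "f \<in> cls M f" "g \<in> cls M g" using assms by (auto simp: mem_cls sep_measurable_imp_strongly_measurable)
  ultimately show "h \<in> cls M f \<oplus>\<^bsub>L M\<^esub> cls M g" by (auto simp: L_all_def cls_def)
qed

lemma smult_cls:
  assumes "sep_measurable M f"
  shows "c \<odot>\<^bsub>L M\<^esub> cls M f = cls M (\<lambda>x. smul c (f x))"
proof (intro equalityI subsetI)
  fix h assume "h \<in> c \<odot>\<^bsub>L M\<^esub> cls M f"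
  then obtain f' where *: "f' \<in> cls M f" "h \<in> cls M (\<lambda>x. smul c (f' x))"
    by (auto simp: L_all_def cls_def)
  then have "AE x in M. smul c (f x) = h x" unfolding mem_cls by (auto elim: AE_mp)
  then show "h \<in> cls M (\<lambda>x. smul c (f x))"
    using * sep_measurable_smul[OF assms] unfolding mem_cls by (auto intro: sep_measurable_imp_strongly_measurable)
next
  fix h assume "h \<in> cls M (\<lambda>x. smul c (f x))"
  moreover have "f \<in> cls M f" using assms by (auto simp: mem_cls sep_measurable_imp_strongly_measurable)
  ultimately show "h \<in> c \<odot>\<^bsub>L M\<^esub> cls M f" by (auto simp: L_all_def cls_def)
qed

lemma zero_cls: "\<zero>\<^bsub>L M\<^esub> = cls M (\<lambda>x. 0)"
  by (simp add: L_all_def cls_def)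

lemma vspace_L: "vspace (L M)"
proof (rule moduleI)
  note simps = add_cls smult_cls zero_cls sep_measurable_add sep_measurable_smul sep_measurable_zero
  show "abelian_group (L M)"
  proof (rule abelian_groupI)
    fix x y z assume "x \<in> carrier (L M)" "y \<in> carrier (L M)" "z \<in> carrier (L M)"
    then obtain f g h where "sep_measurable M f" "x = cls M f" "sep_measurable M g" "y = cls M g" "sep_measurable M h" "z = cls M h"
      by (metis carrier_cls)
    then show "x \<oplus>\<^bsub>L M\<^esub> y \<oplus>\<^bsub>L M\<^esub> z = x \<oplus>\<^bsub>L M\<^esub> (y \<oplus>\<^bsub>L M\<^esub> z)"
      by (simp add: simps add.assoc)
  next
    fix x y assume "x \<in> carrier (L M)" "y \<in> carrier (L M)"
    then obtain f g where fg: "sep_measurable M f" "x = cls M f" "sep_measurable M g" "y = cls M g"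
      by (metis carrier_cls)
    then show "x \<oplus>\<^bsub>L M\<^esub> y = y \<oplus>\<^bsub>L M\<^esub> x" "x \<oplus>\<^bsub>L M\<^esub> y \<in> carrier (L M)"
      by (simp_all add: simps add.commute)
  next
    fix x assume "x \<in> carrier (L M)"
    then obtain f where f: "sep_measurable M f" "x = cls M f" by (metis carrier_cls)
    then show "\<zero>\<^bsub>L M\<^esub> \<oplus>\<^bsub>L M\<^esub> x = x" by (simp add: simps)
    show "\<exists>y\<in>carrier (L M). y \<oplus>\<^bsub>L M\<^esub> x = \<zero>\<^bsub>L M\<^esub>"
      using f by (intro bexI[of _ "cls M (\<lambda>x. - f x)"]) (simp_all add: simps sep_measurable_uminus)
  qed (simp add: simps)
  fix a b :: 'k and x assume "x \<in> carrier (L M)"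
  then obtain f where f: "sep_measurable M f" "x = cls M f" by (metis carrier_cls)
  then show "a \<odot>\<^bsub>L M\<^esub> x \<in> carrier (L M)"
    "(a \<oplus>\<^bsub>ring_of_type_algebra\<^esub> b) \<odot>\<^bsub>L M\<^esub> x = a \<odot>\<^bsub>L M\<^esub> x \<oplus>\<^bsub>L M\<^esub> b \<odot>\<^bsub>L M\<^esub> x"
    "(a \<otimes>\<^bsub>ring_of_type_algebra\<^esub> b) \<odot>\<^bsub>L M\<^esub> x = a \<odot>\<^bsub>L M\<^esub> (b \<odot>\<^bsub>L M\<^esub> x)"
    "\<one>\<^bsub>ring_of_type_algebra :: 'k ring\<^esub> \<odot>\<^bsub>L M\<^esub> x = x"
    by (simp_all add: simps smul_distrib)
  fix y assume "y \<in> carrier (L M)"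
  then obtain g where g: "sep_measurable M g" "y = cls M g" by (metis carrier_cls)
  show "a \<odot>\<^bsub>L M\<^esub> (x \<oplus>\<^bsub>L M\<^esub> y) = a \<odot>\<^bsub>L M\<^esub> x \<oplus>\<^bsub>L M\<^esub> a \<odot>\<^bsub>L M\<^esub> y"
    using f g by (simp add: simps smul_distrib)
qed (auto intro: cring_from_type_algebra)

text \<open>\<open>pt_norm\<close> uses a representative chosen by \<open>SOME\<close>, which need
  not be \<open>f\<close>; hence an equality almost everywhere only. Its measurability is exact,
  because strong measurability includes Borel measurability.\<close>

lemma pt_norm_cls:
  assumes "sep_measurable M f"
  shows "AE x in M. pt_norm q (cls M f) x = ennreal (q (f x))"
    and "pt_norm q (cls M f) \<in> borel_measurable M"
proof -
  have "f \<in> cls M f" using assms by (auto simp: mem_cls sep_measurable_imp_strongly_measurable)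
  then have s: "(SOME g. g \<in> cls M f) \<in> cls M f" by (rule someI[of "\<lambda>g. g \<in> cls M f"])
  then have "AE x in M. f x = (SOME g. g \<in> cls M f) x" unfolding mem_cls by blast
  then show "AE x in M. pt_norm q (cls M f) x = ennreal (q (f x))"
    unfolding pt_norm_def by (auto elim: AE_mp)
  have "(SOME g. g \<in> cls M f) \<in> measurable M borelT"
    using s unfolding mem_cls strongly_measurable_alt by blast
  then show "pt_norm q (cls M f) \<in> borel_measurable M"
    unfolding pt_norm_def by (intro measurable_compose[OF measurable_q measurable_ennreal])
qed

lemma pt_norm_measurable [measurable]: "A \<in> carrier (L M) \<Longrightarrow> pt_norm q A \<in> borel_measurable M"
  by (metis carrier_cls pt_norm_cls(2))

lemma pt_norm_add:
  assumes "A \<in> carrier (L M)" "B \<in> carrier (L M)"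
  shows "AE x in M. pt_norm q (A \<oplus>\<^bsub>L M\<^esub> B) x \<le> ennreal kappa * (pt_norm q A x + pt_norm q B x)"
proof -
  obtain f g where fg: "sep_measurable M f" "A = cls M f" "sep_measurable M g" "B = cls M g"
    using assms by (metis carrier_cls)
  have *: "ennreal (q (f x + g x)) \<le> ennreal kappa * (ennreal (q (f x)) + ennreal (q (g x)))" for x
    using kappa(2)[of "f x" "g x"] kappa(1)
    by (simp add: ennreal_leI flip: ennreal_plus ennreal_mult)
  show ?thesis
    using pt_norm_cls(1)[OF fg(1)] pt_norm_cls(1)[OF fg(3)] pt_norm_cls(1)[OF sep_measurable_add[OF fg(1,3)]]
    unfolding fg(2,4) add_cls[OF fg(1,3)] by eventually_elim (simp add: *)
qed

lemma pt_norm_smult: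
  assumes "A \<in> carrier (L M)"
  shows "AE x in M. pt_norm q (c \<odot>\<^bsub>L M\<^esub> A) x = ennreal (norm c) * pt_norm q A x"
proof -
  obtain f where f: "sep_measurable M f" "A = cls M f" using assms by (metis carrier_cls)
  show ?thesis
    using pt_norm_cls(1)[OF f(1)] pt_norm_cls(1)[OF sep_measurable_smul[OF f(1), of c]]
    unfolding f(2) smult_cls[OF f(1)] by eventually_elim (simp add: q_smul ennreal_mult)
qed

lemma pt_norm_zero: "AE x in M. pt_norm q \<zero>\<^bsub>L M\<^esub> x = 0"
  using pt_norm_cls(1)[OF sep_measurable_zero] by (simp add: zero_cls)

lemma pt_norm_eq_zero:
  assumes "A \<in> carrier (L M)" "AE x in M. pt_norm q A x = 0"
  shows "A = \<zero>\<^bsub>L M\<^esub>"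
proof -
  obtain f where f: "sep_measurable M f" "A = cls M f" using assms by (metis carrier_cls)
  have *: "f x = 0" if "ennreal (q (f x)) = 0" for x
    using that q_nonneg[of "f x"] by (metis ennreal_eq_0_iff antisym q_eq_0)
  have "AE x in M. f x = 0"
    using pt_norm_cls(1)[OF f(1)] assms(2) unfolding f(2)
    by eventually_elim (rule *, metis)
  then show ?thesis unfolding f(2) zero_cls by (intro cls_eqI f(1) sep_measurable_zero)
qed

lemma diff_cls:
  assumes "sep_measurable M f" "sep_measurable M g"
  shows "cls M f \<ominus>\<^bsub>L M\<^esub> cls M g = cls M (\<lambda>x. f x - g x)"
proof -
  interpret LM: module "ring_of_type_algebra :: 'k ring" "L M" by (rule vspace_L)
  have "\<ominus>\<^bsub>L M\<^esub> cls M g = cls M (\<lambda>x. - g x)"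
    using assms by (intro LM.M.minus_equality) (simp_all add: sep_measurable_uminus add_cls zero_cls)
  then show ?thesis using assms by (simp add: LM.M.minus_eq add_cls sep_measurable_uminus)
qed

end

section \<open>Modular function norms\<close>

lemma divide_ennreal_eq: "0 < t \<Longrightarrow> x / ennreal t = ennreal (1 / t) * x"
  by (simp add: divide_ennreal_def inverse_ennreal inverse_eq_divide mult.commute)

lemma gauge_bar_alt: "gauge_bar \<rho> h = Inf (ennreal ` {t. 0 < t \<and> \<rho> (\<lambda>x. ennreal (1 / t) * h x) < ennreal t})"
  unfolding gauge_bar_def by (simp add: divide_ennreal_eq setcompr_eq_image cong: conj_cong)

lemma gauge_tilde_alt: "gauge_tilde \<rho> h = Inf (ennreal ` {t. 0 < t \<and> \<rho> (\<lambda>x. ennreal (1 / t) * h x) < 1})"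
  unfolding gauge_tilde_def by (simp add: divide_ennreal_eq setcompr_eq_image cong: conj_cong)

text \<open>An infimum is below \<open>e\<close> exactly when some competitor is. Later arguments
  work with the competitors \<open>t\<close> and never with the infimum.\<close>

lemma gauge_bar_less:
  "0 < e \<Longrightarrow> gauge_bar \<rho> h < ennreal e \<longleftrightarrow> (\<exists>t>0. t < e \<and> \<rho> (\<lambda>x. ennreal (1 / t) * h x) < ennreal t)"
  by (auto simp: gauge_bar_alt Inf_less_iff ennreal_less_iff)

lemma gauge_tilde_less:
  "0 < e \<Longrightarrow> gauge_tilde \<rho> h < ennreal e \<longleftrightarrow> (\<exists>t>0. t < e \<and> \<rho> (\<lambda>x. ennreal (1 / t) * h x) < 1)"
  by (auto simp: gauge_tilde_alt Inf_less_iff ennreal_less_iff)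

lemma gauge_bar_finite:
  "gauge_bar \<rho> h < \<infinity> \<longleftrightarrow> (\<exists>t>0. \<rho> (\<lambda>x. ennreal (1 / t) * h x) < ennreal t)"
  by (auto simp: gauge_bar_alt Inf_less_iff)

lemma gauge_tilde_finite:
  "gauge_tilde \<rho> h < \<infinity> \<longleftrightarrow> (\<exists>t>0. \<rho> (\<lambda>x. ennreal (1 / t) * h x) < 1)"
  by (auto simp: gauge_tilde_alt Inf_less_iff)

lemma gauge_on_mono:
  "gauge_on M \<sigma> \<Longrightarrow> f \<in> borel_measurable M \<Longrightarrow> g \<in> borel_measurable M \<Longrightarrow> AE x in M. f x \<le> g x \<Longrightarrow> \<sigma> f \<le> \<sigma> g"
  unfolding gauge_on_def by blast

lemma gauge_on_cong:
  assumes "gauge_on M \<sigma>" "f \<in> borel_measurable M" "g \<in> borel_measurable M" "AE x in M. f x = g x"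
  shows "\<sigma> f = \<sigma> g"
proof (rule antisym)
  show "\<sigma> f \<le> \<sigma> g" by (rule gauge_on_mono[OF assms(1-3)]) (use assms(4) in \<open>auto elim: AE_mp\<close>)
  show "\<sigma> g \<le> \<sigma> f" by (rule gauge_on_mono[OF assms(1,3,2)]) (use assms(4) in \<open>auto elim: AE_mp\<close>)
qed

lemma gauge_on_scale_mono:
  assumes "gauge_on M \<sigma>" "f \<in> borel_measurable M" "g \<in> borel_measurable M" "AE x in M. f x \<le> g x" "a \<le> b"
  shows "\<sigma> (\<lambda>x. ennreal a * f x) \<le> \<sigma> (\<lambda>x. ennreal b * g x)"
proof (rule gauge_on_mono[OF assms(1)])
  show "AE x in M. ennreal a * f x \<le> ennreal b * g x"
    using assms(4) by eventually_elim (intro mult_mono ennreal_leI assms(5), auto)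
qed (use assms in auto)

text \<open>With its analogue for \<open>gauge_tilde\<close>, this makes results about a general
  gauge, such as the description of \<open>L_basis\<close>, available for the associated
  gauges.\<close>

lemma gauge_on_bar:
  assumes "gauge_on M \<rho>"
  shows "gauge_on M (gauge_bar \<rho>)"
  unfolding gauge_on_def gauge_bar_alt
proof (intro ballI impI Inf_superset_mono image_mono)
  fix f g :: "'a \<Rightarrow> ennreal"
  assume fg: "f \<in> borel_measurable M" "g \<in> borel_measurable M" "AE x in M. f x \<le> g x"
  show "{t. 0 < t \<and> \<rho> (\<lambda>x. ennreal (1 / t) * g x) < ennreal t} \<subseteq>
        {t. 0 < t \<and> \<rho> (\<lambda>x. ennreal (1 / t) * f x) < ennreal t}"
    using gauge_on_scale_mono[OF assms fg order_refl] by (auto intro: le_less_trans)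
qed

lemma gauge_on_tilde:
  assumes "gauge_on M \<rho>"
  shows "gauge_on M (gauge_tilde \<rho>)"
  unfolding gauge_on_def gauge_tilde_alt
proof (intro ballI impI Inf_superset_mono image_mono)
  fix f g :: "'a \<Rightarrow> ennreal"
  assume fg: "f \<in> borel_measurable M" "g \<in> borel_measurable M" "AE x in M. f x \<le> g x"
  show "{t. 0 < t \<and> \<rho> (\<lambda>x. ennreal (1 / t) * g x) < 1} \<subseteq>
        {t. 0 < t \<and> \<rho> (\<lambda>x. ennreal (1 / t) * f x) < 1}"
    using gauge_on_scale_mono[OF assms fg order_refl] by (auto intro: le_less_trans)
qed

locale modular_space =
  quasi_banach_target smul q + sigma_finite_measure M
  for smul :: "'k::real_normed_field \<Rightarrow> 'b::ab_group_add \<Rightarrow> 'b" and q :: "'b \<Rightarrow> real"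
    and M :: "'a measure" +
  fixes \<rho> :: "('a \<Rightarrow> ennreal) \<Rightarrow> ennreal"
  assumes modular: "modular_function_norm M \<rho>"
begin

abbreviation "LM \<equiv> L_all M smul q"
abbreviation "N \<equiv> pt_norm q :: ('a \<Rightarrow> 'b) set \<Rightarrow> 'a \<Rightarrow> ennreal"
abbreviation "L\<rho> \<equiv> L_space M smul q \<rho>"

sublocale LM: module "ring_of_type_algebra :: 'k ring" LM by (rule vspace_L)

lemma smult_LM [simp]:
  "A \<in> carrier LM \<Longrightarrow> (c::'k) \<odot>\<^bsub>LM\<^esub> A \<in> carrier LM"
  "A \<in> carrier LM \<Longrightarrow> (a::'k) \<odot>\<^bsub>LM\<^esub> (b \<odot>\<^bsub>LM\<^esub> A) = (a * b) \<odot>\<^bsub>LM\<^esub> A"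
  "A \<in> carrier LM \<Longrightarrow> (1::'k) \<odot>\<^bsub>LM\<^esub> A = A"
  using LM.smult_closed[of c A] LM.smult_assoc1[of a b A] LM.smult_one[of A]
  by (simp_all add: ring_of_type_algebra_def)

section \<open>The axioms of a modular function norm in usable form\<close>

lemma gauge: "gauge_on M \<rho>"
  using modular unfolding modular_function_norm_def by blast

lemma rho_add:
  obtains k r :: real where "0 < k" "0 < r" "\<And>f g. f \<in> borel_measurable M \<Longrightarrow> g \<in> borel_measurable M \<Longrightarrow>
    \<rho> (\<lambda>x. f x + g x) \<le> ennreal k * (\<rho> (\<lambda>x. ennreal r * f x) + \<rho> (\<lambda>x. ennreal r * g x))"
proof -
  have "\<exists>k r :: real. 0 < k \<and> 0 < r \<and> (\<forall>f\<in>borel_measurable M. \<forall>g\<in>borel_measurable M.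
        \<rho> (\<lambda>x. f x + g x) \<le> ennreal k * (\<rho> (\<lambda>x. ennreal r * f x) + \<rho> (\<lambda>x. ennreal r * g x)))"
    using modular unfolding modular_function_norm_def by (elim conjE)
  then show thesis by (elim exE conjE) (rule that; assumption?; simp)
qed

lemma rho_small_sets:
  assumes "E \<in> sets M" "emeasure M E < \<infinity>"
  obtains u :: real where "0 < u" "\<rho> (\<lambda>x. ennreal u * indicator E x) < \<infinity>"
    "\<And>\<epsilon>::real. 0 < \<epsilon> \<Longrightarrow> \<exists>\<delta>::real. 0 < \<delta> \<and> (\<forall>A\<in>sets M. A \<subseteq> E \<longrightarrow>
       \<rho> (\<lambda>x. ennreal u * indicator A x) \<le> ennreal \<delta> \<longrightarrow> emeasure M A \<le> ennreal \<epsilon>)"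
proof -
  have "\<forall>E\<in>sets M. emeasure M E < \<infinity> \<longrightarrow> (\<exists>u::real. 0 < u \<and>
        \<rho> (\<lambda>x. ennreal u * indicator E x) < \<infinity> \<and>
        (\<forall>\<epsilon>::real. 0 < \<epsilon> \<longrightarrow> (\<exists>\<delta>::real. 0 < \<delta> \<and> (\<forall>A\<in>sets M. A \<subseteq> E \<longrightarrow>
           \<rho> (\<lambda>x. ennreal u * indicator A x) \<le> ennreal \<delta> \<longrightarrow> emeasure M A \<le> ennreal \<epsilon>))))"
    using modular unfolding modular_function_norm_def by (elim conjE)
  from mp[OF bspec[OF this assms(1)] assms(2)] show thesis
    by (elim exE conjE) (rule that; assumption?; simp)
qed

lemma rho_tendsto_0:
  "f \<in> borel_measurable M \<Longrightarrow> \<rho> f < \<infinity> \<Longrightarrow> ((\<lambda>t::real. \<rho> (\<lambda>x. ennreal t * f x)) \<longlongrightarrow> 0) (at_right 0)"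
  using modular unfolding modular_function_norm_def by (elim conjE) blast

lemma rho_Fatou:
  obtains F :: real where "1 \<le> F" "\<And>f g. (\<And>n. f n \<in> borel_measurable M) \<Longrightarrow> g \<in> borel_measurable M \<Longrightarrow>
    (\<And>n. AE x in M. f n x \<le> f (Suc n) x) \<Longrightarrow> (AE x in M. (\<lambda>n::nat. f n x) \<longlonglongrightarrow> g x) \<Longrightarrow>
    \<rho> g \<le> ennreal F * lim (\<lambda>n. \<rho> (f n))"
proof -
  have "\<exists>F::real. 1 \<le> F \<and> (\<forall>f g. (\<forall>n. f n \<in> borel_measurable M) \<longrightarrow> g \<in> borel_measurable M \<longrightarrow>
        (\<forall>n. AE x in M. f n x \<le> f (Suc n) x) \<longrightarrow>
        (AE x in M. (\<lambda>n::nat. f n x) \<longlonglongrightarrow> g x) \<longrightarrow>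
        \<rho> g \<le> ennreal F * lim (\<lambda>n. \<rho> (f n)))"
    using modular unfolding modular_function_norm_def by (elim conjE)
  then show thesis by (elim exE conjE) (rule that; assumption?; simp)
qed

text \<open>This is \<open>\<rho> (h / t)\<close>, written with a real factor so that successive
  dilations combine. It decreases as \<open>t\<close> grows.\<close>

definition rho_div :: "real \<Rightarrow> ('a \<Rightarrow> ennreal) \<Rightarrow> ennreal" where
  "rho_div t h = \<rho> (\<lambda>x. ennreal (1 / t) * h x)"

lemma rho_div_mono:
  assumes "f \<in> borel_measurable M" "g \<in> borel_measurable M" "AE x in M. f x \<le> g x" "0 < s" "s \<le> t"
  shows "rho_div t f \<le> rho_div s g"
  unfolding rho_div_def using assms by (intro gauge_on_scale_mono[OF gauge]) (auto simp: frac_le)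

lemma rho_div_antimono: "h \<in> borel_measurable M \<Longrightarrow> 0 < s \<Longrightarrow> s \<le> t \<Longrightarrow> rho_div t h \<le> rho_div s h"
  by (rule rho_div_mono) auto

lemma rho_div_cong:
  "f \<in> borel_measurable M \<Longrightarrow> g \<in> borel_measurable M \<Longrightarrow> AE x in M. f x = g x \<Longrightarrow> rho_div t f = rho_div t g"
  unfolding rho_div_def by (rule gauge_on_cong[OF gauge]) (auto elim: AE_mp)

text \<open>The left side decreases and the right side increases in \<open>t\<close>. Hence a ball
  of \<open>bar_norm\<close> can be tested at its own radius, as in
  \<open>bar_norm_lessD\<close>.\<close>

lemma rho_div_less_mono:
  assumes "h \<in> borel_measurable M" "0 < s" "s \<le> t" "rho_div s h < ennreal s"
  shows "rho_div t h < ennreal t"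
  using rho_div_antimono[OF assms(1-3)] assms(4) ennreal_leI[OF assms(3)] by (meson le_less_trans less_le_trans)

lemma rho_div_scale:
  "0 < s \<Longrightarrow> 0 < t \<Longrightarrow> rho_div t (\<lambda>x. ennreal (1 / s) * h x) = rho_div (s * t) h"
  unfolding rho_div_def by (simp add: mult.assoc[symmetric] ennreal_mult[symmetric]) (simp add: mult.commute)

text \<open>Condition (c) read at infinity: multiplying \<open>h / t\<close> by a factor tending to
  0 amounts to dividing \<open>h\<close> by \<open>s\<close> tending to infinity.\<close>

lemma rho_div_small:
  assumes h: "h \<in> borel_measurable M" and t: "0 < t" "rho_div t h < \<infinity>" and e: "0 < e"
  obtains s0 where "0 < s0" "\<And>s. s0 \<le> s \<Longrightarrow> rho_div s h < ennreal e"
proof -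
  have "((\<lambda>\<tau>::real. \<rho> (\<lambda>x. ennreal \<tau> * (ennreal (1 / t) * h x))) \<longlongrightarrow> 0) (at_right 0)"
    using t h unfolding rho_div_def by (intro rho_tendsto_0) auto
  then have "eventually (\<lambda>\<tau>. \<rho> (\<lambda>x. ennreal \<tau> * (ennreal (1 / t) * h x)) < ennreal e) (at_right 0)"
    using e by (intro order_tendstoD(2)) auto
  then obtain b where b: "b > 0" "\<And>\<tau>. 0 < \<tau> \<Longrightarrow> \<tau> < b \<Longrightarrow> \<rho> (\<lambda>x. ennreal \<tau> * (ennreal (1 / t) * h x)) < ennreal e"
    unfolding eventually_at_right_field by blast
  show thesis
  proof
    \<comment> \<open>For \<open>s\<close> at least \<open>2 * t / b\<close> the factor
      \<open>t / s\<close> is at most \<open>b / 2\<close>, hence strictly below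
      \<open>b\<close>.\<close>
    show "0 < 2 * t / b" using b t by simp
    fix s assume s: "2 * t / b \<le> s"
    have s0: "0 < s" using s b(1) t(1) by (meson divide_pos_pos less_le_trans mult_pos_pos zero_less_numeral)
    have "2 * t \<le> s * b" using s b(1) by (simp add: pos_divide_le_eq)
    then have "t / s < b" using s0 t(1) by (simp add: pos_divide_less_eq mult.commute)
    then have "\<rho> (\<lambda>x. ennreal (t / s) * (ennreal (1 / t) * h x)) < ennreal e"
      using s0 t(1) by (intro b(2)) auto
    moreover have "ennreal (t / s) * (ennreal (1 / t) * y) = ennreal (1 / s) * y" for y
      using s0 t(1) by (simp add: mult.assoc[symmetric] ennreal_mult[symmetric])
    ultimately show "rho_div s h < ennreal e" unfolding rho_div_def by simp
  qed
qed

text \<open>Condition (a) for classes. The constant \<open>kappa\<close> of the target is absorbed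
  in the dilation, so the \<open>r\<close> obtained is that of (a) times
  \<open>kappa\<close>.\<close>

lemma rho_div_add:
  obtains k r :: real where "0 < k" "0 < r"
    "\<And>A B t. A \<in> carrier LM \<Longrightarrow> B \<in> carrier LM \<Longrightarrow> 0 < t \<Longrightarrow>
       rho_div (r * t) (N (A \<oplus>\<^bsub>LM\<^esub> B)) \<le> ennreal k * (rho_div t (N A) + rho_div t (N B))"
proof -
  obtain k r :: real where kr: "0 < k" "0 < r" "\<And>f g. f \<in> borel_measurable M \<Longrightarrow> g \<in> borel_measurable M \<Longrightarrow>
    \<rho> (\<lambda>x. f x + g x) \<le> ennreal k * (\<rho> (\<lambda>x. ennreal r * f x) + \<rho> (\<lambda>x. ennreal r * g x))"
    by (rule rho_add) blast
  show thesis
  proof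
    show "0 < k" "0 < r * kappa" using kr kappa(1) by auto
    fix A B and t :: real assume AB: "A \<in> carrier LM" "B \<in> carrier LM" and t: "0 < t"
    have "rho_div (r * kappa * t) (N (A \<oplus>\<^bsub>LM\<^esub> B)) \<le> rho_div (r * kappa * t) (\<lambda>x. ennreal kappa * (N A x + N B x))"
      using AB t kr(2) kappa(1) pt_norm_add[OF AB] by (intro rho_div_mono) auto
    also have "\<dots> = \<rho> (\<lambda>x. ennreal (1 / (r * t)) * N A x + ennreal (1 / (r * t)) * N B x)"
      unfolding rho_div_def using kr(2) t kappa(1)
      by (simp add: mult.assoc[symmetric] ennreal_mult[symmetric] distrib_left)
    also have "\<dots> \<le> ennreal k * (\<rho> (\<lambda>x. ennreal r * (ennreal (1 / (r * t)) * N A x)) + \<rho> (\<lambda>x. ennreal r * (ennreal (1 / (r * t)) * N B x)))"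
      using AB by (intro kr(3)) auto
    also have "\<dots> = ennreal k * (rho_div t (N A) + rho_div t (N B))"
      unfolding rho_div_def using kr(2) t by (simp add: mult.assoc[symmetric] ennreal_mult[symmetric])
    finally show "rho_div (r * kappa * t) (N (A \<oplus>\<^bsub>LM\<^esub> B)) \<le> ennreal k * (rho_div t (N A) + rho_div t (N B))" .
  qed
qed

lemma rho_div_smult:
  assumes "A \<in> carrier LM" "0 < t" "0 < b" "norm (c::'k) \<le> b"
  shows "rho_div (b * t) (N (c \<odot>\<^bsub>LM\<^esub> A)) \<le> rho_div t (N A)"
proof -
  have "rho_div (b * t) (N (c \<odot>\<^bsub>LM\<^esub> A)) \<le> rho_div (b * t) (\<lambda>x. ennreal b * N A x)"
  proof (rule rho_div_mono)
    show "AE x in M. N (c \<odot>\<^bsub>LM\<^esub> A) x \<le> ennreal b * N A x"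
      using pt_norm_smult[OF assms(1), of c]
      by eventually_elim (use assms(4) in \<open>auto intro!: mult_right_mono ennreal_leI\<close>)
  qed (use assms in auto)
  also have "\<dots> = rho_div t (N A)"
    unfolding rho_div_def using assms by (simp add: mult.assoc[symmetric] ennreal_mult[symmetric])
  finally show ?thesis .
qed

lemma scaled_finite_iff:
  "(\<exists>u::real. 0 < u \<and> \<sigma> (\<lambda>x. ennreal u * h x) < \<infinity>) \<longleftrightarrow> (\<exists>t::real. 0 < t \<and> \<sigma> (\<lambda>x. ennreal (1 / t) * h x) < (\<infinity>::ennreal))"
  by (metis divide_pos_pos divide_divide_eq_right div_by_1 mult_1 zero_less_one)

lemma carrier_L_space:
  "A \<in> carrier (L_space M smul q \<sigma>) \<longleftrightarrow> A \<in> carrier LM \<and> (\<exists>t::real. 0 < t \<and> \<sigma> (\<lambda>x. ennreal (1 / t) * N A x) < \<infinity>)"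
  unfolding L_space_def using scaled_finite_iff[of \<sigma> "N A"] by simp

lemma carrier_L\<rho>: "A \<in> carrier L\<rho> \<longleftrightarrow> A \<in> carrier LM \<and> (\<exists>t>0. rho_div t (N A) < \<infinity>)"
  unfolding rho_div_def carrier_L_space by auto

lemma L_space_simps [simp]:
  "add (L_space M smul q \<sigma>) = add LM" "smult (L_space M smul q \<sigma>) = smult LM"
  "\<zero>\<^bsub>L_space M smul q \<sigma>\<^esub> = \<zero>\<^bsub>LM\<^esub>"
  by (simp_all add: L_space_def)

lemma carrier_L\<rho>_I: "A \<in> carrier LM \<Longrightarrow> 0 < t \<Longrightarrow> rho_div t (N A) < ennreal e \<Longrightarrow> A \<in> carrier L\<rho>"
  unfolding carrier_L\<rho> using ennreal_less_top less_trans infinity_ennreal_def by metis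

lemma uminus_LM: assumes "A \<in> carrier LM" shows "\<ominus>\<^bsub>LM\<^esub> A = (-1::'k) \<odot>\<^bsub>LM\<^esub> A"
proof -
  have "(-1::'k) \<odot>\<^bsub>LM\<^esub> A \<oplus>\<^bsub>LM\<^esub> A = ((-1) + 1 :: 'k) \<odot>\<^bsub>LM\<^esub> A"
    using assms LM.smult_l_distr[of "-1" 1 A] by (simp add: ring_of_type_algebra_def)
  also have "\<dots> = \<zero>\<^bsub>LM\<^esub>"
    using assms LM.smult_l_null[of A] by (simp add: ring_of_type_algebra_def)
  finally show ?thesis using assms LM.M.minus_equality by simp
qed

text \<open>Finiteness of \<open>\<rho>\<close> at the zero function comes from condition (b) for
  the empty set.\<close>

lemma rho_div_zero: "rho_div 1 (N \<zero>\<^bsub>LM\<^esub>) < \<infinity>"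
proof -
  obtain u :: real where u: "0 < u" "\<rho> (\<lambda>x. ennreal u * indicator {} x) < \<infinity>"
    using rho_small_sets[of "{}"] by auto
  have "rho_div 1 (N \<zero>\<^bsub>LM\<^esub>) = rho_div 1 (\<lambda>x. 0)" using pt_norm_zero by (intro rho_div_cong) auto
  then show ?thesis using u by (simp add: rho_div_def)
qed

lemma submodule_L\<rho>: "submodule (carrier L\<rho>) (ring_of_type_algebra :: 'k ring) LM"
proof (rule LM.submoduleI)
  show "carrier L\<rho> \<subseteq> carrier LM" by (auto simp: carrier_L\<rho>)
  show "\<zero>\<^bsub>LM\<^esub> \<in> carrier L\<rho>" using rho_div_zero zero_less_one unfolding carrier_L\<rho> by (meson LM.M.zero_closed)
  have sm: "c \<odot>\<^bsub>LM\<^esub> A \<in> carrier L\<rho>" if AL: "A \<in> carrier L\<rho>" for c :: 'k and A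
  proof -
    obtain t where A: "A \<in> carrier LM" and t: "0 < t" "rho_div t (N A) < \<infinity>" using AL by (auto simp: carrier_L\<rho>)
    have "0 < norm c + 1" by (simp add: add_nonneg_pos)
    then show ?thesis
      using rho_div_smult[OF A t(1), of "norm c + 1" c] t A unfolding carrier_L\<rho>
      by (intro conjI exI[of _ "(norm c + 1) * t"]) (auto intro: le_less_trans)
  qed
  then show "c \<odot>\<^bsub>LM\<^esub> A \<in> carrier L\<rho>" if "c \<in> carrier (ring_of_type_algebra :: 'k ring)" "A \<in> carrier L\<rho>" for c A
    using that by blast
  show "\<ominus>\<^bsub>LM\<^esub> A \<in> carrier L\<rho>" if "A \<in> carrier L\<rho>" for A
    using sm[OF that, of "-1"] that by (simp add: uminus_LM carrier_L\<rho>)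
  fix A B assume "A \<in> carrier L\<rho>" "B \<in> carrier L\<rho>"
  then obtain s t where A: "A \<in> carrier LM" "0 < s" "rho_div s (N A) < \<infinity>" and B: "B \<in> carrier LM" "0 < t" "rho_div t (N B) < \<infinity>"
    by (auto simp: carrier_L\<rho>)
  obtain k r where kr: "0 < k" "0 < r" "\<And>A B t. A \<in> carrier LM \<Longrightarrow> B \<in> carrier LM \<Longrightarrow> 0 < t \<Longrightarrow>
       rho_div (r * t) (N (A \<oplus>\<^bsub>LM\<^esub> B)) \<le> ennreal k * (rho_div t (N A) + rho_div t (N B))"
    by (rule rho_div_add) blast
  have fin: "rho_div (max s t) (N A) < \<infinity>" "rho_div (max s t) (N B) < \<infinity>"
    using rho_div_antimono[of "N A" s "max s t"] rho_div_antimono[of "N B" t "max s t"] A B by (auto intro: le_less_trans)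
  have "rho_div (r * max s t) (N (A \<oplus>\<^bsub>LM\<^esub> B)) \<le> ennreal k * (rho_div (max s t) (N A) + rho_div (max s t) (N B))"
    using kr(3)[of A B "max s t"] A B by auto
  also have "\<dots> < \<infinity>" using fin by (simp add: ennreal_mult_less_top)
  finally show "A \<oplus>\<^bsub>LM\<^esub> B \<in> carrier L\<rho>"
    unfolding carrier_L\<rho> using A B kr(2) by (intro conjI exI[of _ "r * max s t"]) auto
qed

lemma vspace_L\<rho>: "vspace L\<rho>"
  using submodule.submodule_is_module[OF submodule_L\<rho> vspace_L] by (simp add: L_space_def)

text \<open>The balls of this functional turn out to generate all the topologies of the theorem.\<close>

definition bar_norm :: "('a \<Rightarrow> 'b) set \<Rightarrow> real" where
  "bar_norm A = enn2real (gauge_bar \<rho> (N A))"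

text \<open>Large dilations push the modular below 1, so a large \<open>t \<ge> 1\<close> is a
  competitor. Thus \<open>enn2real\<close> in \<open>bar_norm\<close> loses nothing on
  \<open>L\<rho>\<close>.\<close>

lemma gauge_bar_N_finite:
  assumes "A \<in> carrier L\<rho>"
  shows "gauge_bar \<rho> (N A) < \<infinity>"
proof -
  obtain t where A: "A \<in> carrier LM" "0 < t" "rho_div t (N A) < \<infinity>" using assms by (auto simp: carrier_L\<rho>)
  obtain s0 where s: "0 < s0" "\<And>s. s0 \<le> s \<Longrightarrow> rho_div s (N A) < ennreal 1"
    using rho_div_small[OF _ A(2,3), of 1] A(1) by auto
  have "ennreal 1 \<le> ennreal (max s0 1)" by (intro ennreal_leI) simp
  then have "rho_div (max s0 1) (N A) < ennreal (max s0 1)" using s(2)[of "max s0 1"] by (meson less_le_trans max.cobounded1)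
  then show ?thesis unfolding gauge_bar_finite rho_div_def using s(1) by (intro exI[of _ "max s0 1"]) auto
qed

lemma bar_norm_less_iff:
  assumes "A \<in> carrier L\<rho>" "0 < e"
  shows "bar_norm A < e \<longleftrightarrow> (\<exists>t>0. t < e \<and> rho_div t (N A) < ennreal t)"
proof -
  have "bar_norm A < e \<longleftrightarrow> gauge_bar \<rho> (N A) < ennreal e"
    using gauge_bar_N_finite[OF assms(1)] assms(2) unfolding bar_norm_def
    by (cases "gauge_bar \<rho> (N A)") (auto simp: ennreal_less_iff)
  then show ?thesis using gauge_bar_less[OF assms(2)] by (simp add: rho_div_def)
qed

lemma bar_norm_lessI: "A \<in> carrier LM \<Longrightarrow> 0 < t \<Longrightarrow> t < e \<Longrightarrow> rho_div t (N A) < ennreal t \<Longrightarrow> bar_norm A < e"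
  using bar_norm_less_iff[of A e] carrier_L\<rho>_I by force

lemma bar_norm_lessD:
  assumes "A \<in> carrier L\<rho>" "0 < e" "bar_norm A < e"
  shows "rho_div e (N A) < ennreal e"
proof -
  obtain t where "0 < t" "t < e" "rho_div t (N A) < ennreal t" using assms bar_norm_less_iff by blast
  then show ?thesis using rho_div_less_mono[of "N A" t e] assms(1) by (auto simp: carrier_L\<rho>)
qed

text \<open>On the part \<open>A\<close> of \<open>E\<close> where \<open>h > c\<close>, the
  function \<open>h / t\<close> dominates \<open>u\<close> as soon as \<open>t \<le> c / u\<close>.
  Hence \<open>u\<close> times the indicator of \<open>A\<close> has modular at most
  \<open>\<rho> (h / t) < t \<le> \<delta>\<close>, and (b) bounds the measure of \<open>A\<close>.
  The number \<open>t\<close> does not depend on \<open>h\<close>.\<close>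

lemma rho_div_small_measure:
  assumes E: "E \<in> sets M" "emeasure M E < \<infinity>" and c: "0 < c" "0 < (\<epsilon>::real)"
  obtains t where "0 < t" "\<And>h. h \<in> borel_measurable M \<Longrightarrow> rho_div t h < ennreal t \<Longrightarrow>
    emeasure M {x \<in> space M. x \<in> E \<and> ennreal c < h x} \<le> ennreal \<epsilon>"
proof -
  obtain u :: real where u: "0 < u" "\<And>\<epsilon>::real. 0 < \<epsilon> \<Longrightarrow> \<exists>\<delta>::real. 0 < \<delta> \<and> (\<forall>A\<in>sets M. A \<subseteq> E \<longrightarrow>
       \<rho> (\<lambda>x. ennreal u * indicator A x) \<le> ennreal \<delta> \<longrightarrow> emeasure M A \<le> ennreal \<epsilon>)"
    using rho_small_sets[OF E] by metis
  obtain \<delta> :: real where \<delta>: "0 < \<delta>" "\<And>A. A \<in> sets M \<Longrightarrow> A \<subseteq> E \<Longrightarrow>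
       \<rho> (\<lambda>x. ennreal u * indicator A x) \<le> ennreal \<delta> \<Longrightarrow> emeasure M A \<le> ennreal \<epsilon>"
    using u(2)[OF c(2)] by blast
  define t where "t = min \<delta> (c / u)"
  have t: "0 < t" "t \<le> \<delta>" "t \<le> c / u" using \<delta>(1) c(1) u(1) by (auto simp: t_def)
  show thesis
  proof
    show "0 < t" by fact
    fix h :: "'a \<Rightarrow> ennreal" assume h [measurable]: "h \<in> borel_measurable M" and rho_div: "rho_div t h < ennreal t"
    note E(1) [measurable]
    let ?A = "{x \<in> space M. x \<in> E \<and> ennreal c < h x}"
    have A: "?A \<in> sets M" by measurable
    have "u \<le> 1 / t * c" using t(1,3) u(1) by (simp add: field_simps)
    then have le: "ennreal u \<le> ennreal (1 / t) * ennreal c"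
      using t(1) c(1) by (simp add: ennreal_leI flip: ennreal_mult)
    have "\<rho> (\<lambda>x. ennreal u * indicator ?A x) \<le> rho_div t h"
      unfolding rho_div_def
    proof (intro gauge_on_mono[OF gauge] AE_I2)
      fix x
      have "ennreal u \<le> ennreal (1 / t) * h x" if "ennreal c < h x"
        using le that by (meson less_imp_le mult_left_mono order_trans zero_le)
      then show "ennreal u * indicator ?A x \<le> ennreal (1 / t) * h x" by (auto simp: indicator_def)
    qed (use A in auto)
    also have "\<dots> \<le> ennreal \<delta>" using rho_div t(2) ennreal_leI by (meson less_imp_le order_trans)
    finally show "emeasure M ?A \<le> ennreal \<epsilon>" by (intro \<delta>(2) A) auto
  qed
qed

text \<open>With \<open>\<epsilon>\<close> arbitrary, the preceding estimate makes the set where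
  \<open>h > 1 / Suc n\<close> null inside each member of a countable cover by sets of finite
  measure.\<close>

lemma AE_zero_of_rho_div:
  assumes h [measurable]: "h \<in> borel_measurable M" and rho_div: "\<And>t. 0 < t \<Longrightarrow> rho_div t h < ennreal t"
  shows "AE x in M. h x = 0"
proof -
  obtain E :: "nat \<Rightarrow> 'a set" where E: "range E \<subseteq> sets M" "(\<Union>i. E i) = space M" "\<And>i. emeasure M (E i) \<noteq> \<infinity>"
    using sigma_finite by blast
  have "AE x in M. \<not> (x \<in> E i \<and> ennreal (1 / Suc n) < h x)" for i n
  proof -
    have [measurable]: "E i \<in> sets M" using E(1) by auto
    have "emeasure M (E i) < \<infinity>" using E(3) by (simp add: less_top)
    have *: "emeasure M {x \<in> space M. x \<in> E i \<and> ennreal (1 / Suc n) < h x} \<le> 0 + ennreal \<epsilon>" if eps: "0 < \<epsilon>" for \<epsilon>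
    proof -
      obtain t where t: "0 < t" "\<And>h. h \<in> borel_measurable M \<Longrightarrow> rho_div t h < ennreal t \<Longrightarrow>
          emeasure M {x \<in> space M. x \<in> E i \<and> ennreal (1 / Suc n) < h x} \<le> ennreal \<epsilon>"
        by (rule rho_div_small_measure[of "E i" "1 / Suc n" \<epsilon>])
          (use eps E(1) \<open>emeasure M (E i) < \<infinity>\<close> in \<open>auto simp del: of_nat_Suc\<close>)
      show ?thesis using t(2)[OF h rho_div[OF t(1)]] by simp
    qed
    have "emeasure M {x \<in> space M. x \<in> E i \<and> ennreal (1 / Suc n) < h x} \<le> 0"
      by (rule ennreal_le_epsilon) (rule *)
    then have "{x \<in> space M. x \<in> E i \<and> ennreal (1 / Suc n) < h x} \<in> null_sets M"
      by (auto simp: null_sets_def)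
    then show ?thesis by (rule AE_I') auto
  qed
  then have "AE x in M. \<forall>i n. \<not> (x \<in> E i \<and> ennreal (1 / Suc n) < h x)"
    unfolding AE_all_countable by blast
  then show ?thesis
    using AE_space
  proof eventually_elim
    case (elim x)
    then have le: "h x \<le> ennreal (1 / Suc n)" for n using E(2) not_le by blast
    have *: "h x \<le> 0 + ennreal e" if e: "0 < e" for e
    proof -
      obtain n where "1 / real (Suc n) < e" using nat_approx_posE[OF e] by blast
      then show ?thesis using le[of n] ennreal_leI[of "1 / real (Suc n)" e] by (simp del: of_nat_Suc)
    qed
    have "h x \<le> 0" by (rule ennreal_le_epsilon) (rule *)
    then show ?case by simp
  qed
qed

lemma vs_gauge_bar_norm: "vs_gauge L\<rho> bar_norm"
proof (intro vs_gauge.intro vspace_L\<rho>; unfold L_space_simps)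
  obtain k r where kr: "0 < k" "0 < r" "\<And>A B t. A \<in> carrier LM \<Longrightarrow> B \<in> carrier LM \<Longrightarrow> 0 < t \<Longrightarrow>
       rho_div (r * t) (N (A \<oplus>\<^bsub>LM\<^esub> B)) \<le> ennreal k * (rho_div t (N A) + rho_div t (N B))"
    by (rule rho_div_add) blast
  fix e :: real assume e: "0 < e"
  \<comment> \<open>Addition dilates by \<open>r\<close> and multiplies the bound by
    \<open>k\<close>. The two entries keep \<open>r * t\<close> and \<open>k * (t + t)\<close> at
    most \<open>e / 2\<close>, so that the competitor \<open>e / 2\<close> is strictly below
    \<open>e\<close>.\<close>
  define t where "t = min (e / 2 / r) (e / (4 * k))"
  have t: "0 < t" "r * t \<le> e / 2" "2 * k * t \<le> e / 2"
    using e kr(1,2) by (auto simp: t_def min_def field_simps)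
  show "\<exists>d>0. \<forall>A\<in>carrier L\<rho>. \<forall>B\<in>carrier L\<rho>. bar_norm A < d \<longrightarrow> bar_norm B < d \<longrightarrow> bar_norm (A \<oplus>\<^bsub>LM\<^esub> B) < e"
  proof (intro exI[of _ t] conjI ballI impI t(1))
    fix A B assume AB: "A \<in> carrier L\<rho>" "B \<in> carrier L\<rho>" "bar_norm A < t" "bar_norm B < t"
    then have AB': "A \<in> carrier LM" "B \<in> carrier LM" by (auto simp: carrier_L\<rho>)
    have lt: "rho_div t (N A) < ennreal t" "rho_div t (N B) < ennreal t" using AB t(1) bar_norm_lessD by auto
    have "rho_div (e / 2) (N (A \<oplus>\<^bsub>LM\<^esub> B)) \<le> rho_div (r * t) (N (A \<oplus>\<^bsub>LM\<^esub> B))"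
      using AB' t(1,2) kr(2) by (intro rho_div_antimono) auto
    also have "\<dots> \<le> ennreal k * (rho_div t (N A) + rho_div t (N B))" using AB' t(1) kr(3) by blast
    also have "\<dots> < ennreal k * (ennreal t + ennreal t)"
      using lt kr(1) by (intro ennreal_mult_strict_left_mono add_strict_mono) auto
    also have "\<dots> = ennreal (2 * k * t)"
      using kr(1) t(1) by (simp add: algebra_simps flip: ennreal_plus ennreal_mult)
    also have "\<dots> \<le> ennreal (e / 2)" using t(3) by (rule ennreal_leI)
    finally show "bar_norm (A \<oplus>\<^bsub>LM\<^esub> B) < e" using AB' e by (intro bar_norm_lessI[of _ "e / 2"]) auto
  qed
next
  fix A and c :: 'k assume "A \<in> carrier L\<rho>" "norm c \<le> 1"
  then have A: "A \<in> carrier LM" "gauge_bar \<rho> (N A) < \<infinity>"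
    by (simp add: carrier_L\<rho>, intro gauge_bar_N_finite)
  have "gauge_bar \<rho> (N (c \<odot>\<^bsub>LM\<^esub> A)) \<le> gauge_bar \<rho> (N A)"
  proof (rule gauge_on_mono[OF gauge_on_bar[OF gauge]])
    show "AE x in M. N (c \<odot>\<^bsub>LM\<^esub> A) x \<le> N A x"
      using pt_norm_smult[OF A(1), of c]
    proof eventually_elim
      case (elim x)
      have "ennreal (norm c) * N A x \<le> 1 * N A x"
        using \<open>norm c \<le> 1\<close> by (intro mult_right_mono) auto
      with elim show ?case by simp
    qed
  qed (use A in auto)
  then show "bar_norm (c \<odot>\<^bsub>LM\<^esub> A) \<le> bar_norm A" unfolding bar_norm_def using A(2) by (intro enn2real_mono) auto
next
  fix A and e :: real assume "A \<in> carrier L\<rho>" and e: "0 < e"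
  then obtain t where A: "A \<in> carrier LM" "0 < t" "rho_div t (N A) < \<infinity>" by (auto simp: carrier_L\<rho>)
  obtain s where s: "0 < s" "rho_div s (N A) < ennreal (e / 2)"
    using rho_div_small[OF _ A(2,3), of "e / 2"] A(1) e by (metis half_gt_zero order_refl pt_norm_measurable)
  show "\<exists>d>0. \<forall>c::'k. norm c < d \<longrightarrow> bar_norm (c \<odot>\<^bsub>LM\<^esub> A) < e"
  proof (intro exI[of _ "e / 2 / s"] conjI allI impI)
    fix c :: 'k assume c: "norm c < e / 2 / s"
    \<comment> \<open>As \<open>norm c\<close> is below \<open>(e / 2) / s\<close>, dividing
      \<open>c A\<close> by \<open>e / 2\<close> gives a norm no larger than dividing
      \<open>A\<close> by \<open>s\<close>.\<close>
    have "rho_div (e / 2 / s * s) (N (c \<odot>\<^bsub>LM\<^esub> A)) \<le> rho_div s (N A)"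
      using c e s A by (intro rho_div_smult) auto
    then have "rho_div (e / 2) (N (c \<odot>\<^bsub>LM\<^esub> A)) < ennreal (e / 2)" using s by simp
    then show "bar_norm (c \<odot>\<^bsub>LM\<^esub> A) < e" using e A by (intro bar_norm_lessI[of _ "e / 2"]) auto
  qed (use e s in auto)
next
  fix A assume A: "A \<in> carrier L\<rho>" "\<And>e. 0 < e \<Longrightarrow> bar_norm A < e"
  then have "A \<in> carrier LM" by (auto simp: carrier_L\<rho>)
  moreover have "AE x in M. N A x = 0"
    using A bar_norm_lessD \<open>A \<in> carrier LM\<close> by (intro AE_zero_of_rho_div) auto
  ultimately show "A = \<zero>\<^bsub>LM\<^esub>" by (rule pt_norm_eq_zero)
qed

sublocale V: vs_gauge L\<rho> bar_norm by (rule vs_gauge_bar_norm)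

text \<open>Multiplying a ball by \<open>u\<close> amounts to dividing the argument of the gauge by
  \<open>u\<close>, so members of \<open>L_basis\<close> are sublevel sets of dilated
  gauges.\<close>

lemma L_basis_iff:
  assumes "gauge_on M \<sigma>"
  shows "S \<in> L_basis M smul q \<sigma> \<longleftrightarrow> (\<exists>u>0. \<exists>\<epsilon>>0. S = {A \<in> carrier LM. \<sigma> (\<lambda>x. ennreal (1 / u) * N A x) < ennreal \<epsilon>})"
proof -
  have eq: "(\<lambda>A. (of_real u :: 'k) \<odot>\<^bsub>LM\<^esub> A) ` L_ball M smul q \<sigma> \<epsilon> =
      {A \<in> carrier LM. \<sigma> (\<lambda>x. ennreal (1 / u) * N A x) < ennreal \<epsilon>}" (is "?l = ?r") if u: "0 < u" for u \<epsilon>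
  proof -
    have iff: "A \<in> L_ball M smul q \<sigma> \<epsilon> \<longleftrightarrow> (of_real u :: 'k) \<odot>\<^bsub>LM\<^esub> A \<in> ?r" if A: "A \<in> carrier LM" for A
    proof -
      have "\<sigma> (\<lambda>x. ennreal (1 / u) * N ((of_real u :: 'k) \<odot>\<^bsub>LM\<^esub> A) x) = \<sigma> (N A)"
      proof (rule gauge_on_cong[OF assms])
        show "AE x in M. ennreal (1 / u) * N ((of_real u :: 'k) \<odot>\<^bsub>LM\<^esub> A) x = N A x"
          using pt_norm_smult[OF A, of "of_real u"]
          by eventually_elim (use u in \<open>simp add: mult.assoc[symmetric] ennreal_mult[symmetric]\<close>)
      qed (use A in auto)
      then show ?thesis using A by (simp add: L_ball_def)
    qed
    have inv: "(of_real u :: 'k) \<odot>\<^bsub>LM\<^esub> ((of_real (1 / u)) \<odot>\<^bsub>LM\<^esub> A) = A" if "A \<in> carrier LM" for A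
      using that u by (simp flip: of_real_mult)
    show ?thesis
    proof (intro equalityI subsetI)
      fix A assume "A \<in> ?l"
      then obtain B where B: "B \<in> L_ball M smul q \<sigma> \<epsilon>" "A = (of_real u :: 'k) \<odot>\<^bsub>LM\<^esub> B" by blast
      then have "B \<in> carrier LM" by (simp add: L_ball_def)
      from iff[OF this] B show "A \<in> ?r" by blast
    next
      fix A assume A: "A \<in> ?r"
      then have A': "A \<in> carrier LM" by simp
      then have "(of_real (1 / u) :: 'k) \<odot>\<^bsub>LM\<^esub> A \<in> carrier LM" by simp
      from iff[OF this] have "(of_real (1 / u) :: 'k) \<odot>\<^bsub>LM\<^esub> A \<in> L_ball M smul q \<sigma> \<epsilon>"
        unfolding inv[OF A'] using A by blast
      then show "A \<in> ?l" using inv[OF A'] by (metis imageI)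
    qed
  qed
  have "S \<in> L_basis M smul q \<sigma> \<longleftrightarrow>
      (\<exists>u \<epsilon>. 0 < u \<and> 0 < \<epsilon> \<and> S = (\<lambda>A. (of_real u :: 'k) \<odot>\<^bsub>LM\<^esub> A) ` L_ball M smul q \<sigma> \<epsilon>)"
    unfolding L_basis_def by blast
  then show ?thesis using eq by (metis (no_types, lifting))
qed

text \<open>One comparison for \<open>\<rho>\<close>, \<open>gauge_bar \<rho>\<close> and
  \<open>gauge_tilde \<rho>\<close>. The common space and topology on the right do not mention
  \<open>\<sigma>\<close>, so the equalities in (ii) and (iv) are read off from two
  instances.\<close>

lemma L_topology_eqI:
  assumes "carrier (L_space M smul q \<sigma>) = carrier L\<rho>"
    and sub: "\<And>S. S \<in> L_basis M smul q \<sigma> \<Longrightarrow> S \<subseteq> carrier L\<rho> \<and> (\<exists>e>0. {A \<in> carrier L\<rho>. bar_norm A < e} \<subseteq> S)"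
    and sup: "\<And>e. 0 < e \<Longrightarrow> \<exists>S\<in>L_basis M smul q \<sigma>. S \<subseteq> {A \<in> carrier L\<rho>. bar_norm A < e}"
  shows "L_space M smul q \<sigma> = L\<rho>" "L_topology M smul q \<sigma> = V.T"
    "nbhd_basis_at V.T \<zero>\<^bsub>L\<rho>\<^esub> (L_basis M smul q \<sigma>)"
proof -
  show sp: "L_space M smul q \<sigma> = L\<rho>"
    using assms(1) by (simp add: L_space_def)
  show "nbhd_basis_at V.T \<zero>\<^bsub>L\<rho>\<^esub> (L_basis M smul q \<sigma>)" by (rule V.nbhd_basis_refine[OF sub sup])
  \<comment> \<open>\<open>L_topology\<close> asks for a translated basis member inside
    \<open>U\<close>, \<open>qn_topology\<close> for all points whose difference from
    \<open>A\<close> is small; translation by \<open>A\<close> matches the two.\<close>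
  have *: "(\<forall>A\<in>U. \<exists>S\<in>L_basis M smul q \<sigma>. (\<lambda>B. A \<oplus>\<^bsub>LM\<^esub> B) ` S \<subseteq> U) \<longleftrightarrow>
      (\<forall>A\<in>U. \<exists>e>0. \<forall>B\<in>carrier L\<rho>. bar_norm (B \<ominus>\<^bsub>L\<rho>\<^esub> A) < e \<longrightarrow> B \<in> U)" if U: "U \<subseteq> carrier L\<rho>" for U
  proof (intro ball_cong refl iffI)
    fix A assume A: "A \<in> U" "\<exists>S\<in>L_basis M smul q \<sigma>. (\<lambda>B. A \<oplus>\<^bsub>LM\<^esub> B) ` S \<subseteq> U"
    then have A': "A \<in> carrier L\<rho>" using U by blast
    obtain S e where S: "e > 0" "{A \<in> carrier L\<rho>. bar_norm A < e} \<subseteq> S" "\<And>B. B \<in> S \<Longrightarrow> A \<oplus>\<^bsub>LM\<^esub> B \<in> U"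
    proof -
      obtain S where S: "S \<in> L_basis M smul q \<sigma>" "(\<lambda>B. A \<oplus>\<^bsub>LM\<^esub> B) ` S \<subseteq> U" using A(2) by blast
      obtain e where "e > 0" "{A \<in> carrier L\<rho>. bar_norm A < e} \<subseteq> S" using sub[OF S(1)] by blast
      with S(2) show thesis by (intro that[of e S]) auto
    qed
    have "B \<in> U" if B: "B \<in> carrier L\<rho>" "bar_norm (B \<ominus>\<^bsub>L\<rho>\<^esub> A) < e" for B
    proof -
      have "A \<oplus>\<^bsub>LM\<^esub> (B \<ominus>\<^bsub>L\<rho>\<^esub> A) \<in> U" using B A' S(2) by (intro S(3)) auto
      moreover have "A \<oplus>\<^bsub>L\<rho>\<^esub> (B \<ominus>\<^bsub>L\<rho>\<^esub> A) = B"
      proof -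
        have "A \<oplus>\<^bsub>L\<rho>\<^esub> (B \<ominus>\<^bsub>L\<rho>\<^esub> A) = (B \<ominus>\<^bsub>L\<rho>\<^esub> A) \<oplus>\<^bsub>L\<rho>\<^esub> (A \<ominus>\<^bsub>L\<rho>\<^esub> \<zero>\<^bsub>L\<rho>\<^esub>)"
          unfolding V.diff_zero[OF A'] by (rule V.M.a_comm[OF A' V.minus_closed'[OF B(1) A']])
        also have "\<dots> = B \<ominus>\<^bsub>L\<rho>\<^esub> \<zero>\<^bsub>L\<rho>\<^esub>" by (rule V.diff_add_diff[OF B(1) V.M.zero_closed A'])
        finally show ?thesis unfolding V.diff_zero[OF B(1)] .
      qed
      ultimately show ?thesis by simp
    qed
    then show "\<exists>e>0. \<forall>B\<in>carrier L\<rho>. bar_norm (B \<ominus>\<^bsub>L\<rho>\<^esub> A) < e \<longrightarrow> B \<in> U" using S(1) by blast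
  next
    fix A assume A: "A \<in> U" "\<exists>e>0. \<forall>B\<in>carrier L\<rho>. bar_norm (B \<ominus>\<^bsub>L\<rho>\<^esub> A) < e \<longrightarrow> B \<in> U"
    then have A': "A \<in> carrier L\<rho>" using U by blast
    obtain e where e: "e > 0" "\<And>B. B\<in>carrier L\<rho> \<Longrightarrow> bar_norm (B \<ominus>\<^bsub>L\<rho>\<^esub> A) < e \<Longrightarrow> B \<in> U" using A(2) by blast
    obtain S where S: "S \<in> L_basis M smul q \<sigma>" "S \<subseteq> {A \<in> carrier L\<rho>. bar_norm A < e}" using sup[OF e(1)] by blast
    have "A \<oplus>\<^bsub>L\<rho>\<^esub> B \<in> U" if "B \<in> S" for B
    proof -
      have B: "B \<in> carrier L\<rho>" "bar_norm B < e" using that S(2) by auto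
      have "(A \<oplus>\<^bsub>L\<rho>\<^esub> B) \<ominus>\<^bsub>L\<rho>\<^esub> A = B"
        using V.diff_add[OF A' B(1) A' V.M.zero_closed]
        unfolding V.diff_zero[OF B(1)] V.diff_self[OF A'] V.M.l_zero[OF B(1)] V.M.r_zero[OF A'] .
      then show ?thesis using V.M.a_closed[OF A' B(1)] B(2) e(2) by metis
    qed
    then show "\<exists>S\<in>L_basis M smul q \<sigma>. (\<lambda>B. A \<oplus>\<^bsub>LM\<^esub> B) ` S \<subseteq> U" using S(1) by auto
  qed
  have "(\<lambda>U. U \<subseteq> carrier L\<rho> \<and> (\<forall>A\<in>U. \<exists>S\<in>L_basis M smul q \<sigma>. (\<lambda>B. A \<oplus>\<^bsub>LM\<^esub> B) ` S \<subseteq> U)) =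
    (\<lambda>U. U \<subseteq> carrier L\<rho> \<and> (\<forall>A\<in>U. \<exists>e>0. \<forall>B\<in>carrier L\<rho>. bar_norm (B \<ominus>\<^bsub>L\<rho>\<^esub> A) < e \<longrightarrow> B \<in> U))"
    by (intro ext conj_cong refl) (rule *)
  then show "L_topology M smul q \<sigma> = V.T" unfolding L_topology_def qn_topology_def sp by simp
qed

end

section \<open>Completeness\<close>

context modular_space
begin

text \<open>Condition (d) concerns monotone sequences. It is applied to the infima over tails, which
  increase to the lower limit \<open>h\<close> (up to the dilation), while the modular of each
  infimum is bounded by that of a single late \<open>g m\<close>.\<close>

lemma rho_div_Fatou:
  obtains F :: real where "1 \<le> F"
    "\<And>g h s t. (\<And>n::nat. g n \<in> borel_measurable M) \<Longrightarrow> h \<in> borel_measurable M \<Longrightarrow>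
      AE x in M. (\<lambda>n. g n x) \<longlonglongrightarrow> h x \<Longrightarrow> 0 < t \<Longrightarrow>
      (\<exists>K. \<forall>n\<ge>K. rho_div t (g n) \<le> ennreal s) \<Longrightarrow> rho_div t h \<le> ennreal F * ennreal s"
proof -
  obtain F :: real where F: "1 \<le> F" "\<And>f g. (\<And>n. f n \<in> borel_measurable M) \<Longrightarrow> g \<in> borel_measurable M \<Longrightarrow>
    (\<And>n. AE x in M. f n x \<le> f (Suc n) x) \<Longrightarrow> (AE x in M. (\<lambda>n::nat. f n x) \<longlonglongrightarrow> g x) \<Longrightarrow>
    \<rho> g \<le> ennreal F * lim (\<lambda>n. \<rho> (f n))"
    by (rule rho_Fatou) blast
  have "rho_div t h \<le> ennreal F * ennreal s"
    if g [measurable]: "\<And>n::nat. g n \<in> borel_measurable M" and h [measurable]: "h \<in> borel_measurable M"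
      and lim: "AE x in M. (\<lambda>n. g n x) \<longlonglongrightarrow> h x" and t: "0 < t"
      and s: "\<exists>K. \<forall>n\<ge>K. rho_div t (g n) \<le> ennreal s" for g h s t
  proof -
    obtain K where K: "\<And>n. n \<ge> K \<Longrightarrow> rho_div t (g n) \<le> ennreal s" using s by blast
    define f where "f n x = ennreal (1 / t) * (INF m\<in>{n..}. g m x)" for n x
    have fm: "f n \<in> borel_measurable M" for n unfolding f_def by measurable
    have mono: "f m x \<le> f n x" if "m \<le> n" for m n x
      unfolding f_def using that by (intro mult_left_mono INF_superset_mono) auto
    have "AE x in M. (\<lambda>n. f n x) \<longlonglongrightarrow> ennreal (1 / t) * h x"
      using lim
    proof eventually_elim
      case (elim x)
      have "(\<lambda>n. INF m\<in>{n..}. g m x) \<longlonglongrightarrow> (SUP n. INF m\<in>{n..}. g m x)"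
        by (intro LIMSEQ_SUP incseq_SucI INF_superset_mono) auto
      also have "(SUP n. INF m\<in>{n..}. g m x) = h x"
        using lim_imp_Liminf[OF _ elim] by (simp add: liminf_SUP_INF)
      finally show ?case unfolding f_def by (intro ennreal_tendsto_cmult) auto
    qed
    then have "rho_div t h \<le> ennreal F * lim (\<lambda>n. \<rho> (f n))"
      unfolding rho_div_def using mono by (intro F(2) fm) auto
    moreover have inc: "\<rho> (f m) \<le> \<rho> (f n)" if "m \<le> n" for m n
      using mono[OF that] by (intro gauge_on_mono[OF gauge] fm) auto
    have "lim (\<lambda>n. \<rho> (f n)) = (SUP n. \<rho> (f n))"
      by (intro limI LIMSEQ_SUP incseq_SucI inc) auto
    moreover have "(SUP n. \<rho> (f n)) \<le> ennreal s"
    proof (rule SUP_least)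
      fix n
      have "\<rho> (f n) \<le> \<rho> (f (max n K))" by (rule inc) simp
      also have "\<dots> \<le> rho_div t (g (max n K))"
        unfolding rho_div_def f_def
        by (intro gauge_on_mono[OF gauge] AE_I2 mult_left_mono INF_lower) auto
      also have "\<dots> \<le> ennreal s" by (rule K) simp
      finally show "\<rho> (f n) \<le> ennreal s" .
    qed
    ultimately show ?thesis by (metis mult_left_mono order_trans zero_le)
  qed
  with F(1) show thesis by (rule that)
qed

text \<open>Telescoping under a quasi-norm costs a factor \<open>kappa\<close> at each step, so the
  jumps must decay faster than the powers of \<open>1 / kappa\<close>.\<close>

lemma geometric_Cauchy:
  fixes z :: "nat \<Rightarrow> 'b"
  assumes z: "\<And>k. K \<le> k \<Longrightarrow> q (z k - z (Suc k)) \<le> (1 / (2 * kappa)) ^ k"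
  shows "\<exists>l. (\<lambda>k. q (z k - l)) \<longlonglongrightarrow> 0"
proof (rule convergent_q)
  define c where "c = 1 / (2 * kappa)"
  have c: "0 < c" "c < 1" "kappa * c = 1 / 2" using kappa(1) by (auto simp: c_def)
  \<comment> \<open>Since \<open>kappa * c = 1 / 2\<close>, the bound
    \<open>b k = 2 * kappa * c ^ k\<close> satisfies
    \<open>b k = kappa * (c ^ k + b (Suc k))\<close>, which is the recursion of the
    induction.\<close>
  have step: "q (z k - z (k + j)) \<le> 2 * kappa * c ^ k" if "K \<le> k" for k j
    using that
  proof (induction j arbitrary: k)
    case 0
    then show ?case using c kappa(1) by simp
  next
    case (Suc j)
    have "q (z k - z (k + Suc j)) \<le> kappa * (q (z k - z (Suc k)) + q (z (Suc k) - z (Suc k + j)))"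
      using q_triangle[of "z k" "z (k + Suc j)" "z (Suc k)"] by simp
    also have "\<dots> \<le> kappa * (c ^ k + 2 * kappa * c ^ Suc k)"
      using Suc.IH[of "Suc k"] Suc.prems z[of k] kappa(1) by (intro mult_left_mono add_mono) (auto simp: c_def)
    also have "\<dots> = kappa * c ^ k + 2 * (kappa * c) * kappa * c ^ k" by (simp add: algebra_simps)
    also have "\<dots> = 2 * kappa * c ^ k" using c(3) by simp
    finally show ?case .
  qed
  fix e :: real assume e: "0 < e"
  have "(\<lambda>k. 2 * kappa * c ^ k) \<longlonglongrightarrow> 2 * kappa * 0"
    using c by (intro tendsto_mult_left LIMSEQ_power_zero) auto
  then have "\<exists>k0. \<forall>k\<ge>k0. norm (2 * kappa * c ^ k - 0) < e"
    using e by (intro LIMSEQ_D) auto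
  then obtain k0 where k0: "\<And>k. k \<ge> k0 \<Longrightarrow> 2 * kappa * c ^ k < e" by fastforce
  have "q (z m - z n) < e" if mn: "m \<ge> max k0 K" "n \<ge> max k0 K" "m \<le> n" for m n
    using step[of m "n - m"] k0[of m] mn by simp
  then have "q (z m - z n) < e" if mn: "m \<ge> max k0 K" "n \<ge> max k0 K" for m n
    using mn q_commute[of "z m" "z n"] by (metis nat_le_linear)
  then show "\<exists>N. \<forall>m\<ge>N. \<forall>n\<ge>N. q (z m - z n) < e" by blast
qed

lemma measurable_q_ennreal [measurable]: "sep_measurable M f \<Longrightarrow> (\<lambda>x. ennreal (q (f x))) \<in> borel_measurable M"
  unfolding sep_measurable_def by (intro measurable_compose[OF measurable_q measurable_ennreal]) auto

lemma sep_measurable_measurable_q: "sep_measurable M f \<Longrightarrow> (\<lambda>x. q (f x)) \<in> borel_measurable M"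
  unfolding sep_measurable_def by (intro measurable_q) auto

text \<open>The \<open>k\<close>-th jump is controlled on \<open>E k\<close> only, with tolerance
  \<open>(1 / (2 * kappa)) ^ k\<close>, as \<open>geometric_Cauchy\<close> needs, and exceptional
  measure \<open>(1 / 2) ^ k\<close>, which is summable. As the \<open>E k\<close> increase to the
  whole space, each point lies in all but finitely many of them.\<close>

lemma AE_convergent_subsequence:
  assumes f: "\<And>n::nat. sep_measurable M (f n)"
    and Cauchy: "\<And>e. 0 < e \<Longrightarrow> \<exists>K. \<forall>m\<ge>K. \<forall>n\<ge>K. rho_div e (\<lambda>x. ennreal (q (f m x - f n x))) < ennreal e"
  obtains \<nu> g where "\<And>k. k \<le> \<nu> k" "sep_measurable M g" "AE x in M. (\<lambda>k. q (f (\<nu> k) x - g x)) \<longlonglongrightarrow> 0"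
proof -
  obtain E :: "nat \<Rightarrow> 'a set" where E: "range E \<subseteq> sets M" "(\<Union>i. E i) = space M" "\<And>i. emeasure M (E i) \<noteq> \<infinity>" "incseq E"
    using sigma_finite_incseq by blast
  have Em [measurable]: "E k \<in> sets M" for k using E(1) by auto
  define c where "c k = (1 / (2 * kappa)) ^ k" for k
  have c: "0 < c k" for k using kappa(1) by (simp add: c_def)
  have fd: "sep_measurable M (\<lambda>x. f m x - f n x)" for m n using f by (intro sep_measurable_diff)
  note fdm [measurable] = sep_measurable_measurable_q[OF fd]
  define B where "B k m n = {x \<in> space M. x \<in> E k \<and> c k < q (f m x - f n x)}" for k m n
  have B: "B k m n \<in> sets M" for k m n unfolding B_def by measurable
  have "\<exists>K. \<forall>m\<ge>K. \<forall>n\<ge>K. emeasure M (B k m n) \<le> ennreal ((1 / 2) ^ k)" for k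
  proof -
    have "emeasure M (E k) < \<infinity>" using E(3) by (simp add: less_top)
    then obtain t where t: "0 < t" "\<And>h. h \<in> borel_measurable M \<Longrightarrow> rho_div t h < ennreal t \<Longrightarrow>
        emeasure M {x \<in> space M. x \<in> E k \<and> ennreal (c k) < h x} \<le> ennreal ((1 / 2) ^ k)"
      by (rule rho_div_small_measure[OF Em _ c[of k], of k "(1 / 2) ^ k"]) auto
    obtain K where K: "\<And>m n. m \<ge> K \<Longrightarrow> n \<ge> K \<Longrightarrow> rho_div t (\<lambda>x. ennreal (q (f m x - f n x))) < ennreal t"
      using Cauchy[OF t(1)] by blast
    have eq: "B k m n = {x \<in> space M. x \<in> E k \<and> ennreal (c k) < ennreal (q (f m x - f n x))}" for m n
      unfolding B_def using c[of k] by (auto simp: ennreal_less_iff)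
    show ?thesis
      by (intro exI[of _ K] allI impI) (unfold eq, rule t(2)[OF measurable_q_ennreal[OF fd] K])
  qed
  then obtain K where K: "\<And>k m n. m \<ge> K k \<Longrightarrow> n \<ge> K k \<Longrightarrow> emeasure M (B k m n) \<le> ennreal ((1 / 2) ^ k)"
    by metis
  \<comment> \<open>The sum puts both \<open>\<nu> k\<close> and \<open>\<nu> (Suc k)\<close> beyond
    \<open>K k\<close>; the summand \<open>k\<close> ensures \<open>k \<le> \<nu> k\<close>.\<close>
  define \<nu> where "\<nu> k = k + (\<Sum>i\<le>k. K i)" for k
  have \<nu>: "k \<le> \<nu> k" "K k \<le> \<nu> k" "K k \<le> \<nu> (Suc k)" for k
  proof -
    have "K k \<le> (\<Sum>i\<le>k. K i)" by (rule member_le_sum) auto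
    then show "k \<le> \<nu> k" "K k \<le> \<nu> k" "K k \<le> \<nu> (Suc k)" by (simp_all add: \<nu>_def)
  qed
  define A where "A k = B k (\<nu> k) (\<nu> (Suc k))" for k
  have A: "A k \<in> sets M" "emeasure M (A k) \<le> ennreal ((1 / 2) ^ k)" for k
    unfolding A_def using B K[OF \<nu>(2,3)] by auto
  have "AE x in M. eventually (\<lambda>k. x \<in> space M - A k) sequentially"
  proof (rule borel_cantelli_AE1[OF A(1)])
    show "emeasure M (A k) < \<infinity>" for k using A(2)[of k] by (auto intro: le_less_trans)
    have le: "measure M (A k) \<le> (1 / 2) ^ k" for k
      unfolding measure_def by (rule enn2real_leI[OF _ A(2)]) simp
    show "summable (\<lambda>k. measure M (A k))"
    proof (rule summable_comparison_test)
      show "\<exists>K. \<forall>k\<ge>K. norm (measure M (A k)) \<le> (1 / 2) ^ k" using le by simp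
      show "summable (\<lambda>k. (1 / 2 :: real) ^ k)" by (rule summable_geometric) simp
    qed
  qed
  \<comment> \<open>A measurable condition that forces convergence. Setting the functions to 0 where
    it fails gives convergence at every point, as \<open>sep_measurable_lim\<close>
    requires.\<close>
  define P where "P x \<longleftrightarrow> (\<exists>K. \<forall>k\<ge>K. q (f (\<nu> k) x - f (\<nu> (Suc k)) x) \<le> c k)" for x
  have AEP: "AE x in M. P x"
    using \<open>AE x in M. eventually (\<lambda>k. x \<in> space M - A k) sequentially\<close> AE_space
  proof eventually_elim
    case (elim x)
    then obtain i where "x \<in> E i" using E(2) by blast
    moreover obtain k0 where "\<And>k. k \<ge> k0 \<Longrightarrow> x \<notin> A k"
      using elim(1) unfolding eventually_sequentially by blast
    ultimately have "q (f (\<nu> k) x - f (\<nu> (Suc k)) x) \<le> c k" if "k \<ge> max i k0" for k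
      using that incseqD[OF E(4), of i k] elim(2) by (fastforce simp: A_def B_def)
    then show ?case unfolding P_def by blast
  qed
  have Pm: "{x \<in> space M. P x} \<in> sets M" unfolding P_def by measurable
  have lim: "\<exists>l. (\<lambda>k. q ((if P x then f (\<nu> k) x else 0) - l)) \<longlonglongrightarrow> 0" for x
  proof (cases "P x")
    case True
    then show ?thesis
      unfolding P_def c_def using geometric_Cauchy[of _ "\<lambda>k. f (\<nu> k) x"] True by auto
  next
    case False
    then show ?thesis by (auto intro!: exI[of _ 0])
  qed
  then obtain g where g: "\<And>x. (\<lambda>k. q ((if P x then f (\<nu> k) x else 0) - g x)) \<longlonglongrightarrow> 0" by metis
  show thesis
  proof
    show "k \<le> \<nu> k" for k by fact
    show "sep_measurable M g" by (rule sep_measurable_lim[OF sep_measurable_if[OF f Pm] g])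
    show "AE x in M. (\<lambda>k. q (f (\<nu> k) x - g x)) \<longlonglongrightarrow> 0"
      using AEP
    proof eventually_elim
      case (elim x)
      then show ?case using g[of x] by simp
    qed
  qed
qed

lemma minus_L\<rho>:
  assumes "A \<in> carrier L\<rho>" "B \<in> carrier L\<rho>"
  shows "A \<ominus>\<^bsub>L\<rho>\<^esub> B = A \<ominus>\<^bsub>LM\<^esub> B"
proof -
  have B: "B \<in> carrier LM" using assms by (simp add: carrier_L\<rho>)
  show ?thesis unfolding V.M.minus_eq LM.M.minus_eq V.uminus_smul[OF assms(2)] uminus_LM[OF B] by simp
qed

lemma rho_div_cls: "sep_measurable M f \<Longrightarrow> rho_div t (N (cls M f)) = rho_div t (\<lambda>x. ennreal (q (f x)))"
  by (rule rho_div_cong[OF pt_norm_cls(2) measurable_q_ennreal pt_norm_cls(1)])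

theorem complete_L\<rho>: "complete_tvs L\<rho> V.T"
proof (rule V.complete_tvs_T)
  fix y :: "nat \<Rightarrow> ('a \<Rightarrow> 'b) set"
  assume y: "range y \<subseteq> carrier L\<rho>"
    and C: "\<And>e. 0 < e \<Longrightarrow> \<exists>K. \<forall>m\<ge>K. \<forall>n\<ge>K. bar_norm (y m \<ominus>\<^bsub>L\<rho>\<^esub> y n) < e"
  have yC: "y n \<in> carrier L\<rho>" for n using y by blast
  have yLM: "y n \<in> carrier LM" for n using yC[of n] by (simp add: carrier_L\<rho>)
  have "\<exists>f. sep_measurable M f \<and> y n = cls M f" for n using carrier_cls[OF yLM] by metis
  then obtain f where f: "\<And>n. sep_measurable M (f n)" "\<And>n. y n = cls M (f n)" by metis
  have diff: "y m \<ominus>\<^bsub>L\<rho>\<^esub> y n = cls M (\<lambda>x. f m x - f n x)" for m n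
    using minus_L\<rho>[OF yC yC, of m n] diff_cls[OF f(1) f(1), of m n] f(2) by metis
  have Cauchy: "\<exists>K. \<forall>m\<ge>K. \<forall>n\<ge>K. rho_div e (\<lambda>x. ennreal (q (f m x - f n x))) < ennreal e" if e: "0 < e" for e
  proof -
    obtain K where K: "\<And>m n. m \<ge> K \<Longrightarrow> n \<ge> K \<Longrightarrow> bar_norm (y m \<ominus>\<^bsub>L\<rho>\<^esub> y n) < e" using C[OF e] by blast
    have "rho_div e (\<lambda>x. ennreal (q (f m x - f n x))) < ennreal e" if "m \<ge> K" "n \<ge> K" for m n
      using bar_norm_lessD[OF V.minus_closed'[OF yC yC] e K[OF that]]
      unfolding diff rho_div_cls[OF sep_measurable_diff[OF f(1) f(1)]] .
    then show ?thesis by blast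
  qed
  obtain \<nu> g where \<nu>: "\<And>k. k \<le> \<nu> k" and g: "sep_measurable M g" and lim: "AE x in M. (\<lambda>k. q (f (\<nu> k) x - g x)) \<longlonglongrightarrow> 0"
    by (rule AE_convergent_subsequence[OF f(1) Cauchy]) (assumption, rule that, assumption+)
  obtain F :: real where F: "1 \<le> F"
    "\<And>g h s t. (\<And>n::nat. g n \<in> borel_measurable M) \<Longrightarrow> h \<in> borel_measurable M \<Longrightarrow>
      AE x in M. (\<lambda>n. g n x) \<longlonglongrightarrow> h x \<Longrightarrow> 0 < t \<Longrightarrow>
      (\<exists>K. \<forall>n\<ge>K. rho_div t (g n) \<le> ennreal s) \<Longrightarrow> rho_div t h \<le> ennreal F * ennreal s"
    by (rule rho_div_Fatou) blast
  have close: "\<exists>K. \<forall>n\<ge>K. rho_div (3 * e / 4) (N (cls M (\<lambda>x. f n x - g x))) < ennreal (3 * e / 4)" if e: "0 < e" for e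
  proof -
    \<comment> \<open>The Fatou estimate multiplies the bound by \<open>F\<close> and yields a weak
      inequality. With \<open>F * t = e / 2\<close> the result is strictly below
      \<open>3 * e / 4\<close>, itself a competitor strictly below \<open>e\<close>.\<close>
    define t where "t = e / (2 * F)"
    have t: "0 < t" "t \<le> 3 * e / 4" "F * t = e / 2" using F(1) e by (auto simp: t_def field_simps)
    obtain K where K: "\<And>m n. m \<ge> K \<Longrightarrow> n \<ge> K \<Longrightarrow> rho_div t (\<lambda>x. ennreal (q (f m x - f n x))) < ennreal t"
      using Cauchy[OF t(1)] by blast
    have "rho_div (3 * e / 4) (N (cls M (\<lambda>x. f n x - g x))) < ennreal (3 * e / 4)" if n: "n \<ge> K" for n
    proof -
      have ng: "sep_measurable M (\<lambda>x. f n x - g x)" by (rule sep_measurable_diff[OF f(1) g])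
      have "rho_div (3 * e / 4) (N (cls M (\<lambda>x. f n x - g x))) \<le> rho_div t (\<lambda>x. ennreal (q (f n x - g x)))"
        unfolding rho_div_cls[OF ng] by (rule rho_div_antimono[OF measurable_q_ennreal[OF ng] t(1,2)])
      also have "\<dots> \<le> ennreal F * ennreal t"
      proof (rule F(2))
        show "(\<lambda>x. ennreal (q (f n x - f (\<nu> k) x))) \<in> borel_measurable M" for k
          by (rule measurable_q_ennreal[OF sep_measurable_diff[OF f(1) f(1)]])
        show "AE x in M. (\<lambda>k. ennreal (q (f n x - f (\<nu> k) x))) \<longlonglongrightarrow> ennreal (q (f n x - g x))"
          using lim by eventually_elim (intro tendsto_ennrealI q_continuous_seq)
        show "\<exists>K. \<forall>k\<ge>K. rho_div t (\<lambda>x. ennreal (q (f n x - f (\<nu> k) x))) \<le> ennreal t"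
          using K[OF n] \<nu> by (meson less_imp_le order_trans)
      qed (use t measurable_q_ennreal[OF ng] in auto)
      also have "\<dots> = ennreal (e / 2)" using F(1) t by (simp flip: ennreal_mult)
      also have "\<dots> < ennreal (3 * e / 4)" using e by (intro ennreal_lessI) auto
      finally show ?thesis .
    qed
    then show ?thesis by blast
  qed
  have dC: "cls M (\<lambda>x. f n x - g x) \<in> carrier LM" for n by (intro cls_carrier sep_measurable_diff f(1) g)
  \<comment> \<open>The limit is \<open>y n\<close> minus the class of \<open>f n - g\<close>, and
    both are already known to lie in \<open>L\<rho>\<close>.\<close>
  have "cls M g \<in> carrier L\<rho>"
  proof -
    obtain n where n: "rho_div (3 / 4) (N (cls M (\<lambda>x. f n x - g x))) < ennreal (3 / 4)" using close[of 1] by auto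
    have d: "cls M (\<lambda>x. f n x - g x) \<in> carrier L\<rho>" by (rule carrier_L\<rho>_I[OF dC _ n]) simp
    have "y n \<ominus>\<^bsub>L\<rho>\<^esub> cls M (\<lambda>x. f n x - g x) = cls M (\<lambda>x. f n x - (f n x - g x))"
      using minus_L\<rho>[OF yC d, of n] diff_cls[OF f(1) sep_measurable_diff[OF f(1) g], of n n] f(2) by metis
    then show ?thesis using V.minus_closed'[OF yC d, of n] by simp
  qed
  moreover have "\<exists>K. \<forall>n\<ge>K. bar_norm (y n \<ominus>\<^bsub>L\<rho>\<^esub> cls M g) < e" if e: "0 < e" for e
  proof -
    have "y n \<ominus>\<^bsub>L\<rho>\<^esub> cls M g = cls M (\<lambda>x. f n x - g x)" for n
      using minus_L\<rho>[OF yC \<open>cls M g \<in> carrier L\<rho>\<close>, of n] diff_cls[OF f(1) g, of n] f(2) by metis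
    moreover obtain K where K: "\<And>n. n \<ge> K \<Longrightarrow> rho_div (3 * e / 4) (N (cls M (\<lambda>x. f n x - g x))) < ennreal (3 * e / 4)"
      using close[OF e] by blast
    have "bar_norm (cls M (\<lambda>x. f n x - g x)) < e" if "n \<ge> K" for n
      by (rule bar_norm_lessI[OF dC _ _ K[OF that]]) (use e in auto)
    ultimately show ?thesis by auto
  qed
  ultimately show "\<exists>l\<in>carrier L\<rho>. \<forall>e>0. \<exists>K. \<forall>n\<ge>K. bar_norm (y n \<ominus>\<^bsub>L\<rho>\<^esub> l) < e" by blast
qed

end

section \<open>The associated gauges and pseudo-homogeneity\<close>

context modular_space
begin

text \<open>The ball of radius \<open>min u \<epsilon>\<close> respects both the dilation
  \<open>u\<close> and the bound \<open>\<epsilon>\<close>; conversely, dilation and bound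
  \<open>e / 2\<close> give a set inside the \<open>e\<close>-ball.\<close>

lemma basis_rho:
  shows "S \<in> L_basis M smul q \<rho> \<Longrightarrow> S \<subseteq> carrier L\<rho> \<and> (\<exists>e>0. {A \<in> carrier L\<rho>. bar_norm A < e} \<subseteq> S)"
    and "0 < e \<Longrightarrow> \<exists>S\<in>L_basis M smul q \<rho>. S \<subseteq> {A \<in> carrier L\<rho>. bar_norm A < e}"
proof -
  assume "S \<in> L_basis M smul q \<rho>"
  then obtain u \<epsilon> where u: "0 < u" "0 < \<epsilon>" and S: "S = {A \<in> carrier LM. rho_div u (N A) < ennreal \<epsilon>}"
    unfolding L_basis_iff[OF gauge] rho_div_def by blast
  have "S \<subseteq> carrier L\<rho>" using u carrier_L\<rho>_I by (auto simp: S)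
  moreover have "rho_div u (N A) < ennreal \<epsilon>" if A: "A \<in> carrier L\<rho>" "bar_norm A < min u \<epsilon>" for A
  proof -
    have "rho_div u (N A) \<le> rho_div (min u \<epsilon>) (N A)"
      using A(1) u by (intro rho_div_antimono) (auto simp: carrier_L\<rho>)
    also have "\<dots> < ennreal (min u \<epsilon>)" using u A by (intro bar_norm_lessD) auto
    also have "\<dots> \<le> ennreal \<epsilon>" by (intro ennreal_leI) simp
    finally show ?thesis .
  qed
  ultimately show "S \<subseteq> carrier L\<rho> \<and> (\<exists>e>0. {A \<in> carrier L\<rho>. bar_norm A < e} \<subseteq> S)"
    using u by (intro conjI exI[of _ "min u \<epsilon>"]) (auto simp: S carrier_L\<rho>)
next
  assume e: "0 < e"
  have "{A \<in> carrier LM. rho_div (e / 2) (N A) < ennreal (e / 2)} \<in> L_basis M smul q \<rho>"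
    unfolding L_basis_iff[OF gauge] rho_div_def using e half_gt_zero by blast
  moreover have "{A \<in> carrier LM. rho_div (e / 2) (N A) < ennreal (e / 2)} \<subseteq> {A \<in> carrier L\<rho>. bar_norm A < e}"
    using e carrier_L\<rho>_I[of _ "e / 2" "e / 2"] bar_norm_lessI[of _ "e / 2" e] by auto
  ultimately show "\<exists>S\<in>L_basis M smul q \<rho>. S \<subseteq> {A \<in> carrier L\<rho>. bar_norm A < e}" by blast
qed

lemma L_topology_rho: "L_topology M smul q \<rho> = V.T" "nbhd_basis_at V.T \<zero>\<^bsub>L\<rho>\<^esub> (L_basis M smul q \<rho>)"
  using L_topology_eqI[OF refl basis_rho] by blast+

text \<open>Prepared for both associated gauges with the competitor
  \<open>t = \<epsilon> / 2\<close>: one entry of the minimum handles the dilation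
  \<open>u * t\<close>, and the bounds \<open>\<epsilon> / 2\<close> and 1 are those that
  \<open>gauge_bar\<close> and \<open>gauge_tilde\<close> ask for.\<close>

lemma bar_norm_less_scaled:
  assumes "A \<in> carrier L\<rho>" "0 < u" "0 < \<epsilon>" "bar_norm A < min (u * (\<epsilon> / 2)) (min (\<epsilon> / 2) 1)"
  shows "rho_div (u * (\<epsilon> / 2)) (N A) < ennreal (min (\<epsilon> / 2) 1)"
proof -
  let ?e = "min (u * (\<epsilon> / 2)) (min (\<epsilon> / 2) 1)"
  have e: "0 < ?e" using assms by auto
  have "rho_div (u * (\<epsilon> / 2)) (N A) \<le> rho_div ?e (N A)"
    using assms(1) e by (intro rho_div_antimono) (auto simp: carrier_L\<rho>)
  also have "\<dots> < ennreal ?e" using assms e by (intro bar_norm_lessD)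
  also have "\<dots> \<le> ennreal (min (\<epsilon> / 2) 1)" by (intro ennreal_leI min.cobounded2)
  finally show ?thesis .
qed

section \<open>The space and topology of \<open>gauge_bar\<close>\<close>

lemma carrier_bar: "carrier (L_space M smul q (gauge_bar \<rho>)) = carrier L\<rho>"
proof (intro equalityI subsetI)
  fix A assume "A \<in> carrier (L_space M smul q (gauge_bar \<rho>))"
  then obtain u where A: "A \<in> carrier LM" and u: "0 < u" "gauge_bar \<rho> (\<lambda>x. ennreal (1 / u) * N A x) < \<infinity>"
    unfolding carrier_L_space by blast
  then obtain t where t: "0 < t" "rho_div t (\<lambda>x. ennreal (1 / u) * N A x) < ennreal t"
    unfolding gauge_bar_finite rho_div_def by blast
  then show "A \<in> carrier L\<rho>" using A u(1) by (intro carrier_L\<rho>_I[of _ "u * t" t]) (auto simp: rho_div_scale)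
next
  fix A assume A: "A \<in> carrier L\<rho>"
  then have "gauge_bar \<rho> (\<lambda>x. ennreal (1 / 1) * N A x) < \<infinity>" using gauge_bar_N_finite by simp
  then show "A \<in> carrier (L_space M smul q (gauge_bar \<rho>))"
    unfolding carrier_L_space using A zero_less_one carrier_L\<rho> by blast
qed

lemma basis_bar:
  shows "S \<in> L_basis M smul q (gauge_bar \<rho>) \<Longrightarrow> S \<subseteq> carrier L\<rho> \<and> (\<exists>e>0. {A \<in> carrier L\<rho>. bar_norm A < e} \<subseteq> S)"
    and "0 < e \<Longrightarrow> \<exists>S\<in>L_basis M smul q (gauge_bar \<rho>). S \<subseteq> {A \<in> carrier L\<rho>. bar_norm A < e}"
proof -
  note iff = L_basis_iff[OF gauge_on_bar[OF gauge]]
  assume "S \<in> L_basis M smul q (gauge_bar \<rho>)"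
  then obtain u \<epsilon> where u: "0 < u" "0 < \<epsilon>"
    and S: "S = {A \<in> carrier LM. gauge_bar \<rho> (\<lambda>x. ennreal (1 / u) * N A x) < ennreal \<epsilon>}"
    unfolding iff by blast
  have S': "S = {A \<in> carrier LM. \<exists>t>0. t < \<epsilon> \<and> rho_div (u * t) (N A) < ennreal t}"
    unfolding S gauge_bar_less[OF u(2)] rho_div_def[symmetric] using u(1) by (auto simp: rho_div_scale)
  have "S \<subseteq> carrier L\<rho>"
  proof
    fix A assume "A \<in> S"
    then obtain t where "A \<in> carrier LM" "0 < t" "rho_div (u * t) (N A) < ennreal t" unfolding S' by blast
    then show "A \<in> carrier L\<rho>" using u(1) by (intro carrier_L\<rho>_I[of _ "u * t" t]) auto
  qed
  moreover have "{A \<in> carrier L\<rho>. bar_norm A < min (u * (\<epsilon> / 2)) (min (\<epsilon> / 2) 1)} \<subseteq> S"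
  proof
    fix A assume "A \<in> {A \<in> carrier L\<rho>. bar_norm A < min (u * (\<epsilon> / 2)) (min (\<epsilon> / 2) 1)}"
    then have A: "A \<in> carrier L\<rho>" "bar_norm A < min (u * (\<epsilon> / 2)) (min (\<epsilon> / 2) 1)" by auto
    have "rho_div (u * (\<epsilon> / 2)) (N A) < ennreal (min (\<epsilon> / 2) 1)" by (rule bar_norm_less_scaled[OF A(1) u A(2)])
    also have "\<dots> \<le> ennreal (\<epsilon> / 2)" by (intro ennreal_leI) simp
    finally show "A \<in> S" unfolding S' using A(1) u by (auto simp: carrier_L\<rho> intro!: exI[of _ "\<epsilon> / 2"])
  qed
  ultimately show "S \<subseteq> carrier L\<rho> \<and> (\<exists>e>0. {A \<in> carrier L\<rho>. bar_norm A < e} \<subseteq> S)"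
    using u by (intro conjI exI[of _ "min (u * (\<epsilon> / 2)) (min (\<epsilon> / 2) 1)"]) auto
next
  note iff = L_basis_iff[OF gauge_on_bar[OF gauge]]
  assume e: "0 < e"
  have "{A \<in> carrier LM. gauge_bar \<rho> (\<lambda>x. ennreal (1 / 1) * N A x) < ennreal e} \<in> L_basis M smul q (gauge_bar \<rho>)"
    unfolding iff using e zero_less_one by blast
  moreover have "{A \<in> carrier LM. gauge_bar \<rho> (\<lambda>x. ennreal (1 / 1) * N A x) < ennreal e} \<subseteq> {A \<in> carrier L\<rho>. bar_norm A < e}"
  proof
    fix A assume "A \<in> {A \<in> carrier LM. gauge_bar \<rho> (\<lambda>x. ennreal (1 / 1) * N A x) < ennreal e}"
    then have A: "A \<in> carrier LM" "gauge_bar \<rho> (N A) < ennreal e" by auto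
    then obtain t where "0 < t" "t < e" "rho_div t (N A) < ennreal t" unfolding gauge_bar_less[OF e] rho_div_def by blast
    then show "A \<in> {A \<in> carrier L\<rho>. bar_norm A < e}" using A(1) carrier_L\<rho>_I bar_norm_lessI by blast
  qed
  ultimately show "\<exists>S\<in>L_basis M smul q (gauge_bar \<rho>). S \<subseteq> {A \<in> carrier L\<rho>. bar_norm A < e}" by blast
qed

lemma L_topology_bar:
  "L_space M smul q (gauge_bar \<rho>) = L\<rho>" "L_topology M smul q (gauge_bar \<rho>) = V.T"
  "nbhd_basis_at V.T \<zero>\<^bsub>L\<rho>\<^esub> (L_basis M smul q (gauge_bar \<rho>))"
  using L_topology_eqI[OF carrier_bar basis_bar] by blast+

text \<open>Undoing a dilation costs a constant factor, uniformly in \<open>h\<close>. So the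
  parameter \<open>u\<close> of a neighbourhood can be traded for a change of
  \<open>\<epsilon>\<close>.\<close>

lemma pseudo_homogeneous_infinityD:
  assumes "pseudo_homogeneous_infinity M \<rho>" "0 < u"
  obtains C where "0 < C" "\<And>h. h \<in> borel_measurable M \<Longrightarrow> \<rho> h \<le> ennreal C * rho_div u h"
proof -
  have "u \<in> dilation_domain M \<rho>" using assms unfolding pseudo_homogeneous_infinity_def by auto
  then obtain C where C: "0 < C" "\<And>f. f \<in> borel_measurable M \<Longrightarrow> \<rho> (\<lambda>x. ennreal u * f x) \<le> ennreal C * \<rho> f"
    unfolding dilation_domain_def dilation_bounds_def by auto
  have "\<rho> h \<le> ennreal C * rho_div u h" if "h \<in> borel_measurable M" for h
    using C(2)[of "\<lambda>x. ennreal (1 / u) * h x"] that assms(2)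
    unfolding rho_div_def by (simp add: mult.assoc[symmetric] ennreal_mult[symmetric])
  with C(1) show thesis by (rule that)
qed

lemma rho_div_1: "rho_div 1 h = \<rho> h" by (simp add: rho_div_def)

lemma carrier_infinity:
  assumes "pseudo_homogeneous_infinity M \<rho>"
  shows "carrier L\<rho> = {A \<in> carrier LM. \<rho> (N A) < \<infinity>}"
proof (intro equalityI subsetI)
  fix A assume "A \<in> carrier L\<rho>"
  then obtain t where A: "A \<in> carrier LM" and t: "0 < t" "rho_div t (N A) < \<infinity>" unfolding carrier_L\<rho> by blast
  obtain C where "0 < C" "\<And>h. h \<in> borel_measurable M \<Longrightarrow> \<rho> h \<le> ennreal C * rho_div t h"
    by (rule pseudo_homogeneous_infinityD[OF assms t(1)]) (rule that)
  then have "\<rho> (N A) \<le> ennreal C * rho_div t (N A)" using A by auto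
  also have "\<dots> < \<infinity>" using t(2) by (simp add: ennreal_mult_less_top)
  finally show "A \<in> {A \<in> carrier LM. \<rho> (N A) < \<infinity>}" using A by simp
next
  fix A assume "A \<in> {A \<in> carrier LM. \<rho> (N A) < \<infinity>}"
  then show "A \<in> carrier L\<rho>" unfolding carrier_L\<rho> using rho_div_1 zero_less_one by (metis (lifting) mem_Collect_eq)
qed

lemma basis_infinity:
  assumes inf: "pseudo_homogeneous_infinity M \<rho>"
  shows "nbhd_basis_at V.T \<zero>\<^bsub>L\<rho>\<^esub> {L_ball M smul q \<rho> \<epsilon> | \<epsilon>. 0 < \<epsilon>}"
proof (rule V.nbhd_basis_refine)
  fix S assume "S \<in> {L_ball M smul q \<rho> \<epsilon> | \<epsilon>. 0 < \<epsilon>}"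
  then obtain \<epsilon> where e: "0 < \<epsilon>" "S = {A \<in> carrier LM. rho_div 1 (N A) < ennreal \<epsilon>}"
    by (auto simp: L_ball_def rho_div_1)
  then have "S \<in> L_basis M smul q \<rho>" unfolding L_basis_iff[OF gauge] rho_div_def using zero_less_one by blast
  then show "S \<subseteq> carrier L\<rho> \<and> (\<exists>e>0. {A \<in> carrier L\<rho>. bar_norm A < e} \<subseteq> S)" by (rule basis_rho)
next
  fix e :: real assume e: "0 < e"
  \<comment> \<open>Dilation by \<open>2 / e\<close> makes the estimate compare
    \<open>\<rho> (h / (e / 2))\<close> with \<open>\<rho> h\<close>; the constant is then absorbed
    in the radius \<open>e / 2 / C\<close>.\<close>
  obtain C where C: "0 < C" "\<And>h. h \<in> borel_measurable M \<Longrightarrow> \<rho> h \<le> ennreal C * rho_div (2 / e) h"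
    using pseudo_homogeneous_infinityD[OF inf, of "2 / e"] e by auto
  have "A \<in> carrier L\<rho> \<and> bar_norm A < e" if A: "A \<in> L_ball M smul q \<rho> (e / 2 / C)" for A
  proof -
    have AL: "A \<in> carrier LM" and lt: "\<rho> (N A) < ennreal (e / 2 / C)" using A by (auto simp: L_ball_def)
    have "rho_div (e / 2) (N A) \<le> ennreal C * rho_div (2 / e) (\<lambda>x. ennreal (1 / (e / 2)) * N A x)"
      unfolding rho_div_def[of "e / 2"] using AL by (intro C(2)) auto
    also have "\<dots> = ennreal C * \<rho> (N A)"
      using e by (subst rho_div_scale) (auto simp: rho_div_1)
    also have "\<dots> < ennreal C * ennreal (e / 2 / C)"
      using lt C(1) by (intro ennreal_mult_strict_left_mono) auto
    also have "\<dots> = ennreal (e / 2)" using C(1) e by (simp flip: ennreal_mult)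
    finally show ?thesis using AL e carrier_L\<rho>_I[of A "e / 2"] bar_norm_lessI[of A "e / 2" e] by auto
  qed
  then show "\<exists>S\<in>{L_ball M smul q \<rho> \<epsilon> | \<epsilon>. 0 < \<epsilon>}. S \<subseteq> {A \<in> carrier L\<rho>. bar_norm A < e}"
    using e C(1) by (intro bexI[of _ "L_ball M smul q \<rho> (e / 2 / C)"]) auto
qed

text \<open>A real \<open>Inf\<close> says nothing about an empty set. For \<open>t \<le> 1\<close>
  the set contains 1, which allows a bound \<open>C\<close> to be extracted from a small
  \<open>dilation_const\<close>.\<close>

lemma dilation_bounds_1: "0 < t \<Longrightarrow> t \<le> 1 \<Longrightarrow> 1 \<in> dilation_bounds M \<rho> t"
  unfolding dilation_bounds_def using gauge_on_scale_mono[OF gauge, of _ _ t 1] by auto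

text \<open>In condition (c) the dilation that makes the modular small depends on the function. Here
  one \<open>\<tau>\<close> serves every \<open>h\<close> and \<open>s\<close> with
  \<open>\<rho> (h / s) \<le> 1\<close>.\<close>

lemma pseudo_homogeneous_originD:
  assumes "pseudo_homogeneous_origin M \<rho>" "0 < e"
  obtains \<tau> where "0 < \<tau>" "\<tau> < 1" "\<And>s h. h \<in> borel_measurable M \<Longrightarrow> 0 < s \<Longrightarrow> rho_div s h \<le> 1 \<Longrightarrow> rho_div (s / \<tau>) h < ennreal e"
proof -
  have "eventually (\<lambda>t. dilation_const M \<rho> t < e) (at_right 0)"
    using assms unfolding pseudo_homogeneous_origin_def by (intro order_tendstoD(2)) auto
  then obtain b where b: "0 < b" "\<And>t. 0 < t \<Longrightarrow> t < b \<Longrightarrow> dilation_const M \<rho> t < e"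
    unfolding eventually_at_right_field by blast
  define \<tau> where "\<tau> = min (b / 2) (1 / 2)"
  have \<tau>: "0 < \<tau>" "\<tau> < 1" "\<tau> < b" using b(1) by (auto simp: \<tau>_def)
  have "Inf (dilation_bounds M \<rho> \<tau>) < e" using b(2)[OF \<tau>(1,3)] by (simp add: dilation_const_def)
  then obtain C where C: "C \<in> dilation_bounds M \<rho> \<tau>" "C < e"
    using dilation_bounds_1[of \<tau>] \<tau> cInf_lessD[of "dilation_bounds M \<rho> \<tau>" e] by auto
  have "rho_div (s / \<tau>) h < ennreal e" if h: "h \<in> borel_measurable M" "0 < s" "rho_div s h \<le> 1" for s h
  proof -
    have "rho_div (s / \<tau>) h = \<rho> (\<lambda>x. ennreal \<tau> * (ennreal (1 / s) * h x))"
      unfolding rho_div_def using h(2) \<tau>(1) by (simp add: mult.assoc[symmetric] ennreal_mult[symmetric])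
    also have "\<dots> \<le> ennreal C * rho_div s h"
      using C(1) h(1) unfolding rho_div_def dilation_bounds_def by auto
    also have "\<dots> \<le> ennreal C * 1" using h(3) by (intro mult_left_mono) auto
    also have "\<dots> < ennreal e" using C(2) assms(2) by (simp add: ennreal_lessI)
    finally show ?thesis .
  qed
  with \<tau>(1,2) show thesis by (rule that)
qed

lemma carrier_tilde: "carrier (L_space M smul q (gauge_tilde \<rho>)) = carrier L\<rho>"
  and gauge_tilde_N_finite: "A \<in> carrier L\<rho> \<Longrightarrow> gauge_tilde \<rho> (N A) < \<infinity>"
proof -
  show fin: "gauge_tilde \<rho> (N A) < \<infinity>" if "A \<in> carrier L\<rho>" for A
  proof -
    obtain t where A: "A \<in> carrier LM" and t: "0 < t" "rho_div t (N A) < \<infinity>" 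
      using \<open>A \<in> carrier L\<rho>\<close> unfolding carrier_L\<rho> by blast
    obtain s where s: "0 < s" "rho_div s (N A) < ennreal 1"
      by (rule rho_div_small[OF _ t, of 1]) (use A in auto)
    then show ?thesis unfolding gauge_tilde_finite rho_div_def by (intro exI[of _ s]) auto
  qed
  show "carrier (L_space M smul q (gauge_tilde \<rho>)) = carrier L\<rho>"
  proof (intro equalityI subsetI)
    fix A assume "A \<in> carrier (L_space M smul q (gauge_tilde \<rho>))"
    then obtain u where A: "A \<in> carrier LM" and u: "0 < u" "gauge_tilde \<rho> (\<lambda>x. ennreal (1 / u) * N A x) < \<infinity>"
      unfolding carrier_L_space by blast
    then obtain t where t: "0 < t" "rho_div t (\<lambda>x. ennreal (1 / u) * N A x) < 1"
      unfolding gauge_tilde_finite rho_div_def by blast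
    then show "A \<in> carrier L\<rho>" using A u(1) by (intro carrier_L\<rho>_I[of _ "u * t" 1]) (auto simp: rho_div_scale)
  next
    fix A assume A: "A \<in> carrier L\<rho>"
    then have "gauge_tilde \<rho> (\<lambda>x. ennreal (1 / 1) * N A x) < \<infinity>" using fin by simp
    then show "A \<in> carrier (L_space M smul q (gauge_tilde \<rho>))"
      unfolding carrier_L_space using A zero_less_one carrier_L\<rho> by blast
  qed
qed

text \<open>In the second claim, the bound 1 at dilation \<open>t\<close> improves to the bound
  \<open>e / 2\<close> at dilation \<open>t / \<tau>\<close>. Since \<open>t / \<tau>\<close> has to
  stay below \<open>e / 2\<close>, the radius is \<open>\<tau> * (e / 2)\<close>.\<close>

lemma basis_tilde:
  assumes origin: "pseudo_homogeneous_origin M \<rho>"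
  shows "S \<in> L_basis M smul q (gauge_tilde \<rho>) \<Longrightarrow> S \<subseteq> carrier L\<rho> \<and> (\<exists>e>0. {A \<in> carrier L\<rho>. bar_norm A < e} \<subseteq> S)"
    and "0 < e \<Longrightarrow> \<exists>\<epsilon>>0. {A \<in> carrier LM. gauge_tilde \<rho> (N A) < ennreal \<epsilon>} \<subseteq> {A \<in> carrier L\<rho>. bar_norm A < e}"
proof -
  note iff = L_basis_iff[OF gauge_on_tilde[OF gauge]]
  assume "S \<in> L_basis M smul q (gauge_tilde \<rho>)"
  then obtain u \<epsilon> where u: "0 < u" "0 < \<epsilon>"
    and S: "S = {A \<in> carrier LM. gauge_tilde \<rho> (\<lambda>x. ennreal (1 / u) * N A x) < ennreal \<epsilon>}"
    unfolding iff by blast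
  have S': "S = {A \<in> carrier LM. \<exists>t>0. t < \<epsilon> \<and> rho_div (u * t) (N A) < 1}"
    unfolding S gauge_tilde_less[OF u(2)] rho_div_def[symmetric] using u(1) by (auto simp: rho_div_scale)
  have "S \<subseteq> carrier L\<rho>"
  proof
    fix A assume "A \<in> S"
    then obtain t where "A \<in> carrier LM" "0 < t" "rho_div (u * t) (N A) < 1" unfolding S' by blast
    then show "A \<in> carrier L\<rho>" using u(1) by (intro carrier_L\<rho>_I[of _ "u * t" 1]) auto
  qed
  moreover have "{A \<in> carrier L\<rho>. bar_norm A < min (u * (\<epsilon> / 2)) (min (\<epsilon> / 2) 1)} \<subseteq> S"
  proof
    fix A assume "A \<in> {A \<in> carrier L\<rho>. bar_norm A < min (u * (\<epsilon> / 2)) (min (\<epsilon> / 2) 1)}"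
    then have A: "A \<in> carrier L\<rho>" "bar_norm A < min (u * (\<epsilon> / 2)) (min (\<epsilon> / 2) 1)" by auto
    have "rho_div (u * (\<epsilon> / 2)) (N A) < ennreal (min (\<epsilon> / 2) 1)" by (rule bar_norm_less_scaled[OF A(1) u A(2)])
    also have "\<dots> \<le> ennreal 1" by (intro ennreal_leI) simp
    finally show "A \<in> S" unfolding S' using A(1) u by (auto simp: carrier_L\<rho> intro!: exI[of _ "\<epsilon> / 2"])
  qed
  ultimately show "S \<subseteq> carrier L\<rho> \<and> (\<exists>e>0. {A \<in> carrier L\<rho>. bar_norm A < e} \<subseteq> S)"
    using u by (intro conjI exI[of _ "min (u * (\<epsilon> / 2)) (min (\<epsilon> / 2) 1)"]) auto
next
  assume e: "0 < e"
  obtain \<tau> where \<tau>: "0 < \<tau>" "\<tau> < 1" "\<And>s h. h \<in> borel_measurable M \<Longrightarrow> 0 < s \<Longrightarrow> rho_div s h \<le> 1 \<Longrightarrow> rho_div (s / \<tau>) h < ennreal (e / 2)"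
    by (rule pseudo_homogeneous_originD[OF origin, of "e / 2"]) (use e in auto)
  show "\<exists>\<epsilon>>0. {A \<in> carrier LM. gauge_tilde \<rho> (N A) < ennreal \<epsilon>} \<subseteq> {A \<in> carrier L\<rho>. bar_norm A < e}"
  proof (intro exI conjI subsetI)
    show pos: "0 < \<tau> * (e / 2)" using e \<tau>(1) by simp
    fix A assume "A \<in> {A \<in> carrier LM. gauge_tilde \<rho> (N A) < ennreal (\<tau> * (e / 2))}"
    then have A: "A \<in> carrier LM" "gauge_tilde \<rho> (N A) < ennreal (\<tau> * (e / 2))" by auto
    obtain t where t: "0 < t" "t < \<tau> * (e / 2)" "rho_div t (N A) < 1"
      using A(2) unfolding gauge_tilde_less[OF pos] rho_div_def by blast
    have "rho_div (e / 2) (N A) \<le> rho_div (t / \<tau>) (N A)"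
      using A(1) t(1,2) \<tau>(1) by (intro rho_div_antimono) (auto simp: field_simps)
    also have "\<dots> < ennreal (e / 2)" using A(1) t by (intro \<tau>(3)) auto
    finally show "A \<in> {A \<in> carrier L\<rho>. bar_norm A < e}"
      using A(1) e carrier_L\<rho>_I[of A "e / 2"] bar_norm_lessI[of A "e / 2" e] by auto
  qed
qed

lemma basis_tilde':
  assumes origin: "pseudo_homogeneous_origin M \<rho>" and e: "0 < e"
  shows "\<exists>S\<in>L_basis M smul q (gauge_tilde \<rho>). S \<subseteq> {A \<in> carrier L\<rho>. bar_norm A < e}"
proof -
  obtain \<epsilon> where \<epsilon>: "0 < \<epsilon>" "{A \<in> carrier LM. gauge_tilde \<rho> (N A) < ennreal \<epsilon>} \<subseteq> {A \<in> carrier L\<rho>. bar_norm A < e}"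
    using basis_tilde(2)[OF origin e] by blast
  have "{A \<in> carrier LM. gauge_tilde \<rho> (\<lambda>x. ennreal (1 / 1) * N A x) < ennreal \<epsilon>} \<in> L_basis M smul q (gauge_tilde \<rho>)"
    unfolding L_basis_iff[OF gauge_on_tilde[OF gauge]] using \<epsilon>(1) zero_less_one by blast
  then show ?thesis using \<epsilon>(2) by (intro bexI) auto
qed

lemma L_topology_tilde:
  assumes "pseudo_homogeneous_origin M \<rho>"
  shows "L_space M smul q (gauge_tilde \<rho>) = L\<rho>" "L_topology M smul q (gauge_tilde \<rho>) = V.T"
    "nbhd_basis_at V.T \<zero>\<^bsub>L\<rho>\<^esub> (L_basis M smul q (gauge_tilde \<rho>))"
  using L_topology_eqI[OF carrier_tilde basis_tilde(1)[OF assms] basis_tilde'[OF assms]] by blast+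

section \<open>The quasi-norm for a gauge pseudo-homogeneous at the origin\<close>

definition tilde_norm :: "('a \<Rightarrow> 'b) set \<Rightarrow> real" where
  "tilde_norm A = enn2real (gauge_tilde \<rho> (N A))"

lemma tilde_norm_less_iff:
  assumes "A \<in> carrier L\<rho>" "0 < e"
  shows "tilde_norm A < e \<longleftrightarrow> (\<exists>t>0. t < e \<and> rho_div t (N A) < 1)"
proof -
  have "tilde_norm A < e \<longleftrightarrow> gauge_tilde \<rho> (N A) < ennreal e"
    using gauge_tilde_N_finite[OF assms(1)] assms(2) unfolding tilde_norm_def
    by (cases "gauge_tilde \<rho> (N A)") (auto simp: ennreal_less_iff)
  then show ?thesis using gauge_tilde_less[OF assms(2)] by (simp add: rho_div_def)
qed

lemma tilde_norm_lessD:
  assumes "A \<in> carrier L\<rho>" "0 < e" "tilde_norm A < e"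
  shows "rho_div e (N A) < 1"
proof -
  obtain t where "0 < t" "t < e" "rho_div t (N A) < 1" using assms tilde_norm_less_iff by blast
  then show ?thesis using rho_div_antimono[of "N A" t e] assms(1) by (auto simp: carrier_L\<rho> intro: le_less_trans)
qed

lemma tilde_norm_topology:
  assumes "pseudo_homogeneous_origin M \<rho>"
  shows "qn_topology L\<rho> tilde_norm = V.T"
proof (rule qn_topology_cong)
  fix e :: real assume e: "0 < e"
  obtain \<epsilon> where \<epsilon>: "0 < \<epsilon>" "{A \<in> carrier LM. gauge_tilde \<rho> (N A) < ennreal \<epsilon>} \<subseteq> {A \<in> carrier L\<rho>. bar_norm A < e}"
    using basis_tilde(2)[OF assms e] by blast
  show "\<exists>d>0. \<forall>A\<in>carrier L\<rho>. tilde_norm A < d \<longrightarrow> bar_norm A < e"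
  proof (intro exI[of _ \<epsilon>] conjI ballI impI \<epsilon>(1))
    fix A assume A: "A \<in> carrier L\<rho>" "tilde_norm A < \<epsilon>"
    from A(2) have "gauge_tilde \<rho> (N A) < ennreal \<epsilon>"
      unfolding tilde_norm_less_iff[OF A(1) \<epsilon>(1)] gauge_tilde_less[OF \<epsilon>(1)] rho_div_def .
    then show "bar_norm A < e" using \<epsilon>(2) A(1) by (auto simp: carrier_L\<rho>)
  qed
  show "\<exists>d>0. \<forall>A\<in>carrier L\<rho>. bar_norm A < d \<longrightarrow> tilde_norm A < e"
  proof (intro exI[of _ "min (1 * (e / 2)) (min (e / 2) 1)"] conjI ballI impI)
    fix A assume A: "A \<in> carrier L\<rho>" "bar_norm A < min (1 * (e / 2)) (min (e / 2) 1)"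
    have "rho_div (1 * (e / 2)) (N A) < ennreal (min (e / 2) 1)" by (rule bar_norm_less_scaled[OF A(1) zero_less_one e A(2)])
    also have "\<dots> \<le> ennreal 1" by (intro ennreal_leI) simp
    finally show "tilde_norm A < e" unfolding tilde_norm_less_iff[OF A(1) e] using e by (intro exI[of _ "e / 2"]) auto
  qed (use e in auto)
qed (rule V.minus_closed')

lemma quasi_norm_tilde_norm:
  assumes origin: "pseudo_homogeneous_origin M \<rho>"
  shows "quasi_norm L\<rho> tilde_norm"
  unfolding quasi_norm_def L_space_simps
proof (intro conjI ballI allI impI)
  fix A assume A: "A \<in> carrier L\<rho>"
  then have ALM: "A \<in> carrier LM" by (simp add: carrier_L\<rho>)
  show nn: "0 \<le> tilde_norm A" by (simp add: tilde_norm_def)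
  show "0 < tilde_norm A" if "A \<noteq> \<zero>\<^bsub>LM\<^esub>"
  proof (rule ccontr)
    assume "\<not> 0 < tilde_norm A"
    \<comment> \<open>Definiteness is inherited: by \<open>basis_tilde\<close>, a vanishing
      \<open>tilde_norm\<close> makes \<open>bar_norm\<close> smaller than every \<open>e\<close>,
      and \<open>bar_norm\<close> separates points.\<close>
    have "bar_norm A < e" if e: "0 < e" for e
    proof -
      obtain \<epsilon> where \<epsilon>: "0 < \<epsilon>" "{A \<in> carrier LM. gauge_tilde \<rho> (N A) < ennreal \<epsilon>} \<subseteq> {A \<in> carrier L\<rho>. bar_norm A < e}"
        using basis_tilde(2)[OF origin e] by blast
      have "tilde_norm A < \<epsilon>" using \<open>\<not> 0 < tilde_norm A\<close> \<epsilon>(1) by linarith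
      then have "gauge_tilde \<rho> (N A) < ennreal \<epsilon>"
        unfolding tilde_norm_less_iff[OF A \<epsilon>(1)] gauge_tilde_less[OF \<epsilon>(1)] rho_div_def .
      then show ?thesis using \<epsilon>(2) ALM by blast
    qed
    then show False using V.G_sep[OF A] that by simp
  qed
  fix c :: 'k
  \<comment> \<open>For nonzero scalars one inequality suffices; the reverse follows by applying it
    to \<open>inverse c\<close> and the vector \<open>c A\<close>.\<close>
  have le: "tilde_norm (c \<odot>\<^bsub>LM\<^esub> B) \<le> norm c * tilde_norm B" if B: "B \<in> carrier L\<rho>" "c \<noteq> 0" for B and c :: 'k
  proof (rule field_le_epsilon)
    fix e :: real assume e: "0 < e"
    have BLM: "B \<in> carrier LM" using B by (simp add: carrier_L\<rho>)
    have cB: "c \<odot>\<^bsub>LM\<^esub> B \<in> carrier L\<rho>" using V.smul_closed[OF B(1), of c] by simp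
    define s where "s = tilde_norm B + e / (2 * norm c)"
    have "0 < e / (2 * norm c)" "0 \<le> tilde_norm B" using B(2) e by (simp_all add: tilde_norm_def)
    then have s: "0 < s" "tilde_norm B < s" unfolding s_def by linarith+
    have lt: "rho_div (norm c * s) (N (c \<odot>\<^bsub>LM\<^esub> B)) < 1"
      using rho_div_smult[OF BLM s(1), of "norm c" c] tilde_norm_lessD[OF B(1) s] B(2) by (auto intro: le_less_trans)
    have "norm c * s = norm c * tilde_norm B + e / 2" using B(2) by (simp add: s_def field_simps)
    moreover have cs: "0 < norm c * s" by (rule mult_pos_pos) (use s(1) B(2) in auto)
    ultimately have "norm c * s < norm c * tilde_norm B + e" "0 < norm c * tilde_norm B + e" using e by linarith+
    with cs lt have "tilde_norm (c \<odot>\<^bsub>LM\<^esub> B) < norm c * tilde_norm B + e" using tilde_norm_less_iff[OF cB] by blast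
    then show "tilde_norm (c \<odot>\<^bsub>LM\<^esub> B) \<le> norm c * tilde_norm B + e" by simp
  qed
  show "tilde_norm (c \<odot>\<^bsub>LM\<^esub> A) = norm c * tilde_norm A"
  proof (cases "c = 0")
    case True
    \<comment> \<open>The modular of the zero class is the same at every dilation, so a value below
      1 at one \<open>s\<close> gives a value below 1 at all of them.\<close>
    have z: "tilde_norm \<zero>\<^bsub>LM\<^esub> \<le> 0 + e" if e: "0 < e" for e :: real
    proof -
      obtain s where s: "0 < s" "rho_div s (N \<zero>\<^bsub>LM\<^esub>) < ennreal 1"
        by (rule rho_div_small[OF _ zero_less_one rho_div_zero, of 1]) auto
      have "rho_div (e / 2) (N \<zero>\<^bsub>LM\<^esub>) = rho_div s (N \<zero>\<^bsub>LM\<^esub>)"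
        unfolding rho_div_def
      proof (rule gauge_on_cong[OF gauge])
        show "AE x in M. ennreal (1 / (e / 2)) * N \<zero>\<^bsub>LM\<^esub> x = ennreal (1 / s) * N \<zero>\<^bsub>LM\<^esub> x"
          using pt_norm_zero[of M] by eventually_elim simp
      qed auto
      then have "tilde_norm \<zero>\<^bsub>LM\<^esub> < e"
        using tilde_norm_less_iff[OF V.M.zero_closed e] s e by (auto intro!: exI[of _ "e / 2"])
      then show ?thesis by simp
    qed
    have "tilde_norm \<zero>\<^bsub>LM\<^esub> \<le> 0" by (rule field_le_epsilon) (rule z)
    then have "tilde_norm \<zero>\<^bsub>LM\<^esub> = 0" by (simp add: tilde_norm_def antisym)
    then show ?thesis using V.smul_0[OF A] True by simp
  next
    case False
    have "norm c * tilde_norm A = norm c * tilde_norm (inverse c \<odot>\<^bsub>LM\<^esub> (c \<odot>\<^bsub>LM\<^esub> A))" using False ALM by simp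
    also have "\<dots> \<le> norm c * (norm (inverse c) * tilde_norm (c \<odot>\<^bsub>LM\<^esub> A))"
      using False V.smul_closed[OF A, of c] by (intro mult_left_mono le) auto
    also have "\<dots> = tilde_norm (c \<odot>\<^bsub>LM\<^esub> A)" using False by (simp add: norm_inverse)
    finally show ?thesis using le[OF A False] by simp
  qed
next
  obtain k r where kr: "0 < k" "0 < r" "\<And>A B t. A \<in> carrier LM \<Longrightarrow> B \<in> carrier LM \<Longrightarrow> 0 < t \<Longrightarrow>
       rho_div (r * t) (N (A \<oplus>\<^bsub>LM\<^esub> B)) \<le> ennreal k * (rho_div t (N A) + rho_div t (N B))"
    by (rule rho_div_add) blast
  \<comment> \<open>With this value the right side of (a) stays below
    \<open>k * (1 / (2 * k) + 1 / (2 * k)) = 1\<close>, the threshold of \<open>gauge_tilde\<close>.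
    The dilations by \<open>1 / \<tau>\<close> and by \<open>r\<close> produce the constant
    \<open>r / \<tau>\<close>.\<close>
  obtain \<tau> where \<tau>: "0 < \<tau>" "\<tau> < 1" "\<And>s h. h \<in> borel_measurable M \<Longrightarrow> 0 < s \<Longrightarrow> rho_div s h \<le> 1 \<Longrightarrow> rho_div (s / \<tau>) h < ennreal (1 / (2 * k))"
    by (rule pseudo_homogeneous_originD[OF origin, of "1 / (2 * k)"]) (use kr(1) in auto)
  show "\<exists>\<kappa>. \<forall>A\<in>carrier L\<rho>. \<forall>B\<in>carrier L\<rho>. tilde_norm (A \<oplus>\<^bsub>LM\<^esub> B) \<le> \<kappa> * (tilde_norm A + tilde_norm B)"
  proof (rule exI[of _ "r / \<tau>"], rule ballI, rule ballI, rule field_le_epsilon)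
    fix A B and e :: real assume AB: "A \<in> carrier L\<rho>" "B \<in> carrier L\<rho>" and e: "0 < e"
    then have AB': "A \<in> carrier LM" "B \<in> carrier LM" by (auto simp: carrier_L\<rho>)
    have ABC: "A \<oplus>\<^bsub>LM\<^esub> B \<in> carrier L\<rho>" using V.M.a_closed[OF AB] by simp
    \<comment> \<open>The surplus \<open>e * \<tau> / (2 * r)\<close> becomes \<open>e / 2\<close>
      after multiplication by \<open>r / \<tau>\<close>.\<close>
    define s where "s = tilde_norm A + tilde_norm B + e * \<tau> / (2 * r)"
    have pos: "0 < e * \<tau> / (2 * r)" using e \<tau> kr by simp
    have HAB: "0 \<le> tilde_norm A" "0 \<le> tilde_norm B" by (simp_all add: tilde_norm_def)
    have s: "0 < s" "tilde_norm A < s" "tilde_norm B < s" unfolding s_def using pos HAB by linarith+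
    have "rho_div (s / \<tau>) (N A) < ennreal (1 / (2 * k))" "rho_div (s / \<tau>) (N B) < ennreal (1 / (2 * k))"
      using tilde_norm_lessD[OF AB(1) s(1,2)] tilde_norm_lessD[OF AB(2) s(1,3)] AB' s(1) by (auto intro!: \<tau>(3))
    then have "ennreal k * (rho_div (s / \<tau>) (N A) + rho_div (s / \<tau>) (N B)) < ennreal k * (ennreal (1 / (2 * k)) + ennreal (1 / (2 * k)))"
      using kr(1) by (intro ennreal_mult_strict_left_mono add_strict_mono) auto
    also have "\<dots> = 1" using kr(1) by (simp flip: ennreal_plus ennreal_mult)
    finally have "rho_div (r * (s / \<tau>)) (N (A \<oplus>\<^bsub>LM\<^esub> B)) < 1"
      using kr(3)[OF AB', of "s / \<tau>"] s(1) \<tau>(1) by (auto intro: le_less_trans)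
    moreover have rho_div: "0 < r * (s / \<tau>)" using s(1) \<tau>(1) kr(2) by simp
    moreover have lt: "r * (s / \<tau>) < r / \<tau> * (tilde_norm A + tilde_norm B) + e"
    proof -
      have "r * (s / \<tau>) = r / \<tau> * s" by simp
      also have "\<dots> = r / \<tau> * (tilde_norm A + tilde_norm B) + r / \<tau> * (e * \<tau> / (2 * r))"
        unfolding s_def by (rule distrib_left)
      also have "r / \<tau> * (e * \<tau> / (2 * r)) = e / 2" using kr(2) \<tau>(1) by simp
      also have "r / \<tau> * (tilde_norm A + tilde_norm B) + e / 2 < r / \<tau> * (tilde_norm A + tilde_norm B) + e" using e by simp
      finally show ?thesis .
    qed
    moreover have "0 < r / \<tau> * (tilde_norm A + tilde_norm B) + e" using rho_div lt by linarith
    ultimately have "tilde_norm (A \<oplus>\<^bsub>LM\<^esub> B) < r / \<tau> * (tilde_norm A + tilde_norm B) + e" using tilde_norm_less_iff[OF ABC] by blast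
    then show "tilde_norm (A \<oplus>\<^bsub>LM\<^esub> B) \<le> r / \<tau> * (tilde_norm A + tilde_norm B) + e" by simp
  qed
qed

end

section \<open>Local p-convexity\<close>

lemma measurable_ennreal_rpow [measurable (raw)]:
  assumes [measurable]: "f \<in> borel_measurable M"
  shows "(\<lambda>x. ennreal_rpow (f x) p) \<in> borel_measurable M"
  unfolding ennreal_rpow_def by measurable

lemma ennreal_rpow_ennreal: "0 \<le> a \<Longrightarrow> ennreal_rpow (ennreal a) p = ennreal (a powr p)"
  by (simp add: ennreal_rpow_def)

lemma ennreal_rpow_inverse_ge:
  assumes "0 < p" "0 \<le> a" "ennreal (a powr p) \<le> y"
  shows "ennreal a \<le> ennreal_rpow y (1 / p)"
proof (cases y)
  case (real r)
  then have "(a powr p) powr (1 / p) \<le> r powr (1 / p)" using assms by (intro powr_mono2) auto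
  then show ?thesis using real assms by (simp add: ennreal_rpow_ennreal powr_powr ennreal_leI)
qed (simp add: ennreal_rpow_def)

context quasi_banach_target
begin

text \<open>\<open>Q\<close> is the Minkowski functional of a \<open>p\<close>-convex neighbourhood of the origin.\<close>

lemma locally_p_convex_functional:
  assumes p: "0 < p" and lpc: "locally_p_convex (typ_vspace smul) tgt.T p"
  obtains Q \<delta> where "0 < \<delta>" "\<And>x. q x \<le> Q x" "\<And>x. Q x \<le> q x / \<delta>"
    "\<And>s t x y. Q (smul s x + smul t y) powr p \<le> norm s powr p * Q x powr p + norm t powr p * Q y powr p"
proof -
  obtain \<B> where B: "nbhd_basis_at tgt.T 0 \<B>" "\<And>A. A \<in> \<B> \<Longrightarrow> p_convex (typ_vspace smul) p A"
    using lpc unfolding locally_p_convex_def by auto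
  have "openin tgt.T {x. q (x - 0) < 1}" by (rule open_ball)
  then have "\<exists>A\<in>\<B>. A \<subseteq> {x. q (x - 0) < 1}" using B(1) unfolding nbhd_basis_at_def by simp
  then obtain A where A: "A \<in> \<B>" "\<And>x. x \<in> A \<Longrightarrow> q x < 1" by auto
  have "\<forall>S\<in>\<B>. S \<subseteq> topspace tgt.T \<and>
      (\<exists>U. openin tgt.T U \<and> 0 \<in> U \<and> U \<subseteq> S)"
    using B(1) unfolding nbhd_basis_at_def by (elim conjE)
  from bspec[OF this A(1)] obtain U where U: "openin tgt.T U" "0 \<in> U" "U \<subseteq> A"
    by (elim conjE exE)
  then obtain \<delta> where \<delta>: "0 < \<delta>" "\<And>x. q (x - 0) < \<delta> \<Longrightarrow> x \<in> U" unfolding openin_target by blast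
  then have \<delta>A: "x \<in> A" if "q x < \<delta>" for x using that U(3) by auto
  have conv: "smul s x + smul t y \<in> A" if "x \<in> A" "y \<in> A" "norm s powr p + norm t powr p \<le> 1" for s t x y
    using B(2)[OF A(1)] that unfolding p_convex_def by simp
  \<comment> \<open>\<open>A\<close> lies in the unit ball of \<open>q\<close>, which gives
    \<open>q x \<le> Q x\<close>, and contains the \<open>\<delta>\<close>-ball, which gives
    \<open>Q x \<le> q x / \<delta>\<close>.\<close>
  define T where "T x = {t::real. 0 < t \<and> smul (of_real (1 / t)) x \<in> A}" for x
  define Q where "Q x = Inf (T x)" for x
  have T_big: "t \<in> T x" if "0 < t" "q x / \<delta> < t" for t x
    unfolding T_def using that \<delta>(1) by (auto intro!: \<delta>A simp: q_smul norm_divide field_simps)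
  have T_ne: "T x \<noteq> {}" for x
    using T_big[of "q x / \<delta> + 1" x] \<delta>(1) by (auto simp: add_nonneg_pos)
  have T_low: "q x \<le> t" if "t \<in> T x" for t x
    using that A(2)[of "smul (of_real (1 / t)) x"] by (auto simp: T_def q_smul norm_divide field_simps)
  then have bdd: "bdd_below (T x)" for x by (intro bdd_belowI)
  have Q_low: "q x \<le> Q x" for x unfolding Q_def by (rule cInf_greatest[OF T_ne T_low])
  then have Q_nn: "0 \<le> Q x" for x using q_nonneg order_trans by blast
  \<comment> \<open>Taking the second scalar to be 0 in \<open>p\<close>-convexity shows that
    \<open>A\<close> is stable under scalars of norm at most 1, so \<open>T x\<close> is closed
    upwards.\<close>
  have T_Q: "t \<in> T x" if Qt: "Q x < t" for t x
  proof -
    obtain s where s: "s \<in> T x" "s < t" using Qt cInf_lessD[OF T_ne] unfolding Q_def by blast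
    have pos: "0 < s" "0 < t" using s by (auto simp: T_def)
    have "norm (of_real (s / t) :: 'k) powr p \<le> 1 powr p"
      unfolding norm_of_real using pos s(2) p by (intro powr_mono2) auto
    then have "smul (of_real (s / t)) (smul (of_real (1 / s)) x) + smul 0 (smul (of_real (1 / s)) x) \<in> A"
      using s(1) by (intro conv) (auto simp: T_def)
    moreover have "(of_real (s / t) :: 'k) * of_real (1 / s) = of_real (1 / t)"
      unfolding of_real_mult[symmetric] using pos by simp
    ultimately show ?thesis using pos(2) unfolding T_def by (simp only: smul_simps add_0_right mem_Collect_eq) simp
  qed
  have Q_high: "Q x \<le> q x / \<delta>" for x
  proof (rule field_le_epsilon)
    fix e :: real assume "0 < e"
    then have "q x / \<delta> + e \<in> T x" using \<delta>(1) by (intro T_big) (auto simp: add_nonneg_pos)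
    then show "Q x \<le> q x / \<delta> + e" unfolding Q_def by (rule cInf_lower[OF _ bdd])
  qed
  have Q0: "Q 0 = 0" using Q_high[of 0] Q_nn[of 0] by simp
  have step: "Q (smul s x + smul t y) powr p \<le> norm s powr p * a powr p + norm t powr p * b powr p"
    if a: "Q x < a" and b: "Q y < b" for s t x y a b
  proof (cases "s = 0 \<and> t = 0")
    \<comment> \<open>The normalising number \<open>m\<close> of the other case would vanish
      here.\<close>
    case True
    then show ?thesis using p by (simp add: Q0)
  next
    case False
    have pos: "0 < a" "0 < b" using a b Q_nn[of x] Q_nn[of y] by linarith+
    define w where "w = norm s powr p * a powr p + norm t powr p * b powr p"
    have w: "0 < w" using False pos unfolding w_def by (auto intro: add_pos_nonneg add_nonneg_pos)
    \<comment> \<open>Dividing \<open>s x + t y\<close> by \<open>m\<close> yields a combination of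
      \<open>x / a\<close> and \<open>y / b\<close>, both in \<open>A\<close>, whose coefficients
      have norms with \<open>p\<close>-th powers summing to exactly 1.\<close>
    define m where "m = w powr (1 / p)"
    have m: "0 < m" "m powr p = w" using w p by (auto simp: m_def powr_powr)
    have "norm (s * of_real (a / m)) powr p + norm (t * of_real (b / m)) powr p = 1"
      using pos m w by (simp add: norm_mult norm_divide powr_mult powr_divide add_divide_distrib[symmetric] w_def)
    then have "smul (s * of_real (a / m)) (smul (of_real (1 / a)) x) + smul (t * of_real (b / m)) (smul (of_real (1 / b)) y) \<in> A"
      using T_Q[OF a] T_Q[OF b] by (intro conv) (auto simp: T_def)
    moreover have "smul (s * of_real (a / m)) (smul (of_real (1 / a)) x) + smul (t * of_real (b / m)) (smul (of_real (1 / b)) y)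
        = smul (of_real (1 / m)) (smul s x + smul t y)"
      using pos by (simp add: smul_distrib(2) mult.commute)
    ultimately have "m \<in> T (smul s x + smul t y)" using m(1) by (simp add: T_def)
    then have "Q (smul s x + smul t y) \<le> m" unfolding Q_def by (rule cInf_lower[OF _ bdd])
    then have "Q (smul s x + smul t y) powr p \<le> m powr p" using Q_nn p by (intro powr_mono2) auto
    then show ?thesis using m(2) by (simp add: w_def)
  qed
  \<comment> \<open>The infima \<open>Q x\<close> and \<open>Q y\<close> need not be attained, so
    the estimate is used slightly above them and passed to the limit.\<close>
  have "Q (smul s x + smul t y) powr p \<le> norm s powr p * Q x powr p + norm t powr p * Q y powr p" for s t x y
  proof (rule LIMSEQ_le_const)
    have lim: "(\<lambda>n. (Q x + inverse (real (Suc n))) powr p) \<longlonglongrightarrow> (Q x + 0) powr p" for x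
      using p Q_nn[of x] by (intro tendsto_powr' tendsto_add tendsto_const LIMSEQ_inverse_real_of_nat) auto
    show "(\<lambda>n. norm s powr p * (Q x + inverse (real (Suc n))) powr p + norm t powr p * (Q y + inverse (real (Suc n))) powr p)
        \<longlonglongrightarrow> norm s powr p * Q x powr p + norm t powr p * Q y powr p"
      using lim[of x] lim[of y] by (intro tendsto_add tendsto_mult tendsto_const) auto
    show "\<exists>K. \<forall>n\<ge>K. Q (smul s x + smul t y) powr p \<le> norm s powr p * (Q x + inverse (real (Suc n))) powr p + norm t powr p * (Q y + inverse (real (Suc n))) powr p"
      by (intro exI[of _ 0] allI impI step) auto
  qed
  with \<delta>(1) Q_low Q_high show thesis by (rule that)
qed

end

context modular_space
begin

text \<open>
  A replacement for the \<open>p\<close>-convex hull of a ball, in which the convex combinations are taken in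
  \<open>L\<^sup>+(\<mu>)\<close> instead of in the space of vector-valued functions.
\<close>

definition p_hull :: "real \<Rightarrow> ('b \<Rightarrow> real) \<Rightarrow> real \<Rightarrow> real \<Rightarrow> ('a \<Rightarrow> 'b) set set" where
  "p_hull p Q u \<epsilon> = {cls M a | a. sep_measurable M a \<and> (\<exists>(n::nat) (s::nat \<Rightarrow> real) f. 1 \<le> n \<and>
     (\<forall>j\<in>{1..n}. 0 \<le> s j \<and> f j \<in> borel_measurable M \<and> \<rho> (f j) < ennreal \<epsilon>) \<and> (\<Sum>j=1..n. s j powr p) \<le> 1 \<and>
     (AE x in M. ennreal ((Q (a x) / u) powr p) \<le> (\<Sum>j=1..n. ennreal (s j powr p) * ennreal_rpow (f j x) p)))}"

text \<open>Since \<open>q \<le> Q\<close>, the \<open>p\<close>-th root of the combination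
  dominates \<open>N A / u\<close>. Lattice \<open>p\<close>-convexity bounds its modular by
  \<open>C\<close> times the largest \<open>\<rho> (f j)\<close>, and a maximum of finitely many
  numbers below \<open>\<epsilon>\<close> is below \<open>\<epsilon>\<close>.\<close>

lemma p_hull_small:
  assumes p: "0 < p" and lat: "lattice_p_convex M \<rho> p" and Q: "\<And>x. q x \<le> Q x"
  obtains C where "1 \<le> C" "\<And>u \<epsilon> A. 0 < u \<Longrightarrow> 0 < \<epsilon> \<Longrightarrow> A \<in> p_hull p Q u \<epsilon> \<Longrightarrow> rho_div u (N A) < ennreal (C * \<epsilon>)"
proof -
  obtain C :: real where C: "1 \<le> C" "\<And>(n::nat) (s::nat \<Rightarrow> real) f. 1 \<le> n \<Longrightarrow>
        (\<forall>j\<in>{1..n}. 0 \<le> s j \<and> f j \<in> borel_measurable M) \<Longrightarrow> (\<Sum>j=1..n. s j powr p) \<le> 1 \<Longrightarrow>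
        \<rho> (\<lambda>x. ennreal_rpow (\<Sum>j=1..n. ennreal (s j powr p) * ennreal_rpow (f j x) p) (1 / p))
          \<le> ennreal C * (MAX j\<in>{1..n}. \<rho> (f j))"
    using lat unfolding lattice_p_convex_def by blast
  have "rho_div u (N A) < ennreal (C * \<epsilon>)" if u: "0 < u" and e: "0 < \<epsilon>" and A: "A \<in> p_hull p Q u \<epsilon>" for u \<epsilon> A
  proof -
    obtain a s f and n :: nat where a: "sep_measurable M a" "A = cls M a" and n: "1 \<le> n"
      and f: "\<And>j. j \<in> {1..n} \<Longrightarrow> 0 \<le> s j \<and> f j \<in> borel_measurable M \<and> \<rho> (f j) < ennreal \<epsilon>"
      and s: "(\<Sum>j=1..n. s j powr p) \<le> 1"
      and le: "AE x in M. ennreal ((Q (a x) / u) powr p) \<le> (\<Sum>j=1..n. ennreal (s j powr p) * ennreal_rpow (f j x) p)"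
      using A unfolding p_hull_def by blast
    let ?h = "\<lambda>x. ennreal_rpow (\<Sum>j=1..n. ennreal (s j powr p) * ennreal_rpow (f j x) p) (1 / p)"
    have "rho_div u (N A) \<le> \<rho> ?h"
      unfolding rho_div_def
    proof (rule gauge_on_mono[OF gauge])
      show "AE x in M. ennreal (1 / u) * N A x \<le> ?h x"
        using le pt_norm_cls(1)[OF a(1)] unfolding a(2)
      proof eventually_elim
        case (elim x)
        have "0 \<le> Q (a x)" using Q[of "a x"] q_nonneg order_trans by blast
        then have "ennreal (Q (a x) / u) \<le> ?h x" using elim(1) p u by (intro ennreal_rpow_inverse_ge) auto
        moreover have "ennreal (1 / u) * ennreal (q (a x)) \<le> ennreal (Q (a x) / u)"
          using u Q[of "a x"] by (simp add: divide_right_mono ennreal_leI flip: ennreal_mult)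
        ultimately show ?case unfolding elim(2) by (rule order_trans[rotated])
      qed
      show "?h \<in> borel_measurable M"
      proof (rule measurable_ennreal_rpow, rule borel_measurable_sum)
        fix j assume "j \<in> {1..n}"
        then have [measurable]: "f j \<in> borel_measurable M" using f by blast
        show "(\<lambda>x. ennreal (s j powr p) * ennreal_rpow (f j x) p) \<in> borel_measurable M" by measurable
      qed
    qed (use a in auto)
    also have "\<dots> \<le> ennreal C * (MAX j\<in>{1..n}. \<rho> (f j))" using n f s by (intro C(2)) auto
    also have "\<dots> < ennreal C * ennreal \<epsilon>"
    proof (rule ennreal_mult_strict_left_mono)
      show "(MAX j\<in>{1..n}. \<rho> (f j)) < ennreal \<epsilon>" using n f by (subst Max_less_iff) auto
    qed (use C(1) in auto)
    also have "\<dots> = ennreal (C * \<epsilon>)" using C(1) e by (simp add: ennreal_mult)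
    finally show ?thesis .
  qed
  with C(1) show thesis by (rule that)
qed

text \<open>A combination with the single term \<open>N A / (\<delta> * u)\<close> and coefficient 1
  is enough, because \<open>Q \<le> q / \<delta>\<close>.\<close>

lemma p_hull_large:
  assumes p: "0 < p" and Q: "0 < \<delta>" "\<And>x. 0 \<le> Q x" "\<And>x. Q x \<le> q x / \<delta>" and u: "0 < u"
  shows "{A \<in> carrier LM. rho_div (\<delta> * u) (N A) < ennreal \<epsilon>} \<subseteq> p_hull p Q u \<epsilon>"
proof
  fix A assume A: "A \<in> {A \<in> carrier LM. rho_div (\<delta> * u) (N A) < ennreal \<epsilon>}"
  then obtain a where a: "sep_measurable M a" "A = cls M a" using carrier_cls by blast
  let ?f = "\<lambda>x. ennreal (1 / (\<delta> * u)) * N A x"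
  have "AE x in M. ennreal ((Q (a x) / u) powr p) \<le> ennreal_rpow (?f x) p"
    using pt_norm_cls(1)[OF a(1)] unfolding a(2)
  proof eventually_elim
    case (elim x)
    have "Q (a x) / u \<le> q (a x) / \<delta> / u" using Q(3) u by (intro divide_right_mono) auto
    then have "(Q (a x) / u) powr p \<le> (q (a x) / (\<delta> * u)) powr p"
      using Q(2) u p by (intro powr_mono2) auto
    then show ?case
      unfolding elim using Q(1) u by (simp add: ennreal_rpow_ennreal ennreal_leI flip: ennreal_mult)
  qed
  then show "A \<in> p_hull p Q u \<epsilon>"
    unfolding p_hull_def using a A
    by (intro CollectI exI[of _ a] conjI exI[of _ "1::nat"] exI[of _ "\<lambda>_. 1::real"] exI[of _ "\<lambda>_. ?f"])
      (auto simp: rho_div_def)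
qed

text \<open>The two families are concatenated, with coefficients multiplied by \<open>norm s\<close>
  and \<open>norm t\<close>; their \<open>p\<close>-th powers sum to at most
  \<open>norm s powr p + norm t powr p\<close>. This is why the hull admits families of every
  length.\<close>

lemma p_hull_p_convex:
  assumes Q: "\<And>x. 0 \<le> Q x"
    "\<And>s t x y. Q (smul s x + smul t y) powr p \<le> norm s powr p * Q x powr p + norm t powr p * Q y powr p"
    and u: "0 < u" and AB: "A \<in> p_hull p Q u \<epsilon>" "B \<in> p_hull p Q u \<epsilon>"
    and st: "norm s powr p + norm t powr p \<le> 1"
  shows "s \<odot>\<^bsub>LM\<^esub> A \<oplus>\<^bsub>LM\<^esub> t \<odot>\<^bsub>LM\<^esub> B \<in> p_hull p Q u \<epsilon>"
proof -
  obtain a s1 f and m :: nat where a: "sep_measurable M a" "A = cls M a" and m: "1 \<le> m"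
    and f: "\<And>j. j \<in> {1..m} \<Longrightarrow> 0 \<le> s1 j \<and> f j \<in> borel_measurable M \<and> \<rho> (f j) < ennreal \<epsilon>"
    and s1: "(\<Sum>j=1..m. s1 j powr p) \<le> 1"
    and le1: "AE x in M. ennreal ((Q (a x) / u) powr p) \<le> (\<Sum>j=1..m. ennreal (s1 j powr p) * ennreal_rpow (f j x) p)"
    using AB(1) unfolding p_hull_def by blast
  obtain b s2 g and n :: nat where b: "sep_measurable M b" "B = cls M b" and n: "1 \<le> n"
    and g: "\<And>j. j \<in> {1..n} \<Longrightarrow> 0 \<le> s2 j \<and> g j \<in> borel_measurable M \<and> \<rho> (g j) < ennreal \<epsilon>"
    and s2: "(\<Sum>j=1..n. s2 j powr p) \<le> 1"
    and le2: "AE x in M. ennreal ((Q (b x) / u) powr p) \<le> (\<Sum>j=1..n. ennreal (s2 j powr p) * ennreal_rpow (g j x) p)"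
    using AB(2) unfolding p_hull_def by blast
  \<comment> \<open>Indices start at 1: the first family occupies \<open>{1..m}\<close>, the second
    is shifted by \<open>m\<close>.\<close>
  define S where "S j = (if j \<le> m then norm s * s1 j else norm t * s2 (j - m))" for j
  define F where "F j = (if j \<le> m then f j else g (j - m))" for j
  have sep_measurable: "sep_measurable M (\<lambda>x. smul s (a x))" "sep_measurable M (\<lambda>x. smul t (b x))"
    "sep_measurable M (\<lambda>x. smul s (a x) + smul t (b x))"
    using a b by (auto intro: sep_measurable_smul sep_measurable_add)
  have eq: "s \<odot>\<^bsub>LM\<^esub> A \<oplus>\<^bsub>LM\<^esub> t \<odot>\<^bsub>LM\<^esub> B = cls M (\<lambda>x. smul s (a x) + smul t (b x))"
    using a b sep_measurable by (simp add: smult_cls add_cls)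
  have split: "(\<Sum>j=1..m+n. h j) = (\<Sum>j=1..m. h j) + (\<Sum>j=1..n. h (j + m))" for h :: "nat \<Rightarrow> 'z::comm_monoid_add"
    using sum.ub_add_nat[of 1 m h n] sum.shift_bounds_cl_nat_ivl[of h 1 m n] by (simp add: add.commute)
  have SF: "0 \<le> S j \<and> F j \<in> borel_measurable M \<and> \<rho> (F j) < ennreal \<epsilon>" if j: "j \<in> {1..m+n}" for j
  proof (cases "j \<le> m")
    case True
    then show ?thesis using j f[of j] by (simp add: S_def F_def)
  next
    case False
    then have "j - m \<in> {1..n}" using j by auto
    from g[OF this] show ?thesis using False by (simp add: S_def F_def)
  qed
  have S1: "S j powr p = norm s powr p * s1 j powr p" if "j \<in> {1..m}" for j
    using that f[OF that] by (simp add: S_def powr_mult)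
  have S2: "S (j + m) powr p = norm t powr p * s2 j powr p" if "j \<in> {1..n}" for j
    using that g[OF that] by (simp add: S_def powr_mult)
  have "(\<Sum>j=1..m+n. S j powr p) = norm s powr p * (\<Sum>j=1..m. s1 j powr p) + norm t powr p * (\<Sum>j=1..n. s2 j powr p)"
    unfolding split sum_distrib_left by (intro arg_cong2[of _ _ _ _ "(+)"] sum.cong refl S1 S2)
  also have "\<dots> \<le> norm s powr p * 1 + norm t powr p * 1"
    using s1 s2 by (intro add_mono mult_left_mono) auto
  also have "\<dots> \<le> 1" using st by simp
  finally have Ssum: "(\<Sum>j=1..m+n. S j powr p) \<le> 1" .
  have "AE x in M. ennreal ((Q (smul s (a x) + smul t (b x)) / u) powr p)
      \<le> (\<Sum>j=1..m+n. ennreal (S j powr p) * ennreal_rpow (F j x) p)"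
    using le1 le2
  proof eventually_elim
    case (elim x)
    have "(Q (smul s (a x) + smul t (b x)) / u) powr p = Q (smul s (a x) + smul t (b x)) powr p / u powr p"
      using u Q(1) by (simp add: powr_divide)
    also have "\<dots> \<le> (norm s powr p * Q (a x) powr p + norm t powr p * Q (b x) powr p) / u powr p"
      by (intro divide_right_mono Q(2)) simp
    also have "\<dots> = norm s powr p * (Q (a x) / u) powr p + norm t powr p * (Q (b x) / u) powr p"
      using u Q(1) by (simp add: powr_divide add_divide_distrib)
    finally have "ennreal ((Q (smul s (a x) + smul t (b x)) / u) powr p) \<le>
        ennreal (norm s powr p) * ennreal ((Q (a x) / u) powr p) + ennreal (norm t powr p) * ennreal ((Q (b x) / u) powr p)"
      by (simp add: ennreal_leI flip: ennreal_mult ennreal_plus)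
    also have "\<dots> \<le> ennreal (norm s powr p) * (\<Sum>j=1..m. ennreal (s1 j powr p) * ennreal_rpow (f j x) p)
        + ennreal (norm t powr p) * (\<Sum>j=1..n. ennreal (s2 j powr p) * ennreal_rpow (g j x) p)"
      using elim by (intro add_mono mult_left_mono) auto
    also have "\<dots> = (\<Sum>j=1..m+n. ennreal (S j powr p) * ennreal_rpow (F j x) p)"
      unfolding split sum_distrib_left
    proof (intro arg_cong2[of _ _ _ _ "(+)"] sum.cong refl)
      fix j assume j: "j \<in> {1..m}"
      then show "ennreal (norm s powr p) * (ennreal (s1 j powr p) * ennreal_rpow (f j x) p) = ennreal (S j powr p) * ennreal_rpow (F j x) p"
        unfolding S1[OF j] by (simp add: F_def ennreal_mult mult.assoc)
    next
      fix j assume j: "j \<in> {1..n}"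
      then show "ennreal (norm t powr p) * (ennreal (s2 j powr p) * ennreal_rpow (g j x) p) = ennreal (S (j + m) powr p) * ennreal_rpow (F (j + m) x) p"
        unfolding S2[OF j] by (simp add: F_def ennreal_mult mult.assoc)
    qed
    finally show ?case .
  qed
  then show ?thesis
    unfolding p_hull_def eq using sep_measurable(3) m SF Ssum
    by (intro CollectI exI[of _ "\<lambda>x. smul s (a x) + smul t (b x)"] conjI exI[of _ "m + n"] exI[of _ S] exI[of _ F]) auto
qed

text \<open>The constant \<open>C\<close> of lattice \<open>p\<close>-convexity may keep a ball from
  being \<open>p\<close>-convex. The hulls are \<open>p\<close>-convex and are squeezed between two
  sublevel sets: they contain the one with dilation \<open>\<delta> * u\<close> and bound
  \<open>\<epsilon>\<close>, and lie in the one with dilation \<open>u\<close> and bound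
  \<open>C * \<epsilon>\<close>.\<close>

theorem locally_p_convex_L\<rho>:
  assumes p: "0 < p" and lat: "lattice_p_convex M \<rho> p"
    and lpc: "locally_p_convex (typ_vspace smul) tgt.T p"
  shows "locally_p_convex L\<rho> V.T p"
proof -
  obtain Q \<delta> where \<delta>: "0 < \<delta>" and Q: "\<And>x. q x \<le> Q x" "\<And>x. Q x \<le> q x / \<delta>"
    "\<And>s t x y. Q (smul s x + smul t y) powr p \<le> norm s powr p * Q x powr p + norm t powr p * Q y powr p"
    by (rule locally_p_convex_functional[OF p lpc]) blast
  have Q0: "0 \<le> Q x" for x using Q(1)[of x] q_nonneg order_trans by blast
  obtain C where C: "1 \<le> C" "\<And>u \<epsilon> A. 0 < u \<Longrightarrow> 0 < \<epsilon> \<Longrightarrow> A \<in> p_hull p Q u \<epsilon> \<Longrightarrow> rho_div u (N A) < ennreal (C * \<epsilon>)"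
    by (rule p_hull_small[OF p lat Q(1)]) blast
  have sub: "p_hull p Q u \<epsilon> \<subseteq> carrier LM" for u \<epsilon> by (auto simp: p_hull_def)
  have subC: "p_hull p Q u \<epsilon> \<subseteq> carrier L\<rho>" if "0 < u" "0 < \<epsilon>" for u \<epsilon>
    using sub C(2)[OF that] carrier_L\<rho>_I[OF _ that(1)] by blast
  let ?B = "{p_hull p Q u \<epsilon> | u \<epsilon>. 0 < u \<and> 0 < \<epsilon>}"
  have "nbhd_basis_at V.T \<zero>\<^bsub>L\<rho>\<^esub> ?B"
  proof (rule V.nbhd_basis_refine)
    fix S assume "S \<in> ?B"
    then obtain u \<epsilon> where u: "0 < u" "0 < \<epsilon>" "S = p_hull p Q u \<epsilon>" by blast
    have du: "0 < \<delta> * u" using \<delta> u by simp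
    have "{A \<in> carrier LM. rho_div (\<delta> * u) (N A) < ennreal \<epsilon>} \<in> L_basis M smul q \<rho>"
      unfolding L_basis_iff[OF gauge] rho_div_def using du u(2) by blast
    from basis_rho(1)[OF this] obtain e where "e > 0" "{A \<in> carrier L\<rho>. bar_norm A < e} \<subseteq> {A \<in> carrier LM. rho_div (\<delta> * u) (N A) < ennreal \<epsilon>}"
      by blast
    then show "S \<subseteq> carrier L\<rho> \<and> (\<exists>e>0. {A \<in> carrier L\<rho>. bar_norm A < e} \<subseteq> S)"
      using p_hull_large[where Q = Q, OF p \<delta> Q0 Q(2) u(1), of \<epsilon>] subC[OF u(1,2)] u(3) by blast
  next
    fix e :: real assume e: "0 < e"
    have pos: "0 < e / 2" "0 < e / 2 / C" using e C(1) by auto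
    have "A \<in> carrier L\<rho> \<and> bar_norm A < e" if A: "A \<in> p_hull p Q (e / 2) (e / 2 / C)" for A
    proof -
      have "rho_div (e / 2) (N A) < ennreal (e / 2)" using C(2)[OF pos A] C(1) by simp
      then show ?thesis using sub A subC[OF pos] e bar_norm_lessI[of A "e / 2" e] by auto
    qed
    then show "\<exists>S\<in>?B. S \<subseteq> {A \<in> carrier L\<rho>. bar_norm A < e}"
      using pos by (intro bexI[of _ "p_hull p Q (e / 2) (e / 2 / C)"]) blast+
  qed
  moreover have "p_convex L\<rho> p S" if "S \<in> ?B" for S
    using that subC p_hull_p_convex[where Q = Q, OF Q0 Q(3)] unfolding p_convex_def by auto
  ultimately show ?thesis unfolding locally_p_convex_def by blast
qed

end

theorem mainTheorem3:
  fixes M :: "'a measure"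
    and \<rho> :: "('a \<Rightarrow> ennreal) \<Rightarrow> ennreal"
    and smul :: "'k::real_normed_field \<Rightarrow> 'b::ab_group_add \<Rightarrow> 'b"
    and q :: "'b \<Rightarrow> real"
  assumes "sigma_finite_measure M"
    and "modular_function_norm M \<rho>"
    and "quasi_banach (typ_vspace smul) q"
    and "continuous_map (target_topology smul q) euclideanreal q"
  shows
    "\<comment> \<open>(i)\<close>
     (vector_topology (L_space M smul q \<rho>) (L_topology M smul q \<rho>) \<and>
      complete_tvs (L_space M smul q \<rho>) (L_topology M smul q \<rho>) \<and>
      nbhd_basis_at (L_topology M smul q \<rho>) \<zero>\<^bsub>L_space M smul q \<rho>\<^esub> (L_basis M smul q \<rho>)) \<and>
     \<comment> \<open>(ii)\<close>
     (L_space M smul q \<rho> = L_space M smul q (gauge_bar \<rho>) \<and>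
      L_topology M smul q \<rho> = L_topology M smul q (gauge_bar \<rho>) \<and>
      nbhd_basis_at (L_topology M smul q (gauge_bar \<rho>)) \<zero>\<^bsub>L_space M smul q (gauge_bar \<rho>)\<^esub>
        (L_basis M smul q (gauge_bar \<rho>))) \<and>
     \<comment> \<open>(iii)\<close>
     (pseudo_homogeneous_infinity M \<rho> \<longrightarrow>
      carrier (L_space M smul q \<rho>) = {A \<in> carrier (L_all M smul q). \<rho> (pt_norm q A) < \<infinity>} \<and>
      nbhd_basis_at (L_topology M smul q \<rho>) \<zero>\<^bsub>L_space M smul q \<rho>\<^esub>
        {L_ball M smul q \<rho> \<epsilon> | \<epsilon>. 0 < \<epsilon>}) \<and>
     \<comment> \<open>(iv)\<close>
     (pseudo_homogeneous_origin M \<rho> \<longrightarrow>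
      (L_space M smul q \<rho> = L_space M smul q (gauge_tilde \<rho>) \<and>
       L_topology M smul q \<rho> = L_topology M smul q (gauge_tilde \<rho>) \<and>
       nbhd_basis_at (L_topology M smul q (gauge_tilde \<rho>)) \<zero>\<^bsub>L_space M smul q (gauge_tilde \<rho>)\<^esub>
         (L_basis M smul q (gauge_tilde \<rho>))) \<and>
      ((\<forall>A\<in>carrier (L_space M smul q (gauge_tilde \<rho>)). gauge_tilde \<rho> (pt_norm q A) < \<infinity>) \<and>
       quasi_banach (L_space M smul q (gauge_tilde \<rho>))
         (\<lambda>A. enn2real (gauge_tilde \<rho> (pt_norm q A))) \<and>
       qn_topology (L_space M smul q (gauge_tilde \<rho>))
         (\<lambda>A. enn2real (gauge_tilde \<rho> (pt_norm q A))) = L_topology M smul q (gauge_tilde \<rho>))) \<and>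
     \<comment> \<open>(v)\<close>
     (\<forall>p::real. 0 < p \<and> p \<le> 1 \<and> lattice_p_convex M \<rho> p \<and>
        locally_p_convex (typ_vspace smul) (target_topology smul q) p \<longrightarrow>
      locally_p_convex (L_space M smul q \<rho>) (L_topology M smul q \<rho>) p)"
proof -
  interpret modular_space smul q M \<rho>
    using assms by (intro modular_space.intro quasi_banach_target.intro modular_space_axioms.intro)
  have i: "vector_topology L\<rho> V.T" "complete_tvs L\<rho> V.T"
    by (rule V.vector_topology_T, rule complete_L\<rho>)
  have tilde_norm_eq: "(\<lambda>A. enn2real (gauge_tilde \<rho> (pt_norm q A))) = tilde_norm"
    by (rule ext) (simp add: tilde_norm_def)
  \<comment> \<open>\<open>tilde_norm\<close> generates the topology whose completeness is already
    known, so completeness is inherited.\<close>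
  have iv: "quasi_banach L\<rho> tilde_norm" if "pseudo_homogeneous_origin M \<rho>"
    unfolding quasi_banach_def tilde_norm_topology[OF that]
    using vspace_L\<rho> quasi_norm_tilde_norm[OF that] i(2) by blast
  show ?thesis
    unfolding L_topology_rho(1) L_topology_bar(1,2) tilde_norm_eq
    by (intro conjI impI allI ballI refl i L_topology_rho(2) L_topology_bar(3) carrier_infinity basis_infinity)
      (simp_all add: L_topology_tilde tilde_norm_topology iv gauge_tilde_N_finite[unfolded infinity_ennreal_def] locally_p_convex_L\<rho> del: L_space_simps)
qed

end
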